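(* Let $\Sigma=\{y+\sqrt{3}\,x=0\}$. For $|\varepsilon|>0$ sufficiently small, the maximum number of limit cycles that the piecewise quadratic perturbation $Z_{2,\varepsilon}$ of the quadratic isochronous center $\dot x=-y+x^2,\ \dot y=x+xy$, with curve of discontinuity $\Sigma$, can have in any neighborhood of the origin is at least $16$. That is, for every neighborhood $U$ of the origin there is $\varepsilon_0>0$ such that for every $\varepsilon$ with $0<|\varepsilon|<\varepsilon_0$ there is a choice of the perturbation polynomials $P_k^\pm,Q_k^\pm$ ($k=1,2$) of degree at most $2$ for which $Z_{2,\varepsilon}$ has at least $16$ crossing limit cycles contained in $U$.
   Context: Let $h$ be a linear form with $\Sigma=\{h=0\}$. Let $Z_{2,\varepsilon}$ be the piecewise vector field equal to $(-y+x^2,\;x+xy)+\varepsilon(P_1^{\pm},Q_1^{\pm})+\varepsilon^2(P_2^{\pm},Q_2^{\pm})$ on $\{\pm h>0\}$, where $P_k^\pm(x,y)=\sum_{0\le i+j\le 2}p^\pm_{k,i,j}x^iy^j$ and $Q_k^\pm(x,y)=\sum_{0\le i+j\le 2}q^\pm_{k,i,j}x^iy^j$ are arbitrary real polynomials of degree at most $2$; the maximum is taken over all choices of these polynomials. Writing $Z^\pm$ for the two vector fields and $Z^{\pm}h(p)=\langle\nabla h(p),Z^{\pm}(p)\rangle$, a point $p\in\Sigma$ is a crossing point if $Z^+h(p)\cdot Z^-h(p)>0$. A crossing periodic orbit is a closed orbit formed by concatenating arcs of trajectories of $Z^+$ in $\{h>0\}$ and of $Z^-$ in $\{h<0\}$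 and meeting $\Sigma$ (at least once) only at crossing points; a crossing limit cycle is a crossing periodic orbit isolated in the set of periodic orbits. *)

theory Defs
  imports "HOL-Analysis.Analysis"
begin

type_synonym plane = "real \<times> real"

definition gradient :: "(plane \<Rightarrow> real) \<Rightarrow> plane \<Rightarrow> plane" where
  "gradient h p = (THE D. GDERIV h p :> D)"

definition lie_derivative :: "(plane \<Rightarrow> plane) \<Rightarrow> (plane \<Rightarrow> real) \<Rightarrow> plane \<Rightarrow> real" where
  "lie_derivative Z h p = gradient h p \<bullet> Z p"

definition crossing_point ::
  "(plane \<Rightarrow> real) \<Rightarrow> (plane \<Rightarrow> plane) \<Rightarrow> (plane \<Rightarrow> plane) \<Rightarrow> plane \<Rightarrow> bool" where
  "crossing_point h Zp Zm p \<longleftrightarrow>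
     h p = 0 \<and> lie_derivative Zp h p * lie_derivative Zm h p > 0"

text \<open>
  A closed orbit is the image of a nonconstant continuous periodic curve. The finitely many
  zeros of \<open>h \<circ> \<gamma>\<close> in one period cut the curve into arcs; between two consecutive zeros
  \<open>h \<circ> \<gamma>\<close> has constant sign, so each arc is a trajectory of \<open>Zp\<close> in \<open>{h > 0}\<close> or of \<open>Zm\<close> in
  \<open>{h < 0}\<close>. Without the finiteness condition the curve could rest on, or move along,
  the discontinuity set \<open>{h = 0}\<close>. The orbit need not meet \<open>{h = 0}\<close>.
\<close>
definition periodic_orbit ::
  "(plane \<Rightarrow> real) \<Rightarrow> (plane \<Rightarrow> plane) \<Rightarrow> (plane \<Rightarrow> plane) \<Rightarrow> plane set \<Rightarrow> bool" where
  "periodic_orbit h Zp Zm \<Gamma> \<longleftrightarrow>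
     (\<exists>(\<gamma> :: real \<Rightarrow> plane) T. T > 0 \<and> continuous_on UNIV \<gamma> \<and> (\<forall>t. \<gamma> (t + T) = \<gamma> t) \<and>
        range \<gamma> = \<Gamma> \<and> (\<forall>p. \<Gamma> \<noteq> {p}) \<and>
        finite {t \<in> {0..T}. h (\<gamma> t) = 0} \<and>
        (\<forall>t. h (\<gamma> t) > 0 \<longrightarrow> (\<gamma> has_vector_derivative Zp (\<gamma> t)) (at t)) \<and>
        (\<forall>t. h (\<gamma> t) < 0 \<longrightarrow> (\<gamma> has_vector_derivative Zm (\<gamma> t)) (at t)) \<and>
        (\<forall>t. h (\<gamma> t) = 0 \<longrightarrow> crossing_point h Zp Zm (\<gamma> t)))"

definition crossing_periodic_orbit ::
  "(plane \<Rightarrow> real) \<Rightarrow> (plane \<Rightarrow> plane) \<Rightarrow> (plane \<Rightarrow> plane) \<Rightarrow> plane set \<Rightarrow> bool" where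
  "crossing_periodic_orbit h Zp Zm \<Gamma> \<longleftrightarrow>
     periodic_orbit h Zp Zm \<Gamma> \<and> (\<exists>p\<in>\<Gamma>. h p = 0)"

text \<open>
  Isolation is among all periodic orbits, including those that stay in \<open>{h > 0}\<close> or in \<open>{h < 0}\<close>.
\<close>
definition crossing_limit_cycle ::
  "(plane \<Rightarrow> real) \<Rightarrow> (plane \<Rightarrow> plane) \<Rightarrow> (plane \<Rightarrow> plane) \<Rightarrow> plane set \<Rightarrow> bool" where
  "crossing_limit_cycle h Zp Zm \<Gamma> \<longleftrightarrow>
     crossing_periodic_orbit h Zp Zm \<Gamma> \<and>
     (\<exists>V. open V \<and> \<Gamma> \<subseteq> V \<and> (\<forall>\<Gamma>'. periodic_orbit h Zp Zm \<Gamma>' \<and> \<Gamma>' \<subseteq> V \<longrightarrow> \<Gamma>' = \<Gamma>))"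

definition bipoly :: "nat \<Rightarrow> (nat \<Rightarrow> nat \<Rightarrow> real) \<Rightarrow> real \<Rightarrow> real \<Rightarrow> real" where
  "bipoly n c x y = (\<Sum>(i, j) | i + j \<le> n. c i j * x ^ i * y ^ j)"

text \<open>
  One branch of the second order quadratic perturbation of the isochronous center:
  \<open>p k\<close> and \<open>q k\<close> (for \<open>k = 1, 2\<close>) are the coefficients of the polynomials at \<open>\<epsilon> ^ k\<close>.
\<close>
definition quad_field ::
  "real \<Rightarrow> (nat \<Rightarrow> nat \<Rightarrow> nat \<Rightarrow> real) \<Rightarrow> (nat \<Rightarrow> nat \<Rightarrow> nat \<Rightarrow> real) \<Rightarrow> plane \<Rightarrow> plane" where
  "quad_field \<epsilon> p q = (\<lambda>(x, y).
     (- y + x\<^sup>2 + (\<Sum>k = 1..2. \<epsilon> ^ k * bipoly 2 (p k) x y),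
      x + x * y + (\<Sum>k = 1..2. \<epsilon> ^ k * bipoly 2 (q k) x y)))"

definition h_line :: "plane \<Rightarrow> real" where
  "h_line = (\<lambda>(x, y). y + sqrt 3 * x)"

lemma gradient_inner: "gradient (\<lambda>p. v \<bullet> p) p = v"
proof -
  have ex: "GDERIV (\<lambda>p. v \<bullet> p) p :> v"
    unfolding gderiv_def by (simp only: inner_commute[of _ v]) (rule bounded_linear_imp_has_derivative[OF bounded_linear_inner_right])
  have uniq: "D = v" if "GDERIV (\<lambda>p. v \<bullet> p) p :> D" for D
  proof -
    have "(\<lambda>w. w \<bullet> D) = (\<lambda>w. w \<bullet> v)"
      using has_derivative_unique[OF that[unfolded gderiv_def] ex[unfolded gderiv_def]] .
    then have "(D - v) \<bullet> D = (D - v) \<bullet> v"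
      by (rule fun_cong)
    then have "(D - v) \<bullet> (D - v) = 0"
      by (simp only: inner_diff_right diff_self)
    then show "D = v"
      by (simp only: inner_eq_zero_iff right_minus_eq)
  qed
  show ?thesis
    unfolding gradient_def by (rule the_equality[where P = "\<lambda>D. GDERIV (\<lambda>p. v \<bullet> p) p :> D", OF ex uniq])
qed

lemma gradient_h_line: "gradient h_line p = (sqrt 3, 1)"
proof -
  have h: "h_line = (\<lambda>p. (sqrt 3, 1) \<bullet> p)"
    by (auto simp: h_line_def)
  show ?thesis
    by (subst h) (rule gradient_inner)
qed

end

theory Submission
  imports Defs "HOL-Complex_Analysis.Complex_Analysis"
begin

text \<open>
  The perturbation may be chosen after \<open>\<epsilon>\<close>, and \<open>(F - F\<^sub>0) / \<epsilon>\<close> is a quadratic polynomial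
  whenever \<open>F\<close> and the unperturbed \<open>F\<^sub>0\<close> are. Hence every pair of quadratic vector fields is a
  member of the family, for every \<open>\<epsilon> \<noteq> 0\<close>. Linear maps and homotheties preserve quadratic fields,
  so it suffices to find one pair of quadratic fields, above and below the line \<open>y = 0\<close>, with
  sixteen crossing limit cycles: a shear moves the line to \<open>\<Sigma>\<close> and a homothety moves the
  cycles into \<open>U\<close> (lemma \<open>realize\<close>).

  The pair consists of two fold-fold fields of the same normal form, with coefficients \<open>z\<close> and
  \<open>w\<close>. Both have \<open>P < 0\<close> near the origin, so an orbit above the axis is the graph of a solution
  of \<open>y' = Q / P\<close>; \<open>hit z u\<close> is its height over \<open>x = 0\<close> when it ends at \<open>(u, 0)\<close>. An orbit
  arc joins \<open>(b, 0)\<close> to \<open>(a, 0)\<close>, where \<open>a < 0 < b\<close>, iff \<open>hit z a = hit z b\<close>. The lower field is the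
  time-reversed mirror image of the field with coefficients \<open>w\<close>, moved by \<open>c\<close>. So cycles are
  solutions of \<open>hit z a = hit z b\<close> and \<open>hit w (a - c) = hit w (b - c)\<close>: eliminating \<open>a\<close>, zeros of
  a function \<open>gap\<close> of \<open>b\<close>.

  Every zero of \<open>gap\<close> is isolated as soon as \<open>gap\<close> is not identically zero, because the
  solution depends holomorphically on a complex \<open>u\<close> (Picard iteration, lemma \<open>flow_holomorphic\<close>)
  and \<open>hit z\<close> has nonzero derivative. An isolated zero gives an isolated periodic orbit: the
  first return map of any nearby periodic orbit is strictly increasing on a finite set, hence the
  identity (lemma \<open>cycle_isolated\<close>). So sixteen sign changes of \<open>gap\<close> suffice.

  The fields are chosen so that \<open>gap\<close> alternates in sign at seventeen explicit points. The amplitude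
  is of order \<open>2 ^ -145\<close>, since sixteen is the number of essential parameters of the pair. The signs are
  proved with a polynomial \<open>F\<close> with integer coefficients which is almost a first integral: the
  coefficients are computed by the recursion for a formal first integral, rounding at each
  step, so that \<open>P F\<^sub>x + Q F\<^sub>y\<close> has coefficients of a few units. Along an orbit
  \<open>F\<close> is then constant up to a small multiple of the length (lemma \<open>certified_hit\<close>). Since
  \<open>F(0, y) = 2 ^ K y\<close>, the number \<open>F(u, 0)\<close> is \<open>2 ^ K hit z u\<close> up to that error, and
  evaluating it reduces each sign to a comparison of integers.
\<close>

section \<open>Normal form and slope estimates\<close>

text \<open>
  The slope field \<open>fS\<close> is also needed at complex arguments, to obtain solutions that are holomorphic in
  the initial point.
\<close>
definition fP :: "(nat \<Rightarrow> real) \<Rightarrow> 'a::real_normed_field \<Rightarrow> 'a \<Rightarrow> 'a" where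
  "fP z x y = - 1 + of_real (z 0) * x + of_real (z 1) * y + of_real (z 2) * x^2 + of_real (z 3) * (x * y) + of_real (z 4) * y^2"
definition fQ :: "(nat \<Rightarrow> real) \<Rightarrow> 'a::real_normed_field \<Rightarrow> 'a \<Rightarrow> 'a" where
  "fQ z x y = 2 * x + of_real (z 5) * x^2 + of_real (z 6) * (x * y) + of_real (z 7) * y^2"
definition fS :: "(nat \<Rightarrow> real) \<Rightarrow> 'a::real_normed_field \<Rightarrow> 'a \<Rightarrow> 'a" where
  "fS z x y = fQ z x y / fP z x y"

text \<open>
  These bounds hold for both explicit fields. On \<open>\<bar>x\<bar> \<le> 9/10\<close>, \<open>\<bar>y\<bar> \<le> 5/2\<close> they keep \<open>P\<close> away
  from zero and make \<open>Q / P\<close> a contraction in \<open>y\<close> over the whole range of \<open>x\<close>, so that one Picard iteration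
  covers the domain.
\<close>
definition small_coeffs :: "(nat \<Rightarrow> real) \<Rightarrow> bool" where
  "small_coeffs z \<longleftrightarrow> \<bar>z 0\<bar> \<le> 16/100 \<and> \<bar>z 1\<bar> \<le> 2/100 \<and> \<bar>z 2\<bar> \<le> 4/100 \<and> \<bar>z 3\<bar> \<le> 2/1000 \<and> \<bar>z 4\<bar> \<le> 1/1000
    \<and> \<bar>z 5\<bar> \<le> 2/10 \<and> \<bar>z 6\<bar> \<le> 4/100 \<and> \<bar>z 7\<bar> \<le> 2/1000"

lemma norm_coeff_le:
  fixes a :: "'a::real_normed_field"
  shows "\<bar>c\<bar> \<le> C \<Longrightarrow> norm a \<le> A \<Longrightarrow> norm (of_real c * a) \<le> C * A"
  by (auto simp: norm_mult intro!: mult_mono)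

lemma norm_fP_diff:
  fixes x y :: "'a::real_normed_field"
  assumes z: "small_coeffs z" and x: "norm x \<le> 9/10" and y: "norm y \<le> 5/2"
  shows "norm (fP z x y + 1) \<le> 1/4"
proof -
  have x2: "norm (x^2) \<le> 81/100" using power_mono[OF x, of 2] by (simp add: norm_power power2_eq_square norm_mult)
  have y2: "norm (y^2) \<le> 25/4" using power_mono[OF y, of 2] by (simp add: norm_power power2_eq_square norm_mult)
  have xy: "norm (x*y) \<le> 9/10*(5/2)" unfolding norm_mult by (intro mult_mono x y) auto
  have "norm (fP z x y + 1) = norm (of_real (z 0) * x + of_real (z 1) * y + of_real (z 2) * x^2 + of_real (z 3) * (x * y) + of_real (z 4) * y^2)"
    by (simp add: fP_def add.assoc)
  also have "\<dots> \<le> 16/100*(9/10) + 2/100*(5/2) + 4/100*(81/100) + 2/1000*(9/10*(5/2)) + 1/1000*(25/4)"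
    by (intro norm_triangle_mono norm_coeff_le x y x2 y2 xy) (use z in \<open>auto simp: small_coeffs_def\<close>)
  finally show ?thesis by simp
qed

lemma norm_fP_ge:
  fixes x y :: "'a::real_normed_field"
  assumes "small_coeffs z" "norm x \<le> 9/10" "norm y \<le> 5/2"
  shows "norm (fP z x y) \<ge> 3/4"
  using norm_fP_diff[OF assms] norm_triangle_ineq4[of "fP z x y + 1" "fP z x y"] by simp

lemma fP_neg:
  fixes x y :: real
  assumes "small_coeffs z" "\<bar>x\<bar> \<le> 9/10" "\<bar>y\<bar> \<le> 5/2"
  shows "fP z x y \<le> -3/4"
proof -
  have "\<bar>fP z x y + 1\<bar> \<le> 1/4" using norm_fP_diff[of z x y] assms by simp
  then show ?thesis by linarith
qed

lemma norm_fQ_le: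
  fixes x y :: "'a::real_normed_field"
  assumes z: "small_coeffs z" and x: "norm x \<le> 9/10" and y: "norm y \<le> 5/2"
  shows "norm (fQ z x y) \<le> 207/100"
proof -
  have x2: "norm (x^2) \<le> 81/100" using power_mono[OF x, of 2] by (simp add: norm_power power2_eq_square norm_mult)
  have y2: "norm (y^2) \<le> 25/4" using power_mono[OF y, of 2] by (simp add: norm_power power2_eq_square norm_mult)
  have xy: "norm (x*y) \<le> 9/10*(5/2)" unfolding norm_mult by (intro mult_mono x y) auto
  have 2: "norm (2*x) \<le> 18/10" using x by (simp add: norm_mult)
  have "norm (fQ z x y) \<le> 18/10 + 2/10*(81/100) + 4/100*(9/10*(5/2)) + 2/1000*(25/4)"
    unfolding fQ_def
    by (intro norm_triangle_mono norm_coeff_le 2 y x2 y2 xy) (use z in \<open>auto simp: small_coeffs_def\<close>)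
  also have "\<dots> \<le> 207/100" by simp
  finally show ?thesis .
qed

lemma norm_fS_le:
  fixes x y :: "'a::real_normed_field"
  assumes "small_coeffs z" "norm x \<le> 9/10" "norm y \<le> 5/2"
  shows "norm (fS z x y) \<le> 276/100"
proof -
  have "norm (fQ z x y) / norm (fP z x y) \<le> (207/100) / (3/4)"
    using norm_fP_ge[OF assms] norm_fQ_le[OF assms] by (intro frac_le) auto
  then show ?thesis by (simp add: fS_def norm_divide)
qed

lemma fS_Lipschitz:
  fixes x y y' :: "'a::real_normed_field"
  assumes z: "small_coeffs z" and x: "norm x \<le> 9/10" and y: "norm y \<le> 5/2" and y': "norm y' \<le> 5/2"
  shows "norm (fS z x y - fS z x y') \<le> 1/5 * norm (y - y')"
proof -
  let ?d = "norm (y - y')"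
  have s: "norm (y + y') \<le> 5" using norm_triangle_ineq[of y y'] y y' by linarith
  have Pd: "norm (fP z x y' - fP z x y) \<le> 27/1000 * ?d"
  proof -
    have "fP z x y' - fP z x y = (of_real (z 1) * 1 + of_real (z 3) * x + of_real (z 4) * (y+y')) * (y'-y)"
      by (simp add: fP_def power2_eq_square algebra_simps)
    moreover have "norm (of_real (z 1) * 1 + of_real (z 3) * x + of_real (z 4) * (y+y')) \<le> 2/100*1 + 2/1000*(9/10) + 1/1000*5"
      by (intro norm_triangle_mono norm_coeff_le x s) (use z in \<open>auto simp: small_coeffs_def\<close>)
    ultimately have "norm (fP z x y' - fP z x y) \<le> (2/100*1 + 2/1000*(9/10) + 1/1000*5) * norm (y' - y)"
      by (simp only: norm_mult mult_right_mono norm_ge_zero)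
    also have "\<dots> \<le> 27/1000 * norm (y' - y)" by (intro mult_right_mono) auto
    finally show ?thesis by (simp add: norm_minus_commute)
  qed
  have Qd: "norm (fQ z x y - fQ z x y') \<le> 46/1000 * ?d"
  proof -
    have "fQ z x y - fQ z x y' = (of_real (z 6) * x + of_real (z 7) * (y+y')) * (y-y')"
      by (simp add: fQ_def power2_eq_square algebra_simps)
    moreover have "norm (of_real (z 6) * x + of_real (z 7) * (y+y')) \<le> 4/100*(9/10) + 2/1000*5"
      by (intro norm_triangle_mono norm_coeff_le x s) (use z in \<open>auto simp: small_coeffs_def\<close>)
    ultimately have "norm (fQ z x y - fQ z x y') \<le> (4/100*(9/10) + 2/1000*5) * norm (y - y')"
      by (simp only: norm_mult mult_right_mono norm_ge_zero)
    then show ?thesis by simp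
  qed
  have P: "norm (fP z x y) \<ge> 3/4" "norm (fP z x y') \<ge> 3/4" using norm_fP_ge assms by blast+
  then have nz: "fP z x y \<noteq> 0" "fP z x y' \<noteq> 0" by auto
  have "fS z x y - fS z x y' = (fQ z x y - fQ z x y') / fP z x y + fS z x y' * ((fP z x y' - fP z x y) / fP z x y)"
    using nz by (simp add: fS_def divide_simps) (simp add: algebra_simps)
  also have "norm \<dots> \<le> (46/1000 * ?d) / (3/4) + 276/100 * ((27/1000 * ?d) / (3/4))"
  proof (rule norm_triangle_mono)
    show "norm ((fQ z x y - fQ z x y') / fP z x y) \<le> (46/1000 * ?d) / (3/4)"
      unfolding norm_divide by (rule frac_le) (use Qd P in auto)
    have "norm ((fP z x y' - fP z x y) / fP z x y) \<le> (27/1000 * ?d) / (3/4)"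
      unfolding norm_divide by (rule frac_le) (use Pd P in auto)
    then show "norm (fS z x y' * ((fP z x y' - fP z x y) / fP z x y)) \<le> 276/100 * ((27/1000 * ?d) / (3/4))"
      unfolding norm_mult by (intro mult_mono norm_fS_le z x y') auto
  qed
  also have "\<dots> \<le> 1/5 * ?d" by (simp add: field_simps)
  finally show ?thesis .
qed

section \<open>Families depending holomorphically on a parameter\<close>

abbreviation "Disc \<equiv> ball (0::complex) (9/10)"

text \<open>
  Joint continuity of the parameter derivative is part of the notion, because differentiation under
  the integral sign in the Picard operator requires it.
\<close>
definition hol_family :: "(complex \<Rightarrow> real \<Rightarrow> complex) \<Rightarrow> bool" where
  "hol_family g \<longleftrightarrow> (\<exists>g'. continuous_on (Disc \<times> {0..1}) (\<lambda>(u,s). g u s) \<and> continuous_on (Disc \<times> {0..1}) (\<lambda>(u,s). g' u s) \<and>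
     (\<forall>u\<in>Disc. \<forall>s\<in>{0..1}. ((\<lambda>u. g u s) has_field_derivative g' u s) (at u within Disc)))"

lemma hol_familyE:
  assumes "hol_family g"
  obtains g' where "continuous_on (Disc \<times> {0..1}) (\<lambda>(u,s). g u s)" "continuous_on (Disc \<times> {0..1}) (\<lambda>(u,s). g' u s)"
    "\<And>u s. u \<in> Disc \<Longrightarrow> s \<in> {0..1} \<Longrightarrow> ((\<lambda>u. g u s) has_field_derivative g' u s) (at u within Disc)"
  using assms unfolding hol_family_def by blast

lemma hol_family_s: "continuous_on {0..1} c \<Longrightarrow> hol_family (\<lambda>u s. c s)"
  unfolding hol_family_def
  by (rule exI[of _ "\<lambda>u s. 0"]) (auto simp: case_prod_unfold intro!: continuous_intros continuous_on_compose2[of "{0..1}" c])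

lemma hol_family_u: "hol_family (\<lambda>u s. u)"
  unfolding hol_family_def
  by (rule exI[of _ "\<lambda>u s. 1"]) (auto simp: case_prod_unfold intro!: continuous_intros derivative_intros)

lemma hol_family_add: assumes "hol_family f" "hol_family g" shows "hol_family (\<lambda>u s. f u s + g u s)"
proof -
  from hol_familyE[OF assms(1)] obtain f' where f: "continuous_on (Disc \<times> {0..1}) (\<lambda>(u,s). f u s)" "continuous_on (Disc \<times> {0..1}) (\<lambda>(u,s). f' u s)"
    "\<And>u s. u \<in> Disc \<Longrightarrow> s \<in> {0..1} \<Longrightarrow> ((\<lambda>u. f u s) has_field_derivative f' u s) (at u within Disc)" by metis
  from hol_familyE[OF assms(2)] obtain g' where g: "continuous_on (Disc \<times> {0..1}) (\<lambda>(u,s). g u s)" "continuous_on (Disc \<times> {0..1}) (\<lambda>(u,s). g' u s)"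
    "\<And>u s. u \<in> Disc \<Longrightarrow> s \<in> {0..1} \<Longrightarrow> ((\<lambda>u. g u s) has_field_derivative g' u s) (at u within Disc)" by metis
  show ?thesis unfolding hol_family_def
    by (rule exI[of _ "\<lambda>u s. f' u s + g' u s"])
      (use f g in \<open>auto simp: case_prod_unfold intro!: continuous_intros derivative_eq_intros\<close>)
qed

lemma hol_family_mult: assumes "hol_family f" "hol_family g" shows "hol_family (\<lambda>u s. f u s * g u s)"
proof -
  from hol_familyE[OF assms(1)] obtain f' where f: "continuous_on (Disc \<times> {0..1}) (\<lambda>(u,s). f u s)" "continuous_on (Disc \<times> {0..1}) (\<lambda>(u,s). f' u s)"
    "\<And>u s. u \<in> Disc \<Longrightarrow> s \<in> {0..1} \<Longrightarrow> ((\<lambda>u. f u s) has_field_derivative f' u s) (at u within Disc)" by metis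
  from hol_familyE[OF assms(2)] obtain g' where g: "continuous_on (Disc \<times> {0..1}) (\<lambda>(u,s). g u s)" "continuous_on (Disc \<times> {0..1}) (\<lambda>(u,s). g' u s)"
    "\<And>u s. u \<in> Disc \<Longrightarrow> s \<in> {0..1} \<Longrightarrow> ((\<lambda>u. g u s) has_field_derivative g' u s) (at u within Disc)" by metis
  show ?thesis unfolding hol_family_def
    by (rule exI[of _ "\<lambda>u s. f' u s * g u s + f u s * g' u s"])
      (use f g DERIV_mult'[OF f(3) g(3)] in \<open>auto simp: case_prod_unfold add.commute intro!: continuous_intros\<close>)
qed

lemma hol_family_inverse: assumes "hol_family g" and nz: "\<And>u s. u \<in> Disc \<Longrightarrow> s \<in> {0..1} \<Longrightarrow> g u s \<noteq> 0"
  shows "hol_family (\<lambda>u s. inverse (g u s))"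
proof -
  from hol_familyE[OF assms(1)] obtain g' where g: "continuous_on (Disc \<times> {0..1}) (\<lambda>(u,s). g u s)" "continuous_on (Disc \<times> {0..1}) (\<lambda>(u,s). g' u s)"
    "\<And>u s. u \<in> Disc \<Longrightarrow> s \<in> {0..1} \<Longrightarrow> ((\<lambda>u. g u s) has_field_derivative g' u s) (at u within Disc)" by metis
  have nz': "\<forall>p\<in>Disc \<times> {0..1}. g (fst p) (snd p) \<noteq> 0" using nz by auto
  show ?thesis unfolding hol_family_def
  proof (rule exI[of _ "\<lambda>u s. - (inverse (g u s) * g' u s * inverse (g u s))"], intro conjI ballI)
    show "continuous_on (Disc \<times> {0..1}) (\<lambda>(u,s). inverse (g u s))"
      using g nz' by (simp add: case_prod_unfold continuous_on_inverse)
    then show "continuous_on (Disc \<times> {0..1}) (\<lambda>(u,s). - (inverse (g u s) * g' u s * inverse (g u s)))"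
      using g(2) by (auto simp: case_prod_unfold intro!: continuous_intros)
    fix u s assume "u \<in> Disc" "s \<in> {0..1::real}"
    then show "((\<lambda>u. inverse (g u s)) has_field_derivative - (inverse (g u s) * g' u s * inverse (g u s))) (at u within Disc)"
      using DERIV_inverse'[OF g(3)] nz by blast
  qed
qed

lemma hol_family_average: assumes "hol_family g"
  shows "hol_family (\<lambda>u s. integral {0..1} (\<lambda>r. g u (s * r)))"
proof -
  from hol_familyE[OF assms(1)] obtain g' where g: "continuous_on (Disc \<times> {0..1}) (\<lambda>(u,s). g u s)" "continuous_on (Disc \<times> {0..1}) (\<lambda>(u,s). g' u s)"
    "\<And>u s. u \<in> Disc \<Longrightarrow> s \<in> {0..1} \<Longrightarrow> ((\<lambda>u. g u s) has_field_derivative g' u s) (at u within Disc)" by metis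
  have c: "continuous_on (Disc \<times> {0..1}) (\<lambda>(u,s). integral {0..1} (\<lambda>r. k u (s * r)))"
    if "continuous_on (Disc \<times> {0..1}) (\<lambda>(u,s). k u s)" for k :: "complex \<Rightarrow> real \<Rightarrow> complex"
  proof -
    have "continuous_on (Disc \<times> {0..1::real}) (\<lambda>p. integral (cbox 0 1) (\<lambda>r. k (fst p) (snd p * r)))"
      by (rule integral_continuous_on_param)
        (auto simp: case_prod_unfold mult_le_one intro!: continuous_intros continuous_on_compose2[OF that[unfolded case_prod_unfold], where f = "\<lambda>q. (fst (fst q), snd (fst q) * snd q)", simplified])
    then show ?thesis by (simp add: case_prod_unfold)
  qed
  show ?thesis unfolding hol_family_def
  proof (rule exI[of _ "\<lambda>u s. integral {0..1} (\<lambda>r. g' u (s * r))"], intro conjI ballI c g)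
    fix u s assume u: "u \<in> Disc" and s: "s \<in> {0..1::real}"
    have "((\<lambda>u. integral (cbox 0 1) (\<lambda>r. g u (s * r))) has_field_derivative integral (cbox 0 1) (\<lambda>r. g' u (s * r))) (at u within Disc)"
    proof (rule leibniz_rule_field_derivative[OF _ _ _ u])
      show "((\<lambda>x. g x (s * t)) has_field_derivative g' x (s * t)) (at x within Disc)"
        if "x \<in> Disc" "t \<in> cbox 0 1" for x t
        using g(3) that s by (auto simp: mult_le_one)
      show "(\<lambda>r. g x (s * r)) integrable_on cbox 0 1" if "x \<in> Disc" for x
        by (rule integrable_continuous)
          (use s that in \<open>auto simp: mult_le_one intro!: continuous_intros continuous_on_compose2[OF g(1)[unfolded case_prod_unfold], where f = "\<lambda>r. (x, s * r)", simplified]\<close>)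
      show "continuous_on (Disc \<times> cbox 0 1) (\<lambda>(x, t). g' x (s * t))"
        unfolding case_prod_unfold
        by (use s in \<open>auto simp: mult_le_one intro!: continuous_intros continuous_on_compose2[OF g(2)[unfolded case_prod_unfold], where f = "\<lambda>q. (fst q, s * snd q)", simplified]\<close>)
    qed auto
    then show "((\<lambda>u. integral {0..1} (\<lambda>r. g u (s * r))) has_field_derivative integral {0..1} (\<lambda>r. g' u (s * r))) (at u within Disc)"
      by simp
  qed
qed

section \<open>Picard iteration with a complex parameter\<close>

lemma hol_family_fS:
  assumes z: "small_coeffs z" and c: "continuous_on {0..1} c" "\<And>s. s \<in> {0..1} \<Longrightarrow> norm (c s) \<le> 1"
    and g: "hol_family g" "\<And>u s. u \<in> Disc \<Longrightarrow> s \<in> {0..1} \<Longrightarrow> norm (g u s) \<le> 5/2"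
  shows "hol_family (\<lambda>u s. fS z (u * c s) (g u s))"
proof -
  have x: "norm (u * c s) \<le> 9/10" if "u \<in> Disc" "s \<in> {0..1}" for u s
    using mult_mono[of "norm u" "9/10" "norm (c s)" 1] c(2)[OF that(2)] that by (simp add: norm_mult)
  have k: "hol_family (\<lambda>u s. k)" for k by (rule hol_family_s) auto
  have uc: "hol_family (\<lambda>u s. u * c s)" by (intro hol_family_mult hol_family_u hol_family_s c)
  have P: "hol_family (\<lambda>u s. fP z (u * c s) (g u s))"
    unfolding fP_def power2_eq_square by (intro hol_family_add hol_family_mult uc k g)
  have Q: "hol_family (\<lambda>u s. fQ z (u * c s) (g u s))"
    unfolding fQ_def power2_eq_square by (intro hol_family_add hol_family_mult uc k g)
  have "fP z (u * c s) (g u s) \<noteq> 0" if "u \<in> Disc" "s \<in> {0..1}" for u s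
    using norm_fP_ge[OF z x[OF that] g(2)[OF that]] by auto
  then show ?thesis unfolding fS_def divide_inverse
    by (intro hol_family_mult Q hol_family_inverse P) auto
qed

text \<open>
  With \<open>x = u (1 - s)\<close> the equation \<open>y' = fS z x y\<close>, \<open>y(u) = 0\<close> becomes \<open>dY/ds = - u fS z (u (1 - s)) Y\<close>,
  \<open>Y(0) = 0\<close>, on a fixed interval for every complex \<open>u\<close>. The substitution \<open>s r\<close> fixes the limits of the
  integral, which makes it holomorphic in \<open>u\<close> for each \<open>s\<close>.
\<close>
definition picard :: "(nat \<Rightarrow> real) \<Rightarrow> (complex \<Rightarrow> real \<Rightarrow> complex) \<Rightarrow> complex \<Rightarrow> real \<Rightarrow> complex" where
  "picard z g u s = - (u * of_real s) * integral {0..1} (\<lambda>r. fS z (u * of_real (1 - s * r)) (g u (s * r)))"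

definition bounded_family :: "(complex \<Rightarrow> real \<Rightarrow> complex) \<Rightarrow> bool" where
  "bounded_family g \<longleftrightarrow> continuous_on (Disc \<times> {0..1}) (\<lambda>(u,s). g u s) \<and> (\<forall>u\<in>Disc. \<forall>s\<in>{0..1}. norm (g u s) \<le> 249/100)"

lemma picard_integrand:
  assumes z: "small_coeffs z" and g: "bounded_family g" and u: "u \<in> Disc" and s: "s \<in> {0..1}"
  shows "continuous_on {0..1} (\<lambda>r. fS z (u * of_real (1 - r)) (g u r))"
    "continuous_on {0..1} (\<lambda>r. fS z (u * of_real (1 - s * r)) (g u (s * r)))"
    "r \<in> {0..1} \<Longrightarrow> norm (u * of_real (1 - r)) \<le> 9/10"
proof -
  have x: "norm (u * of_real (1 - r)) \<le> 9/10" if "r \<in> {0..1}" for r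
  proof -
    have "norm (complex_of_real (1 - r)) = 1 - r" using that by (simp only: norm_of_real) auto
    then show ?thesis using mult_mono[of "norm u" "9/10" "1-r" 1] that u by (simp add: norm_mult)
  qed
  have c: "continuous_on {0..1} (g u)"
    by (rule continuous_on_compose2[of "Disc \<times> {0..1}" "\<lambda>(u,s). g u s" _ "\<lambda>r. (u, r)", simplified])
      (use g u in \<open>auto simp: bounded_family_def intro!: continuous_intros\<close>)
  have nz: "fP z (u * of_real (1 - r)) (g u r) \<noteq> 0" if "r \<in> {0..1}" for r
  proof -
    have "norm (g u r) \<le> 249/100" using g that u by (auto simp: bounded_family_def)
    then show ?thesis using norm_fP_ge[OF z x[OF that], of "g u r"] by auto
  qed
  show 1: "continuous_on {0..1} (\<lambda>r. fS z (u * of_real (1 - r)) (g u r))"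
    unfolding fS_def using nz c by (auto simp: fP_def fQ_def intro!: continuous_intros)
  show "continuous_on {0..1} (\<lambda>r. fS z (u * of_real (1 - s * r)) (g u (s * r)))"
    by (rule continuous_on_compose2[OF 1, of "{0..1}" "\<lambda>r. s * r"])
      (use s in \<open>auto simp: mult_le_one intro!: continuous_intros\<close>)
  show "r \<in> {0..1} \<Longrightarrow> norm (u * of_real (1 - r)) \<le> 9/10" by (rule x)
qed

lemma picard_eq_integral:
  assumes z: "small_coeffs z" and g: "bounded_family g" and u: "u \<in> Disc" and s: "s \<in> {0..1}"
  shows "picard z g u s = - u * integral {0..s} (\<lambda>r. fS z (u * of_real (1 - r)) (g u r))"
proof (cases "s = 0")
  case False
  then have s0: "s > 0" using s by auto
  let ?F = "\<lambda>r. fS z (u * of_real (1 - r)) (g u r)"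
  have "?F integrable_on {0..s}"
    by (rule integrable_continuous_real, rule continuous_on_subset[OF picard_integrand(1)[OF z g u s]]) (use s in auto)
  then have "(?F has_integral integral {0..s} ?F) (cbox 0 s)" by (simp add: integrable_integral)
  from has_integral_affinity[OF this, of s 0] s0
  have "((\<lambda>r. ?F (s * r)) has_integral (1/s) *\<^sub>R integral {0..s} ?F) {0..1}"
    by (simp add: image_affinity_cbox)
  then have "integral {0..1} (\<lambda>r. ?F (s * r)) = (1/s) *\<^sub>R integral {0..s} ?F"
    by (rule integral_unique)
  then show ?thesis unfolding picard_def using s0 by (simp add: scaleR_conv_of_real)
qed (simp add: picard_def)

lemma picard_bound:
  assumes z: "small_coeffs z" and g: "bounded_family g" and u: "u \<in> Disc" and s: "s \<in> {0..1}"
  shows "norm (picard z g u s) \<le> 249/100"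
proof -
  have "norm (integral (cbox 0 1) (\<lambda>r. fS z (u * of_real (1 - s * r)) (g u (s * r)))) \<le> 276/100 * measure lborel (cbox 0 (1::real))"
  proof (rule integrable_bound)
    show "(\<lambda>r. fS z (u * of_real (1 - s * r)) (g u (s * r))) integrable_on cbox 0 1"
      using integrable_continuous_real[OF picard_integrand(2)[OF z g u s]] by simp
    fix r :: real assume "r \<in> cbox 0 1"
    then have r: "s * r \<in> {0..1}" using s by (auto simp: mult_le_one)
    then have "norm (g u (s * r)) \<le> 249/100" using g u by (auto simp: bounded_family_def)
    then show "norm (fS z (u * of_real (1 - s * r)) (g u (s * r))) \<le> 276/100"
      using norm_fS_le[OF z picard_integrand(3)[OF z g u s r]] by simp
  qed simp
  then have "norm (picard z g u s) \<le> (9/10 * 1) * (276/100)"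
    unfolding picard_def norm_mult norm_minus_cancel
    by (intro mult_mono) (use u s in auto)
  then show ?thesis by simp
qed

lemma picard_contract:
  assumes z: "small_coeffs z" and g: "bounded_family g" "bounded_family h" and u: "u \<in> Disc" and s: "s \<in> {0..1}"
    and d: "\<And>r. r \<in> {0..1} \<Longrightarrow> norm (g u r - h u r) \<le> d"
  shows "norm (picard z g u s - picard z h u s) \<le> 1/2 * d"
proof -
  have d0: "0 \<le> d" using order_trans[OF norm_ge_zero d[of 0]] by simp
  let ?I = "\<lambda>g r. fS z (u * of_real (1 - s * r)) (g u (s * r))"
  have i: "?I g integrable_on {0..1}" "?I h integrable_on {0..1}"
    using integrable_continuous_real[OF picard_integrand(2)[OF z _ u s]] g by blast+
  have "norm (integral (cbox 0 1) (\<lambda>r. ?I g r - ?I h r)) \<le> 1/5 * d * measure lborel (cbox 0 (1::real))"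
  proof (rule integrable_bound)
    show "(\<lambda>r. ?I g r - ?I h r) integrable_on cbox 0 1" using integrable_diff[OF i] by simp
    fix r :: real assume "r \<in> cbox 0 1"
    then have r: "s * r \<in> {0..1}" using s by (auto simp: mult_le_one)
    then have "norm (g u (s * r)) \<le> 249/100" "norm (h u (s * r)) \<le> 249/100" using g u by (auto simp: bounded_family_def)
    then have "norm (?I g r - ?I h r) \<le> 1/5 * norm (g u (s*r) - h u (s*r))"
      using fS_Lipschitz[OF z picard_integrand(3)[OF z g(1) u s r]] by simp
    then show "norm (?I g r - ?I h r) \<le> 1/5 * d" using d[OF r] by simp
  qed (use d0 in auto)
  then have b: "norm (integral {0..1} (?I g) - integral {0..1} (?I h)) \<le> 1/5 * d"
    using i by (simp add: integral_diff)
  have "picard z g u s - picard z h u s = - (u * of_real s) * (integral {0..1} (?I g) - integral {0..1} (?I h))"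
    by (simp add: picard_def algebra_simps)
  then have "norm (picard z g u s - picard z h u s) = (norm u * s) * norm (integral {0..1} (?I g) - integral {0..1} (?I h))"
    using s by (simp add: norm_mult)
  also have "\<dots> \<le> (9/10 * 1) * (1/5 * d)"
    by (intro mult_mono b) (use u s d0 in auto)
  also have "\<dots> \<le> 1/2 * d" using d0 by simp
  finally show ?thesis .
qed

lemma hol_family_picard:
  assumes z: "small_coeffs z" and g: "bounded_family g" "hol_family g"
  shows "hol_family (picard z g)"
proof -
  have h: "hol_family (\<lambda>u s. fS z (u * of_real (1 - s)) (g u s))"
  proof (rule hol_family_fS[OF z _ _ g(2)])
    show "cmod (complex_of_real (1 - s)) \<le> 1" if "s \<in> {0..1}" for s
      using that by (simp only: norm_of_real) auto
    show "cmod (g u s) \<le> 5/2" if "u \<in> Disc" "s \<in> {0..1}" for u s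
      using g(1) that order_trans[of "cmod (g u s)" "249/100" "5/2"] by (auto simp: bounded_family_def)
  qed (intro continuous_intros)
  have "hol_family (\<lambda>u s. (of_real (-1 * s) * u) * integral {0..1} (\<lambda>r. fS z (u * of_real (1 - s * r)) (g u (s * r))))"
    by (intro hol_family_mult hol_family_u hol_family_average[OF h] hol_family_s continuous_intros)
  moreover have "picard z g = (\<lambda>u s. (of_real (-1 * s) * u) * integral {0..1} (\<lambda>r. fS z (u * of_real (1 - s * r)) (g u (s * r))))"
    by (intro ext) (simp add: picard_def)
  ultimately show ?thesis by simp
qed

lemma cnj_fS: "cnj (fS z x y) = fS z (cnj x) (cnj y)"
  by (simp add: fS_def fP_def fQ_def)

definition iterate :: "(nat \<Rightarrow> real) \<Rightarrow> nat \<Rightarrow> complex \<Rightarrow> real \<Rightarrow> complex" where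
  "iterate z n = (picard z ^^ n) (\<lambda>u s. 0)"

lemma iter_props:
  assumes z: "small_coeffs z"
  shows "bounded_family (iterate z n) \<and> hol_family (iterate z n) \<and> (\<forall>u s. cnj (iterate z n u s) = iterate z n (cnj u) s)"
proof (induction n)
  case 0
  have "hol_family (\<lambda>u s. 0)" by (rule hol_family_s) auto
  then show ?case by (simp add: iterate_def bounded_family_def)
next
  case (Suc n)
  then have h: "hol_family (picard z (iterate z n))" using hol_family_picard[OF z] by blast
  then have c: "continuous_on (Disc \<times> {0..1}) (\<lambda>(u,s). picard z (iterate z n) u s)" unfolding hol_family_def by blast
  have e: "iterate z (Suc n) = picard z (iterate z n)" by (simp add: iterate_def)
  have "cnj (picard z (iterate z n) u s) = picard z (iterate z n) (cnj u) s" for u s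
    using Suc by (simp add: picard_def integral_cnj cnj_fS)
  then show ?case unfolding e using h c picard_bound[OF z] Suc by (auto simp: bounded_family_def)
qed

lemma iter_diff:
  assumes z: "small_coeffs z" and u: "u \<in> Disc"
  shows "s \<in> {0..1} \<Longrightarrow> norm (iterate z (Suc n) u s - iterate z n u s) \<le> 5/2 * (1/2)^n"
proof (induction n arbitrary: s)
  case 0
  then show ?case using iter_props[OF z, of 1] u by (force simp: bounded_family_def iterate_def)
next
  case (Suc n)
  have "norm (picard z (iterate z (Suc n)) u s - picard z (iterate z n) u s) \<le> 1/2 * (5/2 * (1/2)^n)"
    by (rule picard_contract[OF z _ _ u Suc.prems]) (use iter_props[OF z] Suc.IH in auto)
  then show ?case by (simp add: iterate_def)
qed

definition flow :: "(nat \<Rightarrow> real) \<Rightarrow> complex \<Rightarrow> real \<Rightarrow> complex" where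
  "flow z u s = (\<Sum>n. iterate z (Suc n) u s - iterate z n u s)"

lemma flow_uniform:
  assumes z: "small_coeffs z"
  shows "uniform_limit (Disc \<times> {0..1}) (\<lambda>n (u,s). iterate z n u s) (\<lambda>(u,s). flow z u s) sequentially"
proof -
  have "uniform_limit (Disc \<times> {0..1}) (\<lambda>n p. \<Sum>i<n. iterate z (Suc i) (fst p) (snd p) - iterate z i (fst p) (snd p)) (\<lambda>p. \<Sum>i. iterate z (Suc i) (fst p) (snd p) - iterate z i (fst p) (snd p)) sequentially"
    by (rule Weierstrass_m_test[where M = "\<lambda>n. 5/2 * (1/2)^n"])
      (use iter_diff[OF z] in \<open>auto intro!: summable_mult summable_geometric\<close>)
  moreover have "(\<Sum>i<n. iterate z (Suc i) u s - iterate z i u s) = iterate z n u s" for n u s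
    using sum_lessThan_telescope[of "\<lambda>i. iterate z i u s" n] by (simp add: iterate_def)
  ultimately show ?thesis by (simp add: case_prod_unfold flow_def)
qed

lemma flow_tendsto:
  assumes z: "small_coeffs z" "u \<in> Disc" "s \<in> {0..1}"
  shows "(\<lambda>n. iterate z n u s) \<longlonglongrightarrow> flow z u s"
  using tendsto_uniform_limitI[OF flow_uniform[OF z(1)], of "(u,s)"] z by simp

lemma flow_bounded:
  assumes z: "small_coeffs z" shows "bounded_family (flow z)"
  unfolding bounded_family_def
proof (intro conjI ballI)
  show "continuous_on (Disc \<times> {0..1}) (\<lambda>(u,s). flow z u s)"
    by (rule uniform_limit_theorem[OF _ flow_uniform[OF z]]) (use iter_props[OF z] in \<open>auto simp: bounded_family_def\<close>)
  fix u s assume "u \<in> Disc" "s \<in> {0..1::real}"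
  then show "norm (flow z u s) \<le> 249/100"
    by (intro tendsto_upperbound[OF tendsto_norm[OF flow_tendsto[OF z]]])
      (use iter_props[OF z] in \<open>auto simp: bounded_family_def\<close>)
qed

lemma flow_fixed:
  assumes z: "small_coeffs z" and u: "u \<in> Disc" and s: "s \<in> {0..1}"
  shows "flow z u s = picard z (flow z) u s"
proof (rule LIMSEQ_unique)
  show "(\<lambda>n. iterate z (Suc n) u s) \<longlonglongrightarrow> flow z u s" by (rule LIMSEQ_Suc[OF flow_tendsto[OF z u s]])
  show "(\<lambda>n. iterate z (Suc n) u s) \<longlonglongrightarrow> picard z (flow z) u s"
  proof (rule LIMSEQ_I)
    fix e :: real assume e: "0 < e"
    from uniform_limitD[OF flow_uniform[OF z] e] obtain N where
      N: "\<And>n p. n \<ge> N \<Longrightarrow> p \<in> Disc \<times> {0..1} \<Longrightarrow> dist (case p of (u,s) \<Rightarrow> iterate z n u s) (case p of (u,s) \<Rightarrow> flow z u s) < e"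
      unfolding eventually_sequentially by blast
    have "norm (iterate z (Suc n) u s - picard z (flow z) u s) < e" if n: "n \<ge> N" for n
    proof -
      have "norm (picard z (iterate z n) u s - picard z (flow z) u s) \<le> 1/2 * e"
        by (rule picard_contract[OF z _ flow_bounded[OF z] u s])
          (use N[OF n, of "(u,_)"] u iter_props[OF z] in \<open>auto simp: dist_norm less_imp_le\<close>)
      then show ?thesis using e by (simp add: iterate_def)
    qed
    then show "\<exists>no. \<forall>n\<ge>no. norm (iterate z (Suc n) u s - picard z (flow z) u s) < e" by blast
  qed
qed

lemma flow_0: "small_coeffs z \<Longrightarrow> u \<in> Disc \<Longrightarrow> flow z u 0 = 0"
  using flow_fixed[of z u 0] by (simp add: picard_def)

lemma flow_deriv:
  assumes z: "small_coeffs z" and u: "u \<in> Disc" and s: "s \<in> {0..1}"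
  shows "(flow z u has_vector_derivative - u * fS z (u * of_real (1 - s)) (flow z u s)) (at s within {0..1})"
proof -
  note b = flow_bounded[OF z]
  have "((\<lambda>s. - u * integral {0..s} (\<lambda>r. fS z (u * of_real (1 - r)) (flow z u r))) has_vector_derivative
      - u * fS z (u * of_real (1 - s)) (flow z u s)) (at s within {0..1})"
    by (intro has_vector_derivative_mult_right integral_has_vector_derivative[OF picard_integrand(1)[OF z b u s] s])
  then show ?thesis
    by (rule has_vector_derivative_transform[OF s, rotated])
      (simp add: flow_fixed[OF z u] picard_eq_integral[OF z b u])
qed

lemma flow_real:
  assumes z: "small_coeffs z" and u: "\<bar>u\<bar> < 9/10" and s: "s \<in> {0..1}"
  shows "flow z (of_real u) s = of_real (Re (flow z (of_real u) s))"
proof -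
  have u': "of_real u \<in> Disc" using u by simp
  have "(\<lambda>n. cnj (iterate z n (of_real u) s)) \<longlonglongrightarrow> cnj (flow z (of_real u) s)"
    by (intro tendsto_cnj flow_tendsto z u' s)
  then have "(\<lambda>n. iterate z n (of_real u) s) \<longlonglongrightarrow> cnj (flow z (of_real u) s)"
    using iter_props[OF z] by simp
  from LIMSEQ_unique[OF this flow_tendsto[OF z u' s]] show ?thesis by (simp add: complex_eq_iff)
qed

lemma flow_holomorphic:
  assumes z: "small_coeffs z"
  shows "(\<lambda>u. flow z u 1) holomorphic_on Disc"
proof (rule holomorphic_uniform_sequence)
  show "(\<lambda>u. iterate z n u 1) holomorphic_on Disc" for n
  proof -
    have "hol_family (iterate z n)" using iter_props[OF z] by blast
    then obtain g' where "\<And>u s. u \<in> Disc \<Longrightarrow> s \<in> {0..1} \<Longrightarrow> ((\<lambda>u. iterate z n u s) has_field_derivative g' u s) (at u within Disc)"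
      by (metis hol_familyE)
    then show ?thesis unfolding holomorphic_on_def field_differentiable_def by (meson atLeastAtMost_iff zero_le_one order_refl)
  qed
  fix x assume "x \<in> Disc"
  then obtain d where d: "d > 0" "cball x d \<subseteq> Disc" using open_contains_cball open_ball by blast
  have "uniform_limit (cball x d) (\<lambda>n u. iterate z n u 1) (\<lambda>u. flow z u 1) sequentially"
  proof -
    have "(\<lambda>u. (u, 1::real)) \<in> cball x d \<rightarrow> Disc \<times> {0..1}" using d(2) by auto
    from uniform_limit_compose'[OF flow_uniform[OF z] this] show ?thesis by simp
  qed
  then show "\<exists>d. 0 < d \<and> cball x d \<subseteq> Disc \<and> uniform_limit (cball x d) (\<lambda>n u. iterate z n u 1) (\<lambda>u. flow z u 1) sequentially"
    using d by blast
qed auto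

section \<open>Real orbits as graphs\<close>

lemma DERIV_transform_within_set:
  assumes "(f has_real_derivative D) (at x within S)" "x \<in> S" "\<And>t. t \<in> S \<Longrightarrow> g t = f t"
  shows "(g has_real_derivative D) (at x within S)"
  using has_derivative_transform[of x S g f "(*) D"] assms unfolding has_field_derivative_def by blast

text \<open>
  At \<open>s = 1\<close> the rescaled solution has reached \<open>x = 0\<close>.
\<close>
definition hit :: "(nat \<Rightarrow> real) \<Rightarrow> real \<Rightarrow> real" where
  "hit z u = Re (flow z (of_real u) 1)"

lemma fS_of_real: "fS z (of_real x) (of_real y) = (of_real (fS z x y) :: 'a::real_normed_field)"
  by (simp add: fS_def fP_def fQ_def)

lemma backward_solution:
  assumes z: "small_coeffs z" and u: "0 < u" "u < 9/10"
  obtains y where "y u = 0" "y 0 = hit z u"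
    "\<And>x. x \<in> {0..u} \<Longrightarrow> \<bar>y x\<bar> \<le> 249/100"
    "\<And>x. x \<in> {0..u} \<Longrightarrow> (y has_real_derivative fS z x (y x)) (at x within {0..u})"
proof -
  have u': "complex_of_real u \<in> Disc" using u by simp
  define y where "y x = Re (flow z (of_real u) (1 - x/u))" for x
  have s: "1 - x/u \<in> {0..1}" if "x \<in> {0..u}" for x using that u by (auto simp: field_simps)
  have 3: "\<bar>y x\<bar> \<le> 249/100" if "x \<in> {0..u}" for x
  proof -
    have "cmod (flow z (of_real u) (1 - x/u)) \<le> 249/100"
      using flow_bounded[OF z] u' s[OF that] unfolding bounded_family_def by blast
    then show ?thesis unfolding y_def using abs_Re_le_cmod order_trans by blast
  qed
  have 4: "(y has_real_derivative fS z x (y x)) (at x within {0..u})" if x: "x \<in> {0..u}" for x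
  proof -
    have im: "(\<lambda>x. 1 - x/u) ` {0..u} \<subseteq> {0..1}" using s by auto
    have d: "((\<lambda>x. 1 - x/u) has_vector_derivative (- 1/u)) (at x within {0..u})"
      using u by (auto intro!: derivative_eq_intros simp: has_real_derivative_iff_has_vector_derivative[symmetric])
    have "((flow z (of_real u) \<circ> (\<lambda>x. 1 - x/u)) has_vector_derivative
        (-1/u) *\<^sub>R (- of_real u * fS z (of_real u * of_real (1 - (1 - x/u))) (flow z (of_real u) (1 - x/u)))) (at x within {0..u})"
      by (rule vector_diff_chain_within[OF d has_vector_derivative_within_subset[OF flow_deriv[OF z u' s[OF x]] im]])
    moreover have "of_real u * of_real (1 - (1 - x/u)) = complex_of_real x" using u by simp
    moreover have "flow z (of_real u) (1 - x/u) = of_real (y x)"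
      unfolding y_def using flow_real[OF z _ s[OF x], of u] u by simp
    ultimately have "((\<lambda>x. flow z (of_real u) (1 - x/u)) has_vector_derivative of_real (fS z x (y x))) (at x within {0..u})"
      using u by (simp add: fS_of_real o_def scaleR_conv_of_real)
    from bounded_linear.has_vector_derivative[OF bounded_linear_Re this]
    show ?thesis unfolding y_def has_real_derivative_iff_has_vector_derivative by simp
  qed
  show ?thesis
    by (rule that[of y]) (use 3 4 u flow_0[OF z u'] in \<open>auto simp: y_def hit_def\<close>)
qed

definition sol :: "(nat \<Rightarrow> real) \<Rightarrow> real \<Rightarrow> real \<Rightarrow> (real \<Rightarrow> real) \<Rightarrow> bool" where
  "sol z a b y \<longleftrightarrow> continuous_on {a..b} y \<and>
     (\<forall>x\<in>{a<..<b}. \<bar>y x\<bar> \<le> 5/2 \<and> (y has_real_derivative fS z x (y x)) (at x))"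

lemma sol_subset: "sol z a b y \<Longrightarrow> a \<le> a' \<Longrightarrow> b' \<le> b \<Longrightarrow> sol z a' b' y"
  unfolding sol_def by (auto elim: continuous_on_subset)

lemma solI_within:
  assumes "\<And>x. x \<in> {a..b} \<Longrightarrow> \<bar>y x\<bar> \<le> 5/2"
    "\<And>x. x \<in> {a..b} \<Longrightarrow> (y has_real_derivative fS z x (y x)) (at x within {a..b})"
  shows "sol z a b y"
  unfolding sol_def
proof (intro conjI ballI)
  show "continuous_on {a..b} y" by (rule DERIV_continuous_on[OF assms(2)])
  fix x assume x: "x \<in> {a<..<b}"
  then show "\<bar>y x\<bar> \<le> 5/2" using assms(1) by auto
  have "at x within {a..b} = at x" using x by (intro at_within_interior) (simp add: interior_atLeastAtMost_real)
  then show "(y has_real_derivative fS z x (y x)) (at x)" using assms(2)[of x] x by simp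
qed

text \<open>
  The Lipschitz constant times the length of the interval is at most \<open>9/25\<close>, so the difference of two
  solutions keeps its sign and its size up to a factor. Uniqueness, monotonicity of \<open>hit\<close> and the
  nonvanishing of its derivative all follow from this estimate.
\<close>
lemma sol_gap:
  assumes z: "small_coeffs z" and ab: "-9/10 \<le> a" "b \<le> 9/10"
    and y: "sol z a b y1" "sol z a b y2" and x0: "x0 \<in> {a..b}" and x: "x \<in> {a..b}"
  shows "\<bar>(y2 x - y1 x) - (y2 x0 - y1 x0)\<bar> \<le> 3/4 * \<bar>y2 x0 - y1 x0\<bar>"
proof -
  define d where "d x = y2 x - y1 x" for x
  have c: "continuous_on {a..b} d" unfolding d_def using y by (auto simp: sol_def intro!: continuous_intros)
  obtain xm where xm: "xm \<in> {a..b}" "\<And>t. t \<in> {a..b} \<Longrightarrow> \<bar>d t\<bar> \<le> \<bar>d xm\<bar>"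
  proof -
    have "\<exists>x\<in>{a..b}. \<forall>t\<in>{a..b}. \<bar>d t\<bar> \<le> \<bar>d x\<bar>"
      by (rule continuous_attains_sup) (use c x0 in \<open>auto intro: continuous_on_rabs\<close>)
    then show ?thesis using that by blast
  qed
  have ord: "\<bar>d q - d p\<bar> \<le> 36/100 * \<bar>d xm\<bar>" if "p \<in> {a..b}" "q \<in> {a..b}" "p < q" for p q
  proof -
    have "continuous_on {p..q} d" using c by (rule continuous_on_subset) (use that in auto)
    moreover have dd: "(d has_real_derivative fS z t (y2 t) - fS z t (y1 t)) (at t)" if "p < t" "t < q" for t
      unfolding d_def using y that \<open>p \<in> _\<close> \<open>q \<in> _\<close> by (auto simp: sol_def intro!: derivative_intros)
    ultimately obtain l t where t: "p < t" "t < q" "(d has_real_derivative l) (at t)" "d q - d p = (q - p) * l"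
      using MVT[OF \<open>p < q\<close>, of d] by (metis real_differentiable_def)
    have l: "l = fS z t (y2 t) - fS z t (y1 t)" using DERIV_unique[OF t(3) dd[OF t(1,2)]] .
    have t': "t \<in> {a<..<b}" using t that by auto
    have "\<bar>l\<bar> \<le> 1/5 * \<bar>d t\<bar>"
      unfolding l d_def using fS_Lipschitz[OF z, of t "y2 t" "y1 t"] y t' ab by (auto simp: sol_def)
    also have "\<dots> \<le> 1/5 * \<bar>d xm\<bar>" using xm(2)[of t] t' by auto
    finally have "\<bar>d q - d p\<bar> \<le> 18/10 * (1/5 * \<bar>d xm\<bar>)"
      unfolding t(4) abs_mult by (intro mult_mono) (use that ab in auto)
    then show ?thesis by simp
  qed
  have A: "\<bar>d q - d p\<bar> \<le> 36/100 * \<bar>d xm\<bar>" if "p \<in> {a..b}" "q \<in> {a..b}" for p q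
    using ord[OF that] ord[OF that(2,1)] by (cases p q rule: linorder_cases) (auto simp: abs_minus_commute)
  show ?thesis using A[OF x0 x] A[OF x0 xm(1)] unfolding d_def[symmetric] by linarith
qed

lemma sol_unique:
  assumes "small_coeffs z" "-9/10 \<le> a" "b \<le> 9/10" "sol z a b y1" "sol z a b y2" "x0 \<in> {a..b}" "y1 x0 = y2 x0" "x \<in> {a..b}"
  shows "y1 x = y2 x"
  using sol_gap[OF assms(1-6,8)] assms(7) by simp

text \<open>
  The orbit ending at \<open>v\<close> passes above \<open>u\<close> at a height of order \<open>u (v - u)\<close>, because the slope near
  the axis is about \<open>- 2 x\<close>; \<open>sol_gap\<close> carries a quarter of this height over to \<open>x = 0\<close>. The hypothesis
  \<open>v \<le> 2 u\<close> keeps the height small against \<open>x\<close> on the interval.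
\<close>
lemma hit_local:
  assumes z: "small_coeffs z" and u: "0 < u" "u < v" "v \<le> 2 * u" "v < 9/10"
  shows "hit z v - hit z u \<ge> u / 4 * (v - u)"
proof -
  obtain y1 where y1: "y1 u = 0" "y1 0 = hit z u"
    "\<And>x. x \<in> {0..u} \<Longrightarrow> \<bar>y1 x\<bar> \<le> 249/100"
    "\<And>x. x \<in> {0..u} \<Longrightarrow> (y1 has_real_derivative fS z x (y1 x)) (at x within {0..u})"
    using backward_solution[OF z, of u] u by auto
  obtain y2 where y2: "y2 v = 0" "y2 0 = hit z v"
    "\<And>x. x \<in> {0..v} \<Longrightarrow> \<bar>y2 x\<bar> \<le> 249/100"
    "\<And>x. x \<in> {0..v} \<Longrightarrow> (y2 has_real_derivative fS z x (y2 x)) (at x within {0..v})"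
    using backward_solution[OF z, of v] u by auto
  have s1: "sol z 0 u y1" by (rule solI_within) (use y1 in force)+
  have s2: "sol z 0 v y2" by (rule solI_within) (use y2 in force)+
  have mvt: "\<exists>t. p < t \<and> t < v \<and> y2 p = (v - p) * (- fS z t (y2 t))" if p: "u \<le> p" "p < v" for p
  proof -
    have "continuous_on {p..v} y2" using s2 p u by (auto simp: sol_def elim: continuous_on_subset)
    moreover have dd: "(y2 has_real_derivative fS z t (y2 t)) (at t)" if "p < t" "t < v" for t
      using s2 that p u by (auto simp: sol_def)
    ultimately obtain l t where t: "p < t" "t < v" "(y2 has_real_derivative l) (at t)" "y2 v - y2 p = (v - p) * l"
      using MVT[OF \<open>p < v\<close>, of y2] by (metis real_differentiable_def)
    then have "l = fS z t (y2 t)" using DERIV_unique[OF t(3) dd[OF t(1,2)]] by simp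
    then show ?thesis using t y2(1) by (intro exI[of _ t]) (auto simp: algebra_simps)
  qed
  have small: "\<bar>y2 p\<bar> \<le> 276/100 * p" if p: "u \<le> p" "p < v" for p
  proof -
    obtain t where t: "p < t" "t < v" "y2 p = (v - p) * (- fS z t (y2 t))" using mvt[OF p] by blast
    have "\<bar>fS z t (y2 t)\<bar> \<le> 276/100" using norm_fS_le[OF z, of t "y2 t"] y2(3)[of t] t p u by auto
    then have "\<bar>y2 p\<bar> \<le> p * (276/100)" unfolding t(3) abs_mult abs_minus_cancel
      by (intro mult_mono) (use p u in auto)
    then show ?thesis by simp
  qed
  obtain t where t: "u < t" "t < v" "y2 u = (v - u) * (- fS z t (y2 t))" using mvt[of u] u by auto
  have t1: "0 < t" "t < 9/10" using t u by auto
  have yt: "\<bar>y2 t\<bar> \<le> 276/100 * t" "\<bar>y2 t\<bar> \<le> 249/100" using small[of t] y2(3)[of t] t u by auto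
  have "\<bar>fQ z t (y2 t) - 2 * t\<bar> \<le> 2/10 * (9/10 * t) + 4/100 * (t * (249/100)) + 2/1000 * ((249/100) * (276/100 * t))"
  proof -
    have "fQ z t (y2 t) - 2 * t = z 5 * (t * t) + z 6 * (t * y2 t) + z 7 * (y2 t * y2 t)"
      by (simp add: fQ_def power2_eq_square)
    also have "\<bar>\<dots>\<bar> \<le> 2/10 * (9/10 * t) + 4/100 * (t * (249/100)) + 2/1000 * ((249/100) * (276/100 * t))"
    proof -
      have *: "\<bar>p * q\<bar> \<le> C * D" if "\<bar>p\<bar> \<le> C" "\<bar>q\<bar> \<le> D" for p q C D :: real
        unfolding abs_mult using that by (intro mult_mono) auto
      have "\<bar>z 5 * (t * t)\<bar> \<le> 2/10 * (9/10 * t)" by (intro *) (use z t1 in \<open>auto simp: small_coeffs_def\<close>)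
      moreover have "\<bar>z 6 * (t * y2 t)\<bar> \<le> 4/100 * (t * (249/100))" by (intro *) (use z t1 yt in \<open>auto simp: small_coeffs_def\<close>)
      moreover have "\<bar>z 7 * (y2 t * y2 t)\<bar> \<le> 2/1000 * ((249/100) * (276/100 * t))" by (intro *) (use z t1 yt in \<open>auto simp: small_coeffs_def\<close>)
      ultimately show ?thesis by linarith
    qed
    finally show ?thesis .
  qed
  then have Q: "fQ z t (y2 t) \<ge> 3/2 * t" using t1 by linarith
  have P: "fP z t (y2 t) \<le> -3/4" "- fP z t (y2 t) \<le> 5/4"
  proof -
    have *: "\<bar>t\<bar> \<le> 9/10" "\<bar>y2 t\<bar> \<le> 5/2" using t1 yt by auto
    show "fP z t (y2 t) \<le> -3/4" using fP_neg[OF z *] .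
    have "\<bar>fP z t (y2 t) + 1\<bar> \<le> 1/4" using norm_fP_diff[of z t "y2 t"] z * by simp
    then show "- fP z t (y2 t) \<le> 5/4" by linarith
  qed
  have "t \<le> fQ z t (y2 t) / (- fP z t (y2 t))"
  proof (subst pos_le_divide_eq)
    show "t * - fP z t (y2 t) \<le> fQ z t (y2 t)" using mult_left_mono[OF P(2), of t] t1 Q by linarith
  qed (use P in auto)
  then have "u \<le> - fS z t (y2 t)" using t by (simp add: fS_def)
  then have yu: "(v - u) * u \<le> y2 u" unfolding t(3) using u by (intro mult_left_mono) auto
  then have yu0: "0 \<le> y2 u" by (rule order_trans[rotated]) (use u in simp)
  have "\<bar>(y2 0 - y1 0) - (y2 u - y1 u)\<bar> \<le> 3/4 * \<bar>y2 u - y1 u\<bar>"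
    by (rule sol_gap[OF z _ _ s1 sol_subset[OF s2]]) (use u in auto)
  then have "\<bar>hit z v - hit z u - y2 u\<bar> \<le> 3/4 * y2 u" using yu0 y1(1,2) y2(1,2) by simp
  then have "y2 u / 4 \<le> hit z v - hit z u" by linarith
  moreover have "u / 4 * (v - u) = (v - u) * u / 4" by simp
  ultimately show ?thesis using yu by linarith
qed

lemma hit_0: "small_coeffs z \<Longrightarrow> hit z 0 = 0"
  using flow_fixed[of z 0 1] by (simp add: hit_def picard_def)

lemma hit_continuous: "small_coeffs z \<Longrightarrow> continuous_on {-9/10<..<9/10} (hit z)"
  unfolding hit_def
  by (intro continuous_intros continuous_on_compose2[OF holomorphic_on_imp_continuous_on[OF flow_holomorphic]]) auto

lemma hit_less: assumes z: "small_coeffs z" and u: "0 < u" "u < v" "v < 9/10" shows "hit z u < hit z v"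
proof -
  have "v \<le> 2^n * u \<Longrightarrow> u < v \<Longrightarrow> v < 9/10 \<Longrightarrow> hit z u < hit z v" for n v
  proof (induction n arbitrary: v)
    case (Suc n)
    have l: "hit z p < hit z q" if "0 < p" "p < q" "q \<le> 2*p" "q < 9/10" for p q
    proof -
      have "0 < p / 4 * (q - p)" using that by simp
      then show ?thesis using hit_local[OF z that] by linarith
    qed
    show ?case
    proof (cases "v \<le> 2 * u")
      case True then show ?thesis using l[of u v] Suc.prems u by simp
    next
      case False
      then have "hit z u < hit z (v/2)" using Suc.prems by (intro Suc.IH) auto
      then show ?thesis using l[of "v/2" v] Suc.prems u by simp
    qed
  qed (use u in simp)
  moreover obtain n where "v / u < 2^n" using real_arch_pow[of 2 "v/u"] by auto
  then have "v \<le> 2^n * u" using u by (simp add: field_simps)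
  ultimately show ?thesis using u by blast
qed

lemma hit_pos: assumes z: "small_coeffs z" and u: "0 < u" "u < 9/10" shows "0 < hit z u"
proof -
  have "hit z 0 \<le> hit z (u/2)"
  proof (rule tendsto_upperbound)
    have "isCont (hit z) 0" using hit_continuous[OF z] by (simp add: continuous_on_eq_continuous_at)
    then have "(hit z \<longlongrightarrow> hit z 0) (at 0)" by (simp add: isCont_def)
    then show "(hit z \<longlongrightarrow> hit z 0) (at_right 0)" by (rule tendsto_within_subset) auto
    show "eventually (\<lambda>x. hit z x \<le> hit z (u/2)) (at_right 0)"
      unfolding eventually_at_right_field by (rule exI[of _ "u/2"]) (use u hit_less[OF z] in \<open>auto intro!: less_imp_le\<close>)
  qed simp
  then show ?thesis using hit_less[OF z, of "u/2" u] u hit_0[OF z] by simp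
qed

lemma backward_solution_pos:
  assumes z: "small_coeffs z" and u: "0 < u" "u < 9/10"
  obtains y where "y u = 0" "y 0 = hit z u"
    "\<And>x. x \<in> {0..u} \<Longrightarrow> \<bar>y x\<bar> \<le> 249/100"
    "\<And>x. x \<in> {0..u} \<Longrightarrow> (y has_real_derivative fS z x (y x)) (at x within {0..u})"
    "\<And>x. x \<in> {0..<u} \<Longrightarrow> 0 < y x"
proof -
  obtain y where y: "y u = 0" "y 0 = hit z u"
    "\<And>x. x \<in> {0..u} \<Longrightarrow> \<bar>y x\<bar> \<le> 249/100"
    "\<And>x. x \<in> {0..u} \<Longrightarrow> (y has_real_derivative fS z x (y x)) (at x within {0..u})"
    using backward_solution[OF z u] by auto
  have s: "sol z 0 u y" by (rule solI_within) (use y in force)+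
  have "0 < y x" if x: "x \<in> {0..<u}" for x
  proof (cases "x = 0")
    case False
    then have x0: "0 < x" "x < 9/10" using x u by auto
    obtain y1 where y1: "y1 x = 0" "y1 0 = hit z x"
      "\<And>t. t \<in> {0..x} \<Longrightarrow> \<bar>y1 t\<bar> \<le> 249/100"
      "\<And>t. t \<in> {0..x} \<Longrightarrow> (y1 has_real_derivative fS z t (y1 t)) (at t within {0..x})"
      using backward_solution[OF z x0] by auto
    have s1: "sol z 0 x y1" by (rule solI_within) (use y1 in force)+
    have "\<bar>(y 0 - y1 0) - (y x - y1 x)\<bar> \<le> 3/4 * \<bar>y x - y1 x\<bar>"
      by (rule sol_gap[OF z _ _ s1 sol_subset[OF s]]) (use x x0 in auto)
    moreover have "hit z x < hit z u" using hit_less[OF z, of x u] x0 x u by auto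
    ultimately show ?thesis using y y1 by (cases "y x \<ge> 0") (auto simp: abs_if split: if_splits)
  qed (use y hit_pos[OF z u] in auto)
  then show ?thesis using that y by blast
qed

text \<open>
  The reflection in the vertical axis turns orbits to the left of the origin into orbits of the same
  normal form to the right.
\<close>
definition refl_coeffs :: "(nat \<Rightarrow> real) \<Rightarrow> nat \<Rightarrow> real" where
  "refl_coeffs z i = (if i \<in> {0,3,5,7} then - z i else z i)"

lemma small_refl: "small_coeffs (refl_coeffs z) \<longleftrightarrow> small_coeffs z"
  by (simp add: small_coeffs_def refl_coeffs_def)
lemma refl_refl [simp]: "refl_coeffs (refl_coeffs z) = z"
  by (rule ext) (simp add: refl_coeffs_def)

lemma fS_refl: "fS (refl_coeffs z) x y = - fS z (- x) y"
proof -
  have "fQ (refl_coeffs z) x y = - fQ z (- x) y" by (simp add: fQ_def refl_coeffs_def)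
  moreover have "fP (refl_coeffs z) x y = fP z (- x) y" by (simp add: fP_def refl_coeffs_def)
  ultimately show ?thesis by (simp add: fS_def)
qed

lemma iter_refl: "iterate (refl_coeffs z) n u s = iterate z n (- u) s"
  by (induction n arbitrary: s) (simp_all add: iterate_def picard_def fS_refl)

lemma hit_refl: "hit (refl_coeffs z) u = hit z (- u)"
  by (simp add: hit_def flow_def iter_refl)

lemma sol_refl: "sol z a b y \<Longrightarrow> sol (refl_coeffs z) (- b) (- a) (\<lambda>x. y (- x))"
  unfolding sol_def
proof (intro conjI ballI)
  assume *: "continuous_on {a..b} y \<and> (\<forall>x\<in>{a<..<b}. \<bar>y x\<bar> \<le> 5/2 \<and> (y has_real_derivative fS z x (y x)) (at x))"
  show "continuous_on {-b..-a} (\<lambda>x. y (- x))"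
    by (rule continuous_on_compose2[of "{a..b}" y]) (use * in \<open>auto intro!: continuous_intros\<close>)
  fix x assume x: "x \<in> {-b<..<-a}"
  then show "\<bar>y (- x)\<bar> \<le> 5/2" using * by auto
  have "(y has_real_derivative fS z (-x) (y (-x))) (at (-x))" using * x by auto
  then show "((\<lambda>x. y (- x)) has_real_derivative fS (refl_coeffs z) x (y (- x))) (at x)"
    by (subst (asm) DERIV_mirror) (simp add: fS_refl)
qed

definition orbit_arc :: "(nat \<Rightarrow> real) \<Rightarrow> real \<Rightarrow> real \<Rightarrow> (real \<Rightarrow> real) \<Rightarrow> bool" where
  "orbit_arc z a b y \<longleftrightarrow> a < 0 \<and> 0 < b \<and> sol z a b y \<and> y a = 0 \<and> y b = 0 \<and> (\<forall>x\<in>{a<..<b}. 0 < y x \<and> y x < 5/2)"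

lemma sol_hit: assumes z: "small_coeffs z" and b: "0 < b" "b < 9/10" and s: "sol z 0 b y" and "y b = 0"
  shows "y 0 = hit z b"
proof -
  obtain y1 where y: "y1 b = 0" "y1 0 = hit z b"
    "\<And>x. x \<in> {0..b} \<Longrightarrow> \<bar>y1 x\<bar> \<le> 249/100"
    "\<And>x. x \<in> {0..b} \<Longrightarrow> (y1 has_real_derivative fS z x (y1 x)) (at x within {0..b})"
    using backward_solution[OF z b] by auto
  have s1: "sol z 0 b y1" by (rule solI_within) (use y in force)+
  show ?thesis using sol_unique[OF z _ _ s s1, of b 0] b y assms by simp
qed

lemma arc_hit: assumes z: "small_coeffs z" and r: "-9/10 < a" "b < 9/10" and y: "orbit_arc z a b y"
  shows "hit z a = hit z b"
proof -
  have "y 0 = hit z b" using y r by (intro sol_hit z) (auto simp: orbit_arc_def elim: sol_subset)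
  moreover have "y (- 0) = hit (refl_coeffs z) (- a)"
    using y r by (intro sol_hit[where y = "\<lambda>x. y (- x)"]) (auto simp: orbit_arc_def small_refl z intro: sol_subset[OF sol_refl])
  ultimately show ?thesis by (simp add: hit_refl)
qed

lemma arc_unique: assumes "small_coeffs z" "-9/10 < a" "b < 9/10" "orbit_arc z a b y1" "orbit_arc z a b y2" "x \<in> {a..b}"
  shows "y1 x = y2 x"
  using sol_unique[of z a b y1 y2 b x] assms by (auto simp: orbit_arc_def)

lemma arc_exists: assumes z: "small_coeffs z" and r: "-9/10 < a" "a < 0" "0 < b" "b < 9/10" and e: "hit z a = hit z b"
  shows "\<exists>y. orbit_arc z a b y"
proof -
  obtain p where p: "p b = 0" "p 0 = hit z b"
    "\<And>x. x \<in> {0..b} \<Longrightarrow> \<bar>p x\<bar> \<le> 249/100"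
    "\<And>x. x \<in> {0..b} \<Longrightarrow> (p has_real_derivative fS z x (p x)) (at x within {0..b})"
    "\<And>x. x \<in> {0..<b} \<Longrightarrow> 0 < p x"
    using backward_solution_pos[OF z r(3,4)] by metis
  have ra: "0 < -a" "-a < 9/10" using r by auto
  obtain q where q: "q (-a) = 0" "q 0 = hit (refl_coeffs z) (-a)"
    "\<And>x. x \<in> {0..-a} \<Longrightarrow> \<bar>q x\<bar> \<le> 249/100"
    "\<And>x. x \<in> {0..-a} \<Longrightarrow> (q has_real_derivative fS (refl_coeffs z) x (q x)) (at x within {0..-a})"
    "\<And>x. x \<in> {0..<-a} \<Longrightarrow> 0 < q x"
    using backward_solution_pos[OF _ ra, of "refl_coeffs z"] z small_refl by metis
  define y where "y x = (if x \<le> 0 then q (- x) else p x)" for x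
  have y0: "q 0 = p 0" using e p q by (simp add: hit_refl)
  have yp: "y x = p x" if "x \<ge> 0" for x using that y0 by (auto simp: y_def)
  have yq: "y x = q (-x)" if "x \<le> 0" for x using that by (auto simp: y_def)
  have dp: "(y has_real_derivative fS z x (y x)) (at x within {0..b})" if "x \<in> {0..b}" for x
  proof -
    have "y x = p x" using that yp by auto
    then show ?thesis using DERIV_transform_within_set[OF p(4)[OF that] that, of y] yp by auto
  qed
  have dq: "(y has_real_derivative fS z x (y x)) (at x within {a..0})" if x: "x \<in> {a..0}" for x
  proof -
    have "(q has_real_derivative fS (refl_coeffs z) (-x) (q (-x))) (at (-x) within uminus ` {a..0})"
      using q(4)[of "-x"] x by simp
    from DERIV_image_chain[OF this, of "-1"] have "(q \<circ> uminus has_real_derivative fS z x (q (-x))) (at x within {a..0})"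
      using DERIV_minus[OF DERIV_ident, of x "{a..0}"] by (simp add: fS_refl)
    then have "(y has_real_derivative fS z x (q (-x))) (at x within {a..0})"
      by (rule DERIV_transform_within_set) (use x yq in auto)
    then show ?thesis using x yq[of x] by simp
  qed
  have d: "(y has_real_derivative fS z x (y x)) (at x within {a..b})" if x: "x \<in> {a..b}" for x
  proof -
    have ab: "{a..b} = {a..0} \<union> {0..b}" using r by auto
    have "(y has_real_derivative fS z x (y x)) (at x within {a..0})"
    proof (cases "x \<le> 0")
      case False
      then have "at x within {a..0} = bot" by (simp add: at_within_eq_bot_iff)
      then show ?thesis by (simp add: has_field_derivative_def has_derivative_bot bounded_linear_mult_right)
    qed (use dq x in auto)
    moreover have "(y has_real_derivative fS z x (y x)) (at x within {0..b})"
    proof (cases "x \<ge> 0")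
      case False
      then have "at x within {0..b} = bot" by (simp add: at_within_eq_bot_iff)
      then show ?thesis by (simp add: has_field_derivative_def has_derivative_bot bounded_linear_mult_right)
    qed (use dp x in auto)
    ultimately show ?thesis unfolding ab has_field_derivative_iff by (simp add: at_within_union filterlim_sup)
  qed
  have bd: "\<bar>y x\<bar> \<le> 249/100" if "x \<in> {a..b}" for x
    using p(3)[of x] q(3)[of "-x"] that by (auto simp: y_def)
  have "sol z a b y" by (rule solI_within) (use bd d in force)+
  moreover have "0 < y x \<and> y x < 5/2" if "x \<in> {a<..<b}" for x
    using bd[of x] p(5)[of x] q(5)[of "-x"] that by (auto simp: y_def)
  ultimately show ?thesis using r p q by (intro exI[of _ y]) (auto simp: orbit_arc_def y_def)
qed

section \<open>Isolated zeros of the gap function\<close>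

abbreviation chit :: "(nat \<Rightarrow> real) \<Rightarrow> complex \<Rightarrow> complex" where "chit z u \<equiv> flow z u 1"

lemma chit_of_real: "small_coeffs z \<Longrightarrow> \<bar>u\<bar> < 9/10 \<Longrightarrow> chit z (of_real u) = of_real (hit z u)"
  unfolding hit_def by (rule flow_real) auto

text \<open>
  Otherwise the difference quotients along the real axis would tend to zero, against \<open>hit_local\<close>.
\<close>
lemma deriv_chit_pos: assumes z: "small_coeffs z" and u: "0 < u" "u < 9/10"
  shows "deriv (chit z) (of_real u) \<noteq> 0"
proof
  assume d: "deriv (chit z) (of_real u) = 0"
  have "(chit z has_field_derivative deriv (chit z) (of_real u)) (at (of_real u))"
    by (rule holomorphic_derivI[OF flow_holomorphic[OF z]]) (use u in auto)
  then have l: "((\<lambda>v. (chit z v - chit z (of_real u)) / (v - of_real u)) \<longlongrightarrow> 0) (at (of_real u))"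
    unfolding d by (simp add: has_field_derivative_iff)
  have "filterlim complex_of_real (at (of_real u)) (at_right u)"
    unfolding filterlim_at
    by (auto intro!: tendsto_eq_intros simp: eventually_at_filter)
  from filterlim_compose[OF l this]
  have "((\<lambda>v. (chit z (of_real v) - chit z (of_real u)) / (of_real v - of_real u)) \<longlongrightarrow> 0) (at_right u)" .
  from tendsto_norm[OF this]
  have t: "((\<lambda>v. norm ((chit z (of_real v) - chit z (of_real u)) / (of_real v - of_real u))) \<longlongrightarrow> 0) (at_right u)" by simp
  have "u / 4 \<le> 0"
  proof (rule tendsto_lowerbound[OF t])
    have "u / 4 \<le> norm ((chit z (of_real v) - chit z (of_real u)) / (of_real v - of_real u))"
      if v: "u < v" "v < min (2*u) (9/10)" for v
    proof -
      have "chit z (of_real v) - chit z (of_real u) = of_real (hit z v - hit z u)"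
        using chit_of_real[OF z] u v by simp
      then have e: "norm ((chit z (of_real v) - chit z (of_real u)) / (of_real v - of_real u)) = \<bar>hit z v - hit z u\<bar> / (v - u)"
        using v by (simp add: norm_divide flip: of_real_diff)
      have "u / 4 * (v - u) \<le> \<bar>hit z v - hit z u\<bar>" by (rule order_trans[OF hit_local[OF z] abs_ge_self]) (use u v in auto)
      then show ?thesis unfolding e using v by (simp add: pos_le_divide_eq)
    qed
    then show "\<forall>\<^sub>F v in at_right u. u / 4 \<le> norm ((chit z (of_real v) - chit z (of_real u)) / (of_real v - of_real u))"
      unfolding eventually_at_right_field using u by (intro exI[of _ "min (2*u) (9/10)"]) auto
  qed simp
  then show False using u by simp
qed

lemma deriv_chit_nz: assumes z: "small_coeffs z" and u: "u \<noteq> 0" "\<bar>u\<bar> < 9/10"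
  shows "deriv (chit z) (of_real u) \<noteq> 0"
proof (cases "u > 0")
  case False
  have "(chit z has_field_derivative deriv (chit z) (of_real u)) (at (of_real u))"
    by (rule holomorphic_derivI[OF flow_holomorphic[OF z]]) (use u in auto)
  then have "((\<lambda>v. chit z (- v)) has_field_derivative - deriv (chit z) (of_real u)) (at (of_real (-u)))"
    using DERIV_chain2[of "chit z" "deriv (chit z) (of_real u)" uminus "of_real (-u)" "-1" UNIV] DERIV_minus[OF DERIV_ident, of "- complex_of_real u" UNIV] by simp
  moreover have "(\<lambda>v. chit z (- v)) = chit (refl_coeffs z)" by (rule ext) (simp add: flow_def iter_refl)
  ultimately have "deriv (chit (refl_coeffs z)) (of_real (-u)) = - deriv (chit z) (of_real u)"
    by (simp add: DERIV_imp_deriv)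
  then show ?thesis using deriv_chit_pos[of "refl_coeffs z" "-u"] z u False by (simp add: small_refl)
qed (use deriv_chit_pos[OF z] u in auto)

lemma hit_less_neg: assumes z: "small_coeffs z" and u: "-9/10 < u" "u < v" "v < 0" shows "hit z v < hit z u"
  using hit_less[of "refl_coeffs z" "-v" "-u"] assms by (simp add: small_refl hit_refl)

locale matched_pair =
  fixes z w :: "nat \<Rightarrow> real" and c p q a0 :: real
  assumes z: "small_coeffs z" and w: "small_coeffs w" and c: "\<bar>c\<bar> \<le> 1/100"
    and pq: "0 < p" "p < q" "q < 88/100" and a0: "-88/100 < a0" "a0 < 0" "hit z q < hit z a0"
begin

definition partner :: "real \<Rightarrow> real" where
  "partner b = (THE a. -88/100 < a \<and> a < 0 \<and> hit z a = hit z b)"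

lemma hit_inj_neg: "-9/10 < a \<Longrightarrow> a < 0 \<Longrightarrow> -9/10 < a' \<Longrightarrow> a' < 0 \<Longrightarrow> hit z a = hit z a' \<Longrightarrow> a = a'"
  using hit_less_neg[OF z, of a a'] hit_less_neg[OF z, of a' a] by (cases a a' rule: linorder_cases) auto

lemma partner_ex1:
  assumes b: "b \<in> {p..q}" shows "\<exists>!a. -88/100 < a \<and> a < 0 \<and> hit z a = hit z b"
proof -
  have "hit z b \<le> hit z q" using hit_less[OF z, of b q] b pq by (cases "b = q") auto
  then have "\<exists>a. a0 \<le> a \<and> a \<le> 0 \<and> hit z a = hit z b"
    using a0 hit_0[OF z] hit_pos[OF z, of b] b pq
    by (intro IVT2') (auto intro: continuous_on_subset[OF hit_continuous[OF z]])
  then obtain a where "a0 \<le> a" "a \<le> 0" "hit z a = hit z b" by blast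
  moreover have "a \<noteq> 0" using calculation hit_0[OF z] hit_pos[OF z, of b] b pq by auto
  ultimately have a: "-88/100 < a" "a < 0" "hit z a = hit z b" using a0 by auto
  show ?thesis
  proof (rule ex1I[of _ a])
    fix a' assume "-88/100 < a' \<and> a' < 0 \<and> hit z a' = hit z b"
    then show "a' = a" using a hit_inj_neg[of a' a] by simp
  qed (use a in simp)
qed

lemma partner: assumes b: "b \<in> {p..q}"
  shows "-88/100 < partner b" "partner b < 0" "hit z (partner b) = hit z b"
  using theI'[OF partner_ex1[OF b]] unfolding partner_def by auto

lemma partner_eq: "b \<in> {p..q} \<Longrightarrow> -88/100 < a \<Longrightarrow> a < 0 \<Longrightarrow> hit z a = hit z b \<Longrightarrow> partner b = a"
  using partner[of b] hit_inj_neg[of "partner b" a] by simp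

definition gap :: "real \<Rightarrow> real" where
  "gap b = hit w (b - c) - hit w (partner b - c)"

text \<open>
  A local holomorphic inverse of \<open>chit z\<close> at the partner extends the partner function, hence also the
  gap, to complex arguments. By conjugation symmetry and injectivity it takes real values at
  real points, where it is therefore the partner.
\<close>
lemma gap_local:
  assumes b0: "b0 \<in> {p..q}"
  obtains G r where "r > 0" "G holomorphic_on ball (of_real b0) r"
    "\<And>b. b \<in> {p..q} \<Longrightarrow> \<bar>b - b0\<bar> < r \<Longrightarrow> G (of_real b) = of_real (gap b)"
proof -
  define a where "a = partner b0"
  have a: "-88/100 < a" "a < 0" "hit z a = hit z b0" using partner[OF b0] by (auto simp: a_def)
  have hol: "chit z holomorphic_on Disc" by (rule flow_holomorphic[OF z])
  have aD: "complex_of_real a \<in> Disc" using a by simp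
  have "deriv (chit z) (of_real a) \<noteq> 0" by (rule deriv_chit_nz[OF z]) (use a in auto)
  from has_complex_derivative_locally_injective[OF hol aD open_ball this] obtain r1 where
    r1: "r1 > 0" "ball (of_real a) r1 \<subseteq> Disc" "inj_on (chit z) (ball (of_real a) r1)" by blast
  define r2 where "r2 = min r1 (min (88/100 + a) (- a))"
  have r2: "r2 > 0" "r2 \<le> r1" "r2 \<le> 88/100 + a" "r2 \<le> - a" using r1 a by (auto simp: r2_def)
  define B where "B = ball (complex_of_real a) r2"
  have B: "B \<subseteq> Disc" "inj_on (chit z) B" "open B" using r1 r2 subset_ball[OF r2(2)] by (auto simp: B_def intro: inj_on_subset)
  have holB: "chit z holomorphic_on B" using hol B by (auto intro: holomorphic_on_subset)
  obtain \<phi> where \<phi>: "\<phi> holomorphic_on chit z ` B" "\<And>x. x \<in> B \<Longrightarrow> \<phi> (chit z x) = x"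
    using holomorphic_has_inverse[OF holB B(3,2)] by metis
  have op: "open (chit z ` B)" by (rule open_mapping_thm3[OF holB B(3,2)])
  have b0D: "complex_of_real b0 \<in> Disc" using b0 pq by auto
  have "chit z (of_real b0) = chit z (of_real a)" using chit_of_real[OF z] a b0 pq by auto
  then have m: "chit z (of_real b0) \<in> chit z ` B" using r2 by (auto simp: B_def)
  have "open (Disc \<inter> chit z -` (chit z ` B))"
    by (rule continuous_open_preimage[OF holomorphic_on_imp_continuous_on[OF hol] open_ball op])
  then obtain r3 where r3: "r3 > 0" "ball (of_real b0) r3 \<subseteq> Disc \<inter> chit z -` (chit z ` B)"
    using m b0D openE[of "Disc \<inter> chit z -` (chit z ` B)" "of_real b0"] by auto
  define r where "r = min r3 (88/100 - b0 + 1/100)"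
  have r: "r > 0" "r \<le> r3" "r \<le> 89/100 - b0" using r3 b0 pq by (auto simp: r_def)
  have sub: "ball (complex_of_real b0) r \<subseteq> Disc \<inter> chit z -` (chit z ` B)" using r3 r subset_ball[OF r(2)] by blast
  define G where "G b = chit w (b - of_real c) - chit w (\<phi> (chit z b) - of_real c)" for b
  have \<phi>B: "\<phi> (chit z b) \<in> B" if "b \<in> ball (of_real b0) r" for b
  proof -
    have "chit z b \<in> chit z ` B" using sub that by blast
    then obtain x where "x \<in> B" "chit z b = chit z x" by (elim imageE)
    then show ?thesis using \<phi>(2) by simp
  qed
  have sh: "x - of_real c \<in> Disc" if "norm x < 89/100" for x
    using norm_triangle_ineq4[of x "of_real c"] that c by simp
  have Bn: "norm x < 88/100" if "x \<in> B" for x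
  proof -
    have "norm (x - of_real a) < r2" using that by (simp add: B_def dist_norm norm_minus_commute)
    moreover have "norm (complex_of_real a) = - a" using a by simp
    ultimately show ?thesis using norm_triangle_ineq[of "x - of_real a" "of_real a"] r2 by simp
  qed
  have bn: "norm x < 89/100" if "x \<in> ball (of_real b0) r" for x :: complex
  proof -
    have "norm (x - of_real b0) < r" using that by (simp add: dist_norm norm_minus_commute)
    moreover have "norm (complex_of_real b0) = b0" using b0 pq by simp
    ultimately show ?thesis using norm_triangle_ineq[of "x - of_real b0" "of_real b0"] r by simp
  qed
  have holw: "chit w holomorphic_on Disc" by (rule flow_holomorphic[OF w])
  have h1: "(\<lambda>b. \<phi> (chit z b)) holomorphic_on ball (of_real b0) r"
    using holomorphic_on_compose_gen[OF holomorphic_on_subset[OF hol] \<phi>(1), of "ball (of_real b0) r"] sub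
    by (auto simp: o_def)
  have "G holomorphic_on ball (of_real b0) r"
    unfolding G_def
  proof (rule holomorphic_on_diff)
    have comp: "(\<lambda>b. chit w (k b - of_real c)) holomorphic_on X"
      if "k holomorphic_on X" "\<And>b. b \<in> X \<Longrightarrow> norm (k b) < 89/100" for k X
    proof -
      have "(chit w \<circ> (\<lambda>b. k b - of_real c)) holomorphic_on X"
      proof (rule holomorphic_on_compose_gen[OF _ holw])
        show "(\<lambda>b. k b - of_real c) holomorphic_on X" using that(1) by (intro holomorphic_intros)
        show "(\<lambda>b. k b - of_real c) ` X \<subseteq> Disc" using that(2) sh by blast
      qed
      then show ?thesis by (simp add: o_def)
    qed
    show "(\<lambda>b. chit w (b - of_real c)) holomorphic_on ball (of_real b0) r"
      by (rule comp[OF holomorphic_on_ident bn])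
    show "(\<lambda>b. chit w (\<phi> (chit z b) - of_real c)) holomorphic_on ball (of_real b0) r"
      by (rule comp[OF h1 order.strict_trans[OF Bn[OF \<phi>B]]]) simp_all
  qed
  moreover have "G (of_real b) = of_real (gap b)" if b: "b \<in> {p..q}" "\<bar>b - b0\<bar> < r" for b
  proof -
    have bb: "of_real b \<in> ball (complex_of_real b0) r"
      using b by (simp add: dist_norm norm_minus_commute flip: of_real_diff)
    define x where "x = \<phi> (chit z (of_real b))"
    have x: "x \<in> B" "chit z x = chit z (of_real b)"
    proof -
      obtain t where "t \<in> B" "chit z (of_real b) = chit z t" using sub bb by blast
      then show "x \<in> B" "chit z x = chit z (of_real b)" using \<phi>(2) by (auto simp: x_def)
    qed
    \<comment> \<open>the preimage of a real value near a real point is real, being fixed by conjugation\<close>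
    have "cmod (of_real a - cnj x) = cmod (of_real a - x)" using complex_mod_cnj[of "of_real a - x"] by simp
    then have cx: "cnj x \<in> B" using x(1) by (simp add: B_def dist_norm)
    have "chit z (cnj x) = cnj (chit z x)"
    proof (rule LIMSEQ_unique)
      have xD: "x \<in> Disc" "cnj x \<in> Disc" using x B cx by auto
      show "(\<lambda>n. iterate z n (cnj x) 1) \<longlonglongrightarrow> chit z (cnj x)" by (rule flow_tendsto[OF z xD(2)]) auto
      have "(\<lambda>n. cnj (iterate z n x 1)) \<longlonglongrightarrow> cnj (chit z x)" by (intro tendsto_cnj flow_tendsto[OF z xD(1)]) auto
      then show "(\<lambda>n. iterate z n (cnj x) 1) \<longlonglongrightarrow> cnj (chit z x)" using iter_props[OF z] by simp
    qed
    also have "\<dots> = chit z x" using x chit_of_real[OF z, of b] b pq by simp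
    finally have "cnj x = x" using B(2) cx x(1) by (auto simp: inj_on_def)
    then obtain t where xr: "x = of_real t" using Reals_cnj_iff[of x] by (auto elim: Reals_cases)
    have "\<bar>t - a\<bar> < r2" using x(1) unfolding xr B_def by (simp add: dist_norm norm_minus_commute flip: of_real_diff)
    then have rx: "-88/100 < t" "t < 0" using r2 by auto
    have "hit z t = hit z b"
      using x(2) chit_of_real[OF z, of t] chit_of_real[OF z, of b] rx b pq unfolding xr by auto
    then have "partner b = t" using partner_eq[OF b(1)] rx by simp
    then have xp: "x = of_real (partner b)" using xr by simp
    have "chit w (of_real (partner b) - of_real c) = of_real (hit w (partner b - c))"
    proof -
      have "\<bar>partner b - c\<bar> < 9/10" using partner[OF b(1)] c by linarith
      then show ?thesis using chit_of_real[OF w, of "partner b - c"] by simp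
    qed
    moreover have "chit w (of_real b - of_real c) = of_real (hit w (b - c))"
    proof -
      have "b \<le> q" "p \<le> b" using b by auto
      then have "\<bar>b - c\<bar> < 9/10" using pq c by linarith
      then show ?thesis using chit_of_real[OF w, of "b - c"] by simp
    qed
    ultimately show ?thesis unfolding G_def gap_def x_def[symmetric] xp by simp
  qed
  ultimately show ?thesis using that r by blast
qed

lemma gap_continuous: "continuous_on {p..q} gap"
  unfolding continuous_on_eq_continuous_within
proof
  fix b0 assume b0: "b0 \<in> {p..q}"
  obtain G r where G: "r > 0" "G holomorphic_on ball (of_real b0) r"
    "\<And>b. b \<in> {p..q} \<Longrightarrow> \<bar>b - b0\<bar> < r \<Longrightarrow> G (of_real b) = of_real (gap b)"
    using gap_local[OF b0] by blast
  have "continuous_on (ball b0 r) (\<lambda>b. Re (G (of_real b)))"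
    by (intro continuous_intros continuous_on_compose2[OF holomorphic_on_imp_continuous_on[OF G(2)]])
      (auto simp: dist_norm simp flip: of_real_diff)
  then have "isCont (\<lambda>b. Re (G (of_real b))) b0" using G(1) by (simp add: continuous_on_eq_continuous_at)
  then have "continuous (at b0 within {p..q}) (\<lambda>b. Re (G (of_real b)))" by (rule continuous_at_imp_continuous_at_within)
  then show "continuous (at b0 within {p..q}) gap"
    by (rule continuous_transform_within[OF _ G(1) b0]) (use G(3) in \<open>auto simp: dist_real_def\<close>)
qed

lemma gap_zero_propagates:
  assumes b0: "b0 \<in> {p..q}" and lim: "\<And>e. e > 0 \<Longrightarrow> \<exists>b\<in>{p..q}. b \<noteq> b0 \<and> \<bar>b - b0\<bar> < e \<and> gap b = 0"
  shows "\<exists>r>0. \<forall>b\<in>{p..q}. \<bar>b - b0\<bar> < r \<longrightarrow> gap b = 0"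
proof -
  obtain G r where G: "r > 0" "G holomorphic_on ball (of_real b0) r"
    "\<And>b. b \<in> {p..q} \<Longrightarrow> \<bar>b - b0\<bar> < r \<Longrightarrow> G (of_real b) = of_real (gap b)"
    using gap_local[OF b0] by blast
  have "G x = 0" if "x \<in> ball (of_real b0) r" for x
  proof (rule analytic_continuation[OF G(2) open_ball connected_ball _ _ _ _ that])
    let ?U = "of_real ` {b \<in> {p..q}. \<bar>b - b0\<bar> < r \<and> gap b = 0}"
    show "?U \<subseteq> ball (complex_of_real b0) r" by (auto simp: dist_norm norm_minus_commute simp flip: of_real_diff)
    show "of_real b0 \<in> ball (complex_of_real b0) r" using G by simp
    show "complex_of_real b0 islimpt ?U" unfolding islimpt_approachable
    proof (intro allI impI)
      fix e :: real assume "e > 0"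
      then obtain b where b: "b \<in> {p..q}" "b \<noteq> b0" "\<bar>b - b0\<bar> < min e r" "gap b = 0" using lim[of "min e r"] G by auto
      then show "\<exists>x'\<in>?U. x' \<noteq> complex_of_real b0 \<and> dist x' (complex_of_real b0) < e"
        by (intro bexI[of _ "complex_of_real b"]) (auto simp: dist_norm simp flip: of_real_diff)
    qed
    show "G x = 0" if "x \<in> ?U" for x using that G(3) by auto
  qed
  moreover have "of_real b \<in> ball (complex_of_real b0) r" if "\<bar>b - b0\<bar> < r" for b
    using that by (simp add: dist_norm norm_minus_commute flip: of_real_diff)
  ultimately show ?thesis using G by (metis of_real_eq_0_iff)
qed

text \<open>
  The points near which the gap vanishes identically form a set that is open and closed in the
  interval, by the identity theorem. If a zero were not isolated, this set would reach down to the
  left end, where the gap is nonzero.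
\<close>
lemma gap_zero_isolated:
  assumes b0: "b0 \<in> {p..q}" and np: "gap p \<noteq> 0"
  obtains e where "e > 0" "\<And>b. b \<in> {p..q} \<Longrightarrow> \<bar>b - b0\<bar> < e \<Longrightarrow> gap b = 0 \<Longrightarrow> b = b0"
proof (rule ccontr)
  assume "\<not> thesis"
  then have lim: "\<And>e. e > 0 \<Longrightarrow> \<exists>b\<in>{p..q}. b \<noteq> b0 \<and> \<bar>b - b0\<bar> < e \<and> gap b = 0" using that by blast
  obtain r0 where r0: "r0 > 0" "\<And>b. b \<in> {p..q} \<Longrightarrow> \<bar>b - b0\<bar> < r0 \<Longrightarrow> gap b = 0"
    using gap_zero_propagates[OF b0 lim] by auto
  define T where "T = {t \<in> {p..b0}. \<forall>b\<in>{t..b0}. gap b = 0}"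
  have T0: "b0 \<in> T" using r0 b0 by (auto simp: T_def)
  have bd: "bdd_below T" by (rule bdd_belowI[of _ p]) (auto simp: T_def)
  define t where "t = Inf T"
  have tb: "p \<le> t" "t \<le> b0" 
  proof -
    show "p \<le> t" unfolding t_def by (rule cInf_greatest) (use T0 in \<open>auto simp: T_def\<close>)
    show "t \<le> b0" unfolding t_def by (rule cInf_lower[OF T0 bd])
  qed
  have z: "gap b = 0" if tb': "t < b" "b \<le> b0" for b
  proof -
    have "T \<noteq> {}" using T0 by blast
    then obtain s where "s \<in> T" "s < b" using tb'(1) cInf_less_iff[of T b] bd unfolding t_def by auto
    then show ?thesis using that by (auto simp: T_def)
  qed
  have "\<exists>b\<in>{p..q}. b \<noteq> t \<and> \<bar>b - t\<bar> < e \<and> gap b = 0" if "e > 0" for e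
  proof (cases "t = b0")
    case False
    then show ?thesis using z[of "min b0 (t + e/2)"] that tb b0 by (intro bexI[of _ "min b0 (t + e/2)"]) auto
  qed (use lim that in auto)
  from gap_zero_propagates[OF _ this] tb b0 obtain r where r: "r > 0" "\<And>b. b \<in> {p..q} \<Longrightarrow> \<bar>b - t\<bar> < r \<Longrightarrow> gap b = 0"
    by auto
  have "t \<noteq> p" using r(2)[of p] r(1) np pq by auto
  define s where "s = max p (t - r/2)"
  have s: "s < t" "p \<le> s" using r tb \<open>t \<noteq> p\<close> by (auto simp: s_def)
  have "gap b = 0" if "b \<in> {s..b0}" for b
  proof (cases "b \<le> t")
    case True then show ?thesis using r that s b0 tb by (intro r(2)) (auto simp: s_def)
  qed (use z that in auto)
  then have "s \<in> T" using s tb by (auto simp: T_def)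
  then show False using s cInf_lower[OF _ bd] by (fastforce simp: t_def)
qed

end

section \<open>From graphs to periodic orbits\<close>

definition upper_field :: "(nat \<Rightarrow> real) \<Rightarrow> plane \<Rightarrow> plane" where
  "upper_field z = (\<lambda>(x, y). (fP z x y, fQ z x y))"
definition lower_field :: "(nat \<Rightarrow> real) \<Rightarrow> real \<Rightarrow> plane \<Rightarrow> plane" where
  "lower_field w c = (\<lambda>(x, y). (- fP w (x - c) (- y), fQ w (x - c) (- y)))"

lemma lie_snd: "lie_derivative Z snd p = snd (Z p)"
proof -
  have e: "snd = (\<lambda>p::plane. (0, 1) \<bullet> p)" by (auto simp: inner_prod_def)
  have "gradient snd p = (0, 1)" by (subst e) (rule gradient_inner)
  then show ?thesis by (simp add: lie_derivative_def inner_prod_def)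
qed

text \<open>
  Since \<open>P < 0\<close>, the first coordinate is strictly decreasing in time and can serve as the independent
  variable.
\<close>
lemma upper_pass:
  fixes \<gamma> :: "real \<Rightarrow> plane"
  assumes z: "small_coeffs z" and st: "s < t" and c: "continuous_on {s..t} \<gamma>"
    and d: "\<And>r. s < r \<Longrightarrow> r < t \<Longrightarrow> (\<gamma> has_vector_derivative upper_field z (\<gamma> r)) (at r)"
    and y: "\<And>r. s < r \<Longrightarrow> r < t \<Longrightarrow> 0 < snd (\<gamma> r) \<and> snd (\<gamma> r) < 5/2" "snd (\<gamma> s) = 0" "snd (\<gamma> t) = 0"
    and x: "\<And>r. s \<le> r \<Longrightarrow> r \<le> t \<Longrightarrow> \<bar>fst (\<gamma> r)\<bar> < 9/10"
    and ab: "a = fst (\<gamma> t)" "b = fst (\<gamma> s)"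
  shows "a < b \<and> (a < 0 \<longrightarrow> 0 < b \<longrightarrow> (\<exists>f. orbit_arc z a b f \<and> \<gamma> ` {s..t} = (\<lambda>x. (x, f x)) ` {a..b}))"
proof -
  define X where "X r = fst (\<gamma> r)" for r
  define Y where "Y r = snd (\<gamma> r)" for r
  have cX: "continuous_on {s..t} X" and cY: "continuous_on {s..t} Y"
    unfolding X_def Y_def using c by (auto intro!: continuous_intros)
  have dX: "(X has_real_derivative fP z (X r) (Y r)) (at r)" and dY: "(Y has_real_derivative fQ z (X r) (Y r)) (at r)"
    if "s < r" "r < t" for r
  proof -
    have e: "upper_field z (\<gamma> r) = (fP z (X r) (Y r), fQ z (X r) (Y r))" by (simp add: upper_field_def X_def Y_def case_prod_unfold)
    note dd = d[OF that, unfolded e]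
    show "(X has_real_derivative fP z (X r) (Y r)) (at r)"
      using bounded_linear.has_vector_derivative[OF bounded_linear_fst dd] unfolding X_def has_real_derivative_iff_has_vector_derivative by simp
    show "(Y has_real_derivative fQ z (X r) (Y r)) (at r)"
      using bounded_linear.has_vector_derivative[OF bounded_linear_snd dd] unfolding Y_def has_real_derivative_iff_has_vector_derivative by simp
  qed
  have neg: "fP z (X r) (Y r) < 0" if "s < r" "r < t" for r
    using fP_neg[OF z, of "X r" "Y r"] x[of r] y(1)[OF that] that by (simp add: X_def Y_def)
  have dec: "X q < X p" if "s \<le> p" "p < q" "q \<le> t" for p q
  proof (rule DERIV_neg_imp_decreasing_open[OF that(2)])
    show "\<exists>l. (X has_real_derivative l) (at r) \<and> l < 0" if "p < r" "r < q" for r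
      using dX[of r] neg[of r] that \<open>s \<le> p\<close> \<open>q \<le> t\<close> by force
    show "continuous_on {p..q} X" using cX by (rule continuous_on_subset) (use that in auto)
  qed
  have X_ab: "X s = b" "X t = a" by (simp_all add: X_def ab)
  have "a < b" using dec[of s t] st X_ab by simp
  have inj: "inj_on X {s..t}" unfolding inj_on_def
  proof (intro ballI impI)
    fix p q assume pq: "p \<in> {s..t}" "q \<in> {s..t}" "X p = X q"
    show "p = q" using dec[of p q] dec[of q p] pq by (cases p q rule: linorder_cases) auto
  qed
  have img: "X ` {s..t} = {a..b}"
  proof
    show "X ` {s..t} \<subseteq> {a..b}"
    proof
      fix v assume "v \<in> X ` {s..t}"
      then obtain r where r: "r \<in> {s..t}" "v = X r" by blast
      then show "v \<in> {a..b}" using dec[of s r] dec[of r t] X_ab by (cases "r = s"; cases "r = t") auto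
    qed
    show "{a..b} \<subseteq> X ` {s..t}"
    proof
      fix v assume "v \<in> {a..b}"
      then have "\<exists>r\<ge>s. r \<le> t \<and> X r = v" using IVT2'[of X t v s] X_ab cX st by auto
      then show "v \<in> X ` {s..t}" by auto
    qed
  qed
  define T where "T = the_inv_into {s..t} X"
  have TX: "T (X r) = r" if "r \<in> {s..t}" for r unfolding T_def using inj that by (rule the_inv_into_f_f)
  have XT: "X (T v) = v" "T v \<in> {s..t}" if "v \<in> {a..b}" for v
    using that unfolding img[symmetric] T_def by (auto simp: the_inv_into_f_f[OF inj])
  have cT: "continuous_on {a..b} T" unfolding img[symmetric]
    by (rule continuous_on_inv[OF cX]) (use TX in auto)
  define f where "f v = Y (T v)" for v
  have fX: "f (X r) = Y r" if "r \<in> {s..t}" for r using TX[OF that] by (simp add: f_def)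
  have T_int: "s < T v \<and> T v < t" if "a < v" "v < b" for v
  proof -
    have v: "v \<in> {a..b}" using that by simp
    have "T v \<noteq> s" "T v \<noteq> t" using XT(1)[OF v] X_ab that by auto
    then show ?thesis using XT(2)[OF v] by auto
  qed
  have "sol z a b f" unfolding sol_def
  proof (intro conjI ballI)
    show "continuous_on {a..b} f" unfolding f_def
      by (rule continuous_on_compose2[OF cY cT]) (use XT in auto)
    fix v assume v: "v \<in> {a<..<b}"
    then have v': "v \<in> {a..b}" and Ti: "s < T v" "T v < t" using T_int[of v] by auto
    show "\<bar>f v\<bar> \<le> 5/2" using y(1)[OF Ti] by (simp add: f_def Y_def)
    have "isCont T v" using cT v by (intro continuous_on_interior) (auto simp: interior_atLeastAtMost_real)
    have "(T has_real_derivative inverse (fP z (X (T v)) (Y (T v)))) (at v)"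
      by (rule DERIV_inverse_function[where f = X and a = a and b = b]) (use dX[OF Ti] neg[OF Ti] v XT \<open>isCont T v\<close> in auto)
    from DERIV_chain2[OF dY[OF Ti] this] show "(f has_real_derivative fS z v (f v)) (at v)"
      using XT(1)[OF v'] by (simp add: f_def[abs_def] fS_def divide_inverse)
  qed
  moreover have "f a = 0" "f b = 0" using fX[of t] fX[of s] X_ab y(2,3) st by (auto simp: Y_def)
  moreover have "0 < f v \<and> f v < 5/2" if "v \<in> {a<..<b}" for v
    using y(1)[of "T v"] T_int[of v] that by (simp add: f_def Y_def)
  moreover have "\<gamma> ` {s..t} = (\<lambda>x. (x, f x)) ` {a..b}"
  proof -
    have "\<gamma> r = (X r, f (X r))" if "r \<in> {s..t}" for r using fX[OF that] by (simp add: X_def Y_def)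
    then have "\<gamma> ` {s..t} = (\<lambda>r. (X r, f (X r))) ` {s..t}" by (rule image_cong[OF refl])
    then show ?thesis unfolding img[symmetric] by (simp add: image_image)
  qed
  ultimately show ?thesis using \<open>a < b\<close> unfolding orbit_arc_def by blast
qed

text \<open>
  The time needed to travel along the graph is the integral of \<open>- 1 / P\<close>; its inverse function
  parametrises the graph as a trajectory.
\<close>
lemma upper_orbit:
  assumes z: "small_coeffs z" and r: "-9/10 < a" "b < 9/10" and f: "orbit_arc z a b f"
  obtains T \<gamma> where "T > 0" "continuous_on {0..T} \<gamma>" "\<gamma> 0 = (b, 0)" "\<gamma> T = (a, 0)"
    "\<And>t. 0 < t \<Longrightarrow> t < T \<Longrightarrow> (\<gamma> has_vector_derivative upper_field z (\<gamma> t)) (at t) \<and> 0 < snd (\<gamma> t)"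
    "\<gamma> ` {0..T} = (\<lambda>x. (x, f x)) ` {a..b}"
proof -
  have ab: "a < 0" "0 < b" "a < b" and s: "sol z a b f" and f0: "f a = 0" "f b = 0" and fp: "\<And>x. x \<in> {a<..<b} \<Longrightarrow> 0 < f x \<and> f x < 5/2"
    using f by (auto simp: orbit_arc_def)
  have cf: "continuous_on {a..b} f" using s by (simp add: sol_def)
  have fb: "\<bar>f x\<bar> \<le> 5/2" if "x \<in> {a..b}" for x
    using fp[of x] f0 that by (cases "x = a"; cases "x = b") auto
  have P: "fP z x (f x) < 0" if "x \<in> {a..b}" for x
  proof -
    have "\<bar>x\<bar> \<le> 9/10" using that r by auto
    then show ?thesis using fP_neg[OF z, of x "f x"] fb[OF that] by simp
  qed
  have cP: "continuous_on {a..b} (\<lambda>x. fP z x (f x))" unfolding fP_def by (auto intro!: continuous_intros cf)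
  have cI: "continuous_on {a..b} (\<lambda>x. - inverse (fP z x (f x)))" using cP P by (fastforce intro!: continuous_intros)
  define \<tau> where "\<tau> x = integral {a..x} (\<lambda>x. - inverse (fP z x (f x)))" for x
  have d\<tau>: "(\<tau> has_real_derivative - inverse (fP z x (f x))) (at x within {a..b})" if "x \<in> {a..b}" for x
    using integral_has_real_derivative[OF cI that] by (simp add: \<tau>_def[abs_def])
  have c\<tau>: "continuous_on {a..b} \<tau>" by (rule DERIV_continuous_on[OF d\<tau>])
  have d\<tau>': "(\<tau> has_real_derivative - inverse (fP z x (f x))) (at x)" if "x \<in> {a<..<b}" for x
  proof -
    have "at x within {a..b} = at x" using that by (intro at_within_interior) (simp add: interior_atLeastAtMost_real)
    then show ?thesis using d\<tau>[of x] that by simp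
  qed
  have inc: "\<tau> p < \<tau> q" if "a \<le> p" "p < q" "q \<le> b" for p q
  proof (rule DERIV_pos_imp_increasing_open[OF that(2)])
    show "\<exists>l. (\<tau> has_real_derivative l) (at x) \<and> 0 < l" if "p < x" "x < q" for x
      using d\<tau>'[of x] P[of x] that \<open>a \<le> p\<close> \<open>q \<le> b\<close> by (intro exI[of _ "- inverse (fP z x (f x))"]) auto
    show "continuous_on {p..q} \<tau>" using c\<tau> by (rule continuous_on_subset) (use that in auto)
  qed
  define T where "T = \<tau> b"
  have \<tau>a: "\<tau> a = 0" by (simp add: \<tau>_def)
  have T: "T > 0" using inc[of a b] ab \<tau>a by (simp add: T_def)
  have inj: "inj_on \<tau> {a..b}" unfolding inj_on_def
  proof (intro ballI impI)
    fix p q assume pq: "p \<in> {a..b}" "q \<in> {a..b}" "\<tau> p = \<tau> q"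
    show "p = q" using inc[of p q] inc[of q p] pq by (cases p q rule: linorder_cases) auto
  qed
  have img: "\<tau> ` {a..b} = {0..T}"
  proof
    show "\<tau> ` {a..b} \<subseteq> {0..T}"
    proof
      fix v assume "v \<in> \<tau> ` {a..b}"
      then obtain x where x: "x \<in> {a..b}" "v = \<tau> x" by blast
      then show "v \<in> {0..T}" using inc[of a x] inc[of x b] \<tau>a by (cases "x = a"; cases "x = b") (auto simp: T_def)
    qed
    show "{0..T} \<subseteq> \<tau> ` {a..b}"
    proof
      fix v assume "v \<in> {0..T}"
      then have "\<exists>x\<ge>a. x \<le> b \<and> \<tau> x = v" using IVT'[of \<tau> a v b] \<tau>a c\<tau> ab by (auto simp: T_def)
      then show "v \<in> \<tau> ` {a..b}" by auto
    qed
  qed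
  define X where "X = the_inv_into {a..b} \<tau>"
  have X\<tau>: "X (\<tau> x) = x" if "x \<in> {a..b}" for x unfolding X_def using inj that by (rule the_inv_into_f_f)
  have \<tau>X: "\<tau> (X t) = t" "X t \<in> {a..b}" if "t \<in> {0..T}" for t
    using that unfolding img[symmetric] X_def by (auto simp: the_inv_into_f_f[OF inj])
  have cX: "continuous_on {0..T} X" unfolding img[symmetric]
    by (rule continuous_on_inv[OF c\<tau>]) (use X\<tau> in auto)
  have Xe: "X 0 = a" "X T = b" using X\<tau>[of a] X\<tau>[of b] \<tau>a ab by (auto simp: T_def)
  define \<gamma> where "\<gamma> t = (X (T - t), f (X (T - t)))" for t
  have X_int: "X t \<in> {a<..<b}" if "0 < t" "t < T" for t
  proof -
    have t: "t \<in> {0..T}" using that by simp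
    have "X t \<noteq> a" "X t \<noteq> b" using \<tau>X(1)[OF t] \<tau>a that by (auto simp: T_def)
    then show ?thesis using \<tau>X(2)[OF t] by auto
  qed
  have dX: "(X has_real_derivative - fP z (X t) (f (X t))) (at t)" if t: "0 < t" "t < T" for t
  proof -
    have "isCont X t" using cX t by (intro continuous_on_interior) (auto simp: interior_atLeastAtMost_real)
    have "(X has_real_derivative inverse (- inverse (fP z (X t) (f (X t))))) (at t)"
      by (rule DERIV_inverse_function[where f = \<tau> and a = 0 and b = T])
        (use d\<tau>'[OF X_int[OF t]] P[of "X t"] X_int[OF t] t \<tau>X \<open>isCont X t\<close> in auto)
    then show ?thesis by simp
  qed
  show ?thesis
  proof (rule that[OF T])
    show "continuous_on {0..T} \<gamma>" unfolding \<gamma>_def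
      by (intro continuous_intros continuous_on_compose2[OF cX] continuous_on_compose2[OF cf]) (use \<tau>X in auto)
    show "\<gamma> 0 = (b, 0)" "\<gamma> T = (a, 0)" using Xe f0 by (auto simp: \<gamma>_def)
    fix t assume t: "0 < t" "t < T"
    then have t': "0 < T - t" "T - t < T" by auto
    let ?x = "X (T - t)"
    have d1: "((\<lambda>t. X (T - t)) has_real_derivative fP z ?x (f ?x)) (at t)"
    proof -
      have "((\<lambda>t. T - t) has_real_derivative -1) (at t)" by (auto intro!: derivative_eq_intros)
      from DERIV_chain2[where f = X and g = "\<lambda>t. T - t", OF dX[OF t'] this] show ?thesis by simp
    qed
    have "(f has_real_derivative fS z ?x (f ?x)) (at ?x)" using s X_int[OF t'] by (simp add: sol_def)
    from DERIV_chain2[where f = f and g = "\<lambda>t. X (T - t)", OF this d1] have d2: "((\<lambda>t. f (X (T - t))) has_real_derivative fQ z ?x (f ?x)) (at t)"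
      using P[of ?x] X_int[OF t'] by (simp add: fS_def)
    show "(\<gamma> has_vector_derivative upper_field z (\<gamma> t)) (at t) \<and> 0 < snd (\<gamma> t)"
      using has_vector_derivative_Pair[OF d1[unfolded has_real_derivative_iff_has_vector_derivative] d2[unfolded has_real_derivative_iff_has_vector_derivative]]
        fp[OF X_int[OF t']] by (simp add: \<gamma>_def[abs_def] upper_field_def)
  next
    have "\<gamma> ` {0..T} = (\<lambda>t. (X t, f (X t))) ` ((\<lambda>t. T - t) ` {0..T})" by (simp only: \<gamma>_def[abs_def] image_image)
    also have "(\<lambda>t. T - t) ` {0..T} = {0..T}" by simp
    also have "(\<lambda>t. (X t, f (X t))) ` {0..T} = (\<lambda>x. (x, f x)) ` (X ` {0..T})" by (simp add: image_image)
    also have "X ` {0..T} = {a..b}" unfolding img[symmetric] image_image using X\<tau> by force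
    finally show "\<gamma> ` {0..T} = (\<lambda>x. (x, f x)) ` {a..b}" .
  qed
qed

lemma periodic_extension:
  fixes \<gamma>0 :: "real \<Rightarrow> plane"
  assumes T: "T > 0" and c: "continuous_on {0..T} \<gamma>0" and e: "\<gamma>0 T = \<gamma>0 0"
  obtains \<gamma> where "continuous_on UNIV \<gamma>" "\<And>t. \<gamma> (t + T) = \<gamma> t" "\<And>t. t \<in> {0..T} \<Longrightarrow> \<gamma> t = \<gamma>0 t" "range \<gamma> = \<gamma>0 ` {0..T}"
    "\<And>t. \<exists>k::int. t - of_int k * T \<in> {0..<T}" "\<And>t (k::int). \<gamma> (t - of_int k * T) = \<gamma> t"
proof -
  define k where "k t = \<lfloor>t / T\<rfloor>" for t
  define \<gamma> where "\<gamma> t = \<gamma>0 (t - of_int (k t) * T)" for t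
  have kt: "t - of_int (k t) * T \<in> {0..<T}" for t
  proof -
    have "of_int (k t) \<le> t / T" "t / T < of_int (k t) + 1" unfolding k_def by linarith+
    then show ?thesis using T by (auto simp: field_simps)
  qed
  have ku: "k t = j" if "t - of_int j * T \<in> {0..<T}" for t j
    unfolding k_def using that T by (intro floor_unique) (auto simp: field_simps)
  have sh: "\<gamma> (t - of_int j * T) = \<gamma> t" for t j
  proof -
    have "k (t - of_int j * T) = k t - j" by (rule ku) (use kt[of t] in \<open>simp add: algebra_simps\<close>)
    then show ?thesis unfolding \<gamma>_def by (simp only:) (simp add: algebra_simps)
  qed
  have on: "\<gamma> t = \<gamma>0 t" if "t \<in> {0..T}" for t
  proof (cases "t = T")
    case True
    have "k T = 1" by (rule ku) (use T in simp)
    then show ?thesis using True e by (simp add: \<gamma>_def)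
  next
    case False
    then have "k t = 0" using that by (intro ku) auto
    then show ?thesis by (simp add: \<gamma>_def)
  qed
  have cp: "continuous_on {of_int j * T..of_int (j + 1) * T} \<gamma>" for j
  proof -
    have "continuous_on {of_int j * T..of_int (j + 1) * T} (\<lambda>t. \<gamma>0 (t - of_int j * T))"
      by (intro continuous_on_compose2[OF c] continuous_intros) (auto simp: algebra_simps)
    moreover have "\<gamma>0 (t - of_int j * T) = \<gamma> t" if "t \<in> {of_int j * T..of_int (j + 1) * T}" for t
      using on[of "t - of_int j * T"] sh[of t j] that by (auto simp: algebra_simps)
    ultimately show ?thesis by (rule continuous_on_eq)
  qed
  have "continuous_on UNIV \<gamma>"
  proof (rule continuous_at_imp_continuous_on, rule ballI)
    fix t :: real
    let ?j = "k t"
    have "continuous_on ({of_int (?j - 1) * T..of_int (?j - 1 + 1) * T} \<union> {of_int ?j * T..of_int (?j + 1) * T}) \<gamma>"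
      by (intro continuous_on_closed_Un cp) auto
    moreover have "{of_int (?j - 1) * T..of_int (?j - 1 + 1) * T} \<union> {of_int ?j * T..of_int (?j + 1) * T} = {of_int (?j - 1) * T..of_int (?j + 1) * T}"
    proof -
      have "of_int (?j - 1) * T \<le> of_int ?j * T" "of_int ?j * T \<le> of_int (?j + 1) * T"
        using T by (auto intro!: mult_right_mono)
      then show ?thesis unfolding diff_add_cancel by auto
    qed
    moreover have "t \<in> interior {of_int (?j - 1) * T..of_int (?j + 1) * T}"
      using kt[of t] T by (auto simp: interior_atLeastAtMost_real algebra_simps)
    ultimately show "isCont \<gamma> t" by (metis continuous_on_interior)
  qed
  moreover have "\<gamma> (t + T) = \<gamma> t" for t using sh[of t "-1"] by simp
  moreover have "range \<gamma> = \<gamma>0 ` {0..T}"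
  proof
    show "range \<gamma> \<subseteq> \<gamma>0 ` {0..T}" using kt by (force simp: \<gamma>_def)
    show "\<gamma>0 ` {0..T} \<subseteq> range \<gamma>" 
    proof (rule image_subsetI)
      fix t assume "t \<in> {0..T}"
      then have "\<gamma>0 t = \<gamma> t" using on by simp
      then show "\<gamma>0 t \<in> range \<gamma>" by simp
    qed
  qed
  ultimately show ?thesis using that on kt sh by blast
qed

definition cycle :: "real \<Rightarrow> real \<Rightarrow> real \<Rightarrow> (real \<Rightarrow> real) \<Rightarrow> (real \<Rightarrow> real) \<Rightarrow> plane set" where
  "cycle c a b f g = (\<lambda>x. (x, f x)) ` {a..b} \<union> (\<lambda>x. (x, - g (x - c))) ` {a..b}"

lemma sgn_fQ_axis:
  assumes z: "small_coeffs z" and x: "\<bar>x\<bar> < 9/10"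
  shows "\<exists>k>0. fQ z x (0::real) = k * x"
proof -
  have "\<bar>z 5 * x\<bar> \<le> 2/10 * (9/10)" unfolding abs_mult
    by (intro mult_mono) (use z x in \<open>auto simp: small_coeffs_def\<close>)
  then have "2 + z 5 * x > 0" by linarith
  then show ?thesis by (intro exI[of _ "2 + z 5 * x"]) (simp add: fQ_def power2_eq_square algebra_simps)
qed

lemma cycle_periodic:
  assumes z: "small_coeffs z" and w: "small_coeffs w" and c: "\<bar>c\<bar> \<le> 1/100" and r: "-88/100 < a" "a < - \<bar>c\<bar>" "\<bar>c\<bar> < b" "b < 88/100"
    and f: "orbit_arc z a b f" and g: "orbit_arc w (a - c) (b - c) g"
  shows "crossing_periodic_orbit snd (upper_field z) (lower_field w c) (cycle c a b f g)"
proof -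
  obtain T1 \<alpha> where \<alpha>: "T1 > 0" "continuous_on {0..T1} \<alpha>" "\<alpha> 0 = (b, 0)" "\<alpha> T1 = (a, 0)"
    "\<And>t. 0 < t \<Longrightarrow> t < T1 \<Longrightarrow> (\<alpha> has_vector_derivative upper_field z (\<alpha> t)) (at t) \<and> 0 < snd (\<alpha> t)"
    "\<alpha> ` {0..T1} = (\<lambda>x. (x, f x)) ` {a..b}"
  proof -
    have "-9/10 < a" "b < 9/10" using r by auto
    from upper_orbit[OF z this f] show ?thesis using that by blast
  qed
  have r': "-9/10 < a - c" "b - c < 9/10" using r c by linarith+
  obtain T2 \<beta> where \<beta>: "T2 > 0" "continuous_on {0..T2} \<beta>" "\<beta> 0 = (b - c, 0)" "\<beta> T2 = (a - c, 0)"
    "\<And>t. 0 < t \<Longrightarrow> t < T2 \<Longrightarrow> (\<beta> has_vector_derivative upper_field w (\<beta> t)) (at t) \<and> 0 < snd (\<beta> t)"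
    "\<beta> ` {0..T2} = (\<lambda>x. (x, g x)) ` {a - c..b - c}"
    by (rule upper_orbit[OF w r' g]) blast
  define T where "T = T1 + T2"
  define \<beta>' where "\<beta>' t = (fst (\<beta> (T - t)) + c, - snd (\<beta> (T - t)))" for t
  define \<gamma>0 where "\<gamma>0 t = (if t \<le> T1 then \<alpha> t else \<beta>' t)" for t
  have T: "T > 0" using \<alpha>(1) \<beta>(1) by (simp add: T_def)
  have b1: "\<beta>' T1 = \<alpha> T1" using \<alpha>(4) \<beta>(4) by (simp add: \<beta>'_def T_def)
  have cb: "continuous_on {T1..T} \<beta>'" unfolding \<beta>'_def
    by (intro continuous_intros continuous_on_compose2[OF \<beta>(2)]) (auto simp: T_def)
  have "continuous_on ({0..T1} \<union> {T1..T}) \<gamma>0" unfolding \<gamma>0_def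
    by (rule continuous_on_cases) (use \<alpha>(2) cb b1 in auto)
  then have c0: "continuous_on {0..T} \<gamma>0" using \<alpha>(1) \<beta>(1) by (simp add: T_def ivl_disj_un_two_touch)
  have e0: "\<gamma>0 0 = (b, 0)" "\<gamma>0 T = (b, 0)" using \<alpha> \<beta> by (auto simp: \<gamma>0_def \<beta>'_def T_def)
  obtain \<gamma> where \<gamma>: "continuous_on UNIV \<gamma>" "\<And>t. \<gamma> (t + T) = \<gamma> t" "\<And>t. t \<in> {0..T} \<Longrightarrow> \<gamma> t = \<gamma>0 t" "range \<gamma> = \<gamma>0 ` {0..T}"
    "\<And>t. \<exists>k::int. t - of_int k * T \<in> {0..<T}" "\<And>t (k::int). \<gamma> (t - of_int k * T) = \<gamma> t"
  proof -
    have "\<gamma>0 T = \<gamma>0 0" using e0 by simp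
    from periodic_extension[OF T c0 this] show ?thesis using that by blast
  qed
  have up: "\<gamma> t = \<alpha> t" if "t \<in> {0..T1}" for t using \<gamma>(3)[of t] that \<beta>(1) by (simp add: \<gamma>0_def T_def)
  have lo: "\<gamma> t = \<beta>' t" if "t \<in> {T1..T}" for t
    using \<gamma>(3)[of t] that \<alpha>(1) b1 by (cases "t = T1") (auto simp: \<gamma>0_def)
  have im: "\<gamma>0 ` {0..T} = cycle c a b f g"
  proof -
    have "\<gamma>0 ` {0..T} = \<gamma> ` {0..T}" using \<gamma>(3) by (metis image_cong)
    also have "\<gamma> ` {0..T} = \<gamma> ` ({0..T1} \<union> {T1..T})" using \<alpha>(1) \<beta>(1) by (simp add: T_def ivl_disj_un_two_touch)
    also have "\<gamma> ` ({0..T1} \<union> {T1..T}) = \<alpha> ` {0..T1} \<union> \<beta>' ` {T1..T}" unfolding image_Un using up lo by simp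
    also have "\<beta>' ` {T1..T} = (\<lambda>p. (fst p + c, - snd p)) ` (\<beta> ` ((\<lambda>t. T - t) ` {T1..T}))"
      by (simp only: image_image \<beta>'_def[abs_def])
    also have "(\<lambda>t. T - t) ` {T1..T} = {0..T2}" by (simp add: T_def)
    also have "(\<lambda>p. (fst p + c, - snd p)) ` (\<beta> ` {0..T2}) = (\<lambda>x. (x, - g (x - c))) ` ((\<lambda>x. x + c) ` {a - c..b - c})"
      unfolding \<beta>(6) by (simp only: image_image fst_conv snd_conv add_diff_cancel_right')
    also have "(\<lambda>x. x + c) ` {a - c..b - c} = {a..b}" by simp
    finally show ?thesis unfolding cycle_def \<alpha>(6) .
  qed
  have up_d: "0 < snd (\<gamma> t) \<and> (\<gamma> has_vector_derivative upper_field z (\<gamma> t)) (at t)" if t: "0 < t" "t < T1" for t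
  proof -
    have "(\<gamma> has_vector_derivative upper_field z (\<alpha> t)) (at t)"
      by (rule has_vector_derivative_transform_within_open[of \<alpha> _ t "{0<..<T1}"]) (use \<alpha>(5)[OF t] t up in auto)
    then show ?thesis using up[of t] t \<alpha>(5)[OF t] by simp
  qed
  have lo_d: "snd (\<gamma> t) < 0 \<and> (\<gamma> has_vector_derivative lower_field w c (\<gamma> t)) (at t)" if t: "T1 < t" "t < T" for t
  proof -
    have t': "0 < T - t" "T - t < T2" using t by (auto simp: T_def)
    have "((\<lambda>t. T - t) has_vector_derivative -1) (at t)"
      by (auto intro!: derivative_eq_intros simp flip: has_real_derivative_iff_has_vector_derivative)
    from vector_diff_chain_at[OF this, of \<beta>] \<beta>(5)[OF t']
    have d: "((\<lambda>t. \<beta> (T - t)) has_vector_derivative - upper_field w (\<beta> (T - t))) (at t)" by (simp add: o_def)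
    have "(\<beta>' has_vector_derivative (fst (- upper_field w (\<beta> (T - t))), - snd (- upper_field w (\<beta> (T - t))))) (at t)"
      unfolding \<beta>'_def[abs_def]
      using has_vector_derivative_Pair[OF has_vector_derivative_add[OF bounded_linear.has_vector_derivative[OF bounded_linear_fst d] has_vector_derivative_const[of c]]
         has_vector_derivative_minus[OF bounded_linear.has_vector_derivative[OF bounded_linear_snd d]]] by simp
    then have d': "(\<beta>' has_vector_derivative lower_field w c (\<beta>' t)) (at t)"
      by (simp add: lower_field_def upper_field_def \<beta>'_def case_prod_unfold)
    have "(\<gamma> has_vector_derivative lower_field w c (\<beta>' t)) (at t)"
      by (rule has_vector_derivative_transform_within_open[of \<beta>' _ t "{T1<..<T}"]) (use d' t lo in auto)
    then show ?thesis using lo[of t] t \<beta>(5)[OF t'] by (simp add: \<beta>'_def)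
  qed
  have shift: "(\<gamma> has_vector_derivative D) (at t)" if "(\<gamma> has_vector_derivative D) (at (t - of_int k * T))" for t D and k :: int
  proof -
    have "((\<lambda>t. t - of_int k * T) has_vector_derivative 1) (at t)"
      by (auto intro!: derivative_eq_intros simp flip: has_real_derivative_iff_has_vector_derivative)
    from vector_diff_chain_at[OF this that] show ?thesis by (simp add: o_def \<gamma>(6))
  qed
  have ends: "\<gamma> 0 = (b, 0)" "\<gamma> T1 = (a, 0)" using up[of 0] up[of T1] \<alpha> by auto
  have cases: "(0 < snd (\<gamma> t) \<and> (\<gamma> has_vector_derivative upper_field z (\<gamma> t)) (at t)) \<or>
     (snd (\<gamma> t) < 0 \<and> (\<gamma> has_vector_derivative lower_field w c (\<gamma> t)) (at t)) \<or> \<gamma> t = (b, 0) \<or> \<gamma> t = (a, 0)" for t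
  proof -
    obtain k :: int where k: "t - of_int k * T \<in> {0..<T}" using \<gamma>(5) by blast
    let ?s = "t - of_int k * T"
    have s: "\<gamma> ?s = \<gamma> t" by (rule \<gamma>(6))
    consider "?s = 0" | "0 < ?s" "?s < T1" | "?s = T1" | "T1 < ?s" "?s < T" using k by fastforce
    then show ?thesis
      by cases (use ends up_d[of ?s] lo_d[of ?s] shift[of _ t k] s in auto)
  qed
  have cross: "crossing_point snd (upper_field z) (lower_field w c) (x, 0)" if x: "x = a \<or> x = b" for x
  proof -
    obtain k l where k: "k > 0" "fQ z x 0 = k * x" and l: "l > 0" "fQ w (x - c) 0 = l * (x - c)"
      using sgn_fQ_axis[OF z, of x] sgn_fQ_axis[OF w, of "x - c"] x r r' c by fastforce
    have "0 < x * (x - c)" using x r by (auto intro: mult_pos_pos mult_neg_neg)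
    then have "0 < (k * l) * (x * (x - c))" using mult_pos_pos[OF mult_pos_pos[OF k(1) l(1)]] by blast
    then show ?thesis unfolding crossing_point_def lie_snd by (simp add: upper_field_def lower_field_def k l mult_ac)
  qed
  have "periodic_orbit snd (upper_field z) (lower_field w c) (cycle c a b f g)"
    unfolding periodic_orbit_def
  proof (intro exI conjI)
    show "T > 0" "continuous_on UNIV \<gamma>" "\<forall>t. \<gamma> (t + T) = \<gamma> t" "range \<gamma> = cycle c a b f g"
      using T \<gamma> im by auto
    have "(a, 0) \<in> range \<gamma>" "(b, 0) \<in> range \<gamma>" using ends by (metis rangeI)+
    then show "\<forall>p. cycle c a b f g \<noteq> {p}" using \<gamma>(4) im r by auto
    have "{t \<in> {0..T}. snd (\<gamma> t) = 0} \<subseteq> {0, T1, T}"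
    proof
      fix t assume "t \<in> {t \<in> {0..T}. snd (\<gamma> t) = 0}"
      then have t: "0 \<le> t" "t \<le> T" "snd (\<gamma> t) = 0" by auto
      show "t \<in> {0, T1, T}"
      proof (rule ccontr)
        assume "t \<notin> {0, T1, T}"
        then have "(0 < t \<and> t < T1) \<or> (T1 < t \<and> t < T)" using t by auto
        then show False using up_d[of t] lo_d[of t] t(3) by auto
      qed
    qed
    then show "finite {t \<in> {0..T}. snd (\<gamma> t) = 0}" by (rule finite_subset) simp
    show "\<forall>t. 0 < snd (\<gamma> t) \<longrightarrow> (\<gamma> has_vector_derivative upper_field z (\<gamma> t)) (at t)" 
    proof (intro allI impI)
      fix t assume "0 < snd (\<gamma> t)"
      then show "(\<gamma> has_vector_derivative upper_field z (\<gamma> t)) (at t)" using cases[of t] by auto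
    qed
    show "\<forall>t. snd (\<gamma> t) < 0 \<longrightarrow> (\<gamma> has_vector_derivative lower_field w c (\<gamma> t)) (at t)" 
    proof (intro allI impI)
      fix t assume "snd (\<gamma> t) < 0"
      then show "(\<gamma> has_vector_derivative lower_field w c (\<gamma> t)) (at t)" using cases[of t] by auto
    qed
    show "\<forall>t. snd (\<gamma> t) = 0 \<longrightarrow> crossing_point snd (upper_field z) (lower_field w c) (\<gamma> t)"
      using cases cross by (metis less_irrefl)
  qed
  moreover have "(b, 0) \<in> cycle c a b f g" using im \<gamma>(4) ends by (metis rangeI)
  ultimately show ?thesis unfolding crossing_periodic_orbit_def by force
qed

section \<open>Limit cycles at zeros of the gap function\<close>

lemma finite_strict_mono_id:
  fixes f :: "real \<Rightarrow> real"
  assumes fin: "finite A" and f: "f ` A \<subseteq> A" and m: "\<And>x y. x \<in> A \<Longrightarrow> y \<in> A \<Longrightarrow> x < y \<Longrightarrow> f x < f y" and a: "a \<in> A"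
  shows "f a = a"
proof (rule ccontr)
  assume ne: "f a \<noteq> a"
  show False
  proof (cases "a < f a")
    case True
    let ?S = "{x \<in> A. x < f x}"
    have S: "finite ?S" "?S \<noteq> {}" using fin a True by auto
    then have x: "Max ?S \<in> ?S" by (rule Max_in)
    then have "f (Max ?S) \<in> ?S" using f m by auto
    then have "f (Max ?S) \<le> Max ?S" using S(1) by (intro Max_ge)
    then show False using x by auto
  next
    case False
    let ?S = "{x \<in> A. f x < x}"
    have S: "finite ?S" "?S \<noteq> {}" using fin a False ne by auto
    then have x: "Min ?S \<in> ?S" by (rule Min_in)
    then have "f (Min ?S) \<in> ?S" using f m by auto
    then have "Min ?S \<le> f (Min ?S)" using S(1) by (intro Min_le)
    then show False using x by auto
  qed
qed

text \<open>
  It excludes the wrong side after a crossing point; mirrored in time or in sign, it also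
  treats the side before the crossing and crossings in the other direction.
\<close>
lemma positive_slope_start:
  fixes Y \<phi> :: "real \<Rightarrow> real"
  assumes c: "continuous_on UNIV Y" and \<phi>: "isCont \<phi> s" "0 < \<phi> s" and Y: "Y s = 0" and st: "s < t"
    and d: "\<And>r. s < r \<Longrightarrow> r < t \<Longrightarrow> (Y has_real_derivative \<phi> r) (at r) \<and> Y r < 0"
  shows False
proof -
  have "eventually (\<lambda>r. 0 < \<phi> r) (at s)" using \<phi> by (intro order_tendstoD(1)[of \<phi> "\<phi> s"]) (simp_all add: isCont_def)
  then obtain e where e: "e > 0" "\<And>r. r \<noteq> s \<Longrightarrow> dist r s < e \<Longrightarrow> 0 < \<phi> r" unfolding eventually_at by blast
  define q where "q = min ((s + t) / 2) (s + e / 2)"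
  have q: "s < q" "q < t" "q < s + e" using st e by (auto simp: q_def min_def)
  have "Y s < Y q"
  proof (rule DERIV_pos_imp_increasing_open[OF q(1)])
    show "\<exists>l. (Y has_real_derivative l) (at r) \<and> 0 < l" if "s < r" "r < q" for r
      using d[of r] e(2)[of r] that q by (intro exI[of _ "\<phi> r"]) (auto simp: dist_real_def)
    show "continuous_on {s..q} Y" using c by (rule continuous_on_subset) simp
  qed
  then show False using Y d[of q] q by simp
qed

lemma constant_sign:
  fixes Y :: "real \<Rightarrow> real"
  assumes c: "continuous_on UNIV Y" and S: "connected S" and nz: "\<And>t. t \<in> S \<Longrightarrow> Y t \<noteq> 0"
  shows "(\<forall>t\<in>S. 0 < Y t) \<or> (\<forall>t\<in>S. Y t < 0)"
proof (rule ccontr)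
  assume "\<not> ?thesis"
  then obtain s t where st: "s \<in> S" "t \<in> S" "Y s \<le> 0" "0 \<le> Y t" by (meson not_less)
  have "connected (Y ` S)" by (rule connected_continuous_image[OF continuous_on_subset[OF c] S]) simp
  from connectedD_interval[OF this _ _ st(3,4)] st have "0 \<in> Y ` S" by blast
  then show False using nz by auto
qed

context matched_pair
begin

text \<open>
  The isolating neighbourhood meets the line only near the two crossing points. A periodic orbit
  inside it crosses upwards near \<open>b\<close> and downwards near \<open>a\<close>, so its crossings alternate, and
  the upper and lower arcs are graphs between consecutive crossings. Passing from one crossing near \<open>b\<close> to the
  next is strictly increasing because \<open>hit z\<close> and \<open>hit w\<close> are strictly monotone on both sides of zero. The
  set of crossings is finite, so every crossing near \<open>b\<close> is a zero of the gap and hence equal to \<open>b\<close>.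
\<close>
lemma cycle_isolated:
  assumes b: "p < b" "b < q" "gap b = 0" and np: "gap p \<noteq> 0"
    and a1: "a0 < a1" "a1 < - \<bar>c\<bar>" "hit z a1 < hit z p" and cp: "\<bar>c\<bar> < p"
  obtains \<Gamma> where "crossing_limit_cycle snd (upper_field z) (lower_field w c) \<Gamma>" "(b, 0) \<in> \<Gamma>"
    "\<And>x. (x, 0) \<in> \<Gamma> \<Longrightarrow> 0 < x \<Longrightarrow> x = b" "\<And>v. v \<in> \<Gamma> \<Longrightarrow> norm v \<le> 4"
proof -
  have bI: "b \<in> {p..q}" using b by simp
  have pa: "partner x < a1" if x: "x \<in> {p..q}" for x
  proof (rule ccontr)
    assume "\<not> partner x < a1"
    then have "hit z (partner x) \<le> hit z a1"
      using hit_less_neg[OF z, of a1 "partner x"] partner[OF x] a1 a0 c by (cases "partner x = a1") auto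
    moreover have "hit z p \<le> hit z x" using hit_less[OF z, of p x] pq x by (cases "x = p") auto
    ultimately show False using partner[OF x] a1 by simp
  qed
  define a where "a = partner b"
  have a: "-88/100 < a" "a < a1" "hit z a = hit z b" using partner[OF bI] pa[OF bI] by (auto simp: a_def)
  have cs: "\<bar>x - c\<bar> < 9/10" if "\<bar>x\<bar> < 88/100" for x using that c by linarith
  have hw: "hit w (a - c) = hit w (b - c)" using b(3) by (simp add: gap_def a_def)
  have a2: "-9/10 < a" "a < 0" "0 < b" "b < 9/10" using a a1 b pq by linarith+
  obtain f where f: "orbit_arc z a b f" using arc_exists[OF z a2 a(3)] by blast
  have w1: "-9/10 < a - c" "a - c < 0" "0 < b - c" "b - c < 9/10"
    using a a1 b pq c cp by linarith+
  obtain g where g: "orbit_arc w (a - c) (b - c) g" using arc_exists[OF w w1 hw] by blast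
  define \<Gamma> where "\<Gamma> = cycle c a b f g"
  have per: "crossing_periodic_orbit snd (upper_field z) (lower_field w c) \<Gamma>"
    unfolding \<Gamma>_def by (rule cycle_periodic[OF z w c _ _ _ _ f g]) (use a a1 b pq cp in auto)
  obtain e where e: "e > 0" "\<And>x. x \<in> {p..q} \<Longrightarrow> \<bar>x - b\<bar> < e \<Longrightarrow> gap x = 0 \<Longrightarrow> x = b"
    using gap_zero_isolated[OF bI np] by blast
  define \<eta> where "\<eta> = min e (min (b - p) (q - b))"
  define \<theta> where "\<theta> = min (a1 - a) (a + 88/100)"
  have pos: "\<eta> > 0" "\<theta> > 0" using e b a by (auto simp: \<eta>_def \<theta>_def)
  define nb where "nb x \<longleftrightarrow> \<bar>x - b\<bar> < \<eta>" for x
  define na where "na x \<longleftrightarrow> \<bar>x - a\<bar> < \<theta>" for x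
  have nbD: "x \<in> {p..q}" "0 < x - c" "0 < x" "\<bar>x - b\<bar> < e" if "nb x" for x
    using that cp pq by (auto simp: nb_def \<eta>_def abs_less_iff)
  have naD: "-88/100 < x" "x < a1" "x - c < 0" "x < 0" if "na x" for x
    using that a1 by (auto simp: na_def \<theta>_def abs_less_iff)
  define V where "V = {v::plane. \<bar>fst v\<bar> < 88/100 \<and> \<bar>snd v\<bar> < 5/2 \<and> (snd v \<noteq> 0 \<or> nb (fst v) \<or> na (fst v))}"
  have oV: "open V" unfolding V_def nb_def na_def
    by (intro open_Collect_conj open_Collect_disj open_Collect_less open_Collect_neq continuous_intros)
  have fx: "\<bar>f x\<bar> < 5/2 \<and> (f x = 0 \<longrightarrow> x = a \<or> x = b)" if "x \<in> {a..b}" for x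
  proof (cases "x = a \<or> x = b")
    case True
    then have "f x = 0" using f unfolding orbit_arc_def by auto
    then show ?thesis using True by simp
  next
    case False
    then have "x \<in> {a<..<b}" using that by auto
    then have "0 < f x \<and> f x < 5/2" using f unfolding orbit_arc_def by blast
    then show ?thesis by simp
  qed
  have gx: "\<bar>g (x - c)\<bar> < 5/2 \<and> (g (x - c) = 0 \<longrightarrow> x = a \<or> x = b)" if "x \<in> {a..b}" for x
  proof (cases "x = a \<or> x = b")
    case True
    then have "g (x - c) = 0" using g unfolding orbit_arc_def by auto
    then show ?thesis using True by simp
  next
    case False
    then have "x - c \<in> {a - c<..<b - c}" using that by auto
    then have "0 < g (x - c) \<and> g (x - c) < 5/2" using g unfolding orbit_arc_def by blast
    then show ?thesis by simp
  qed
  have nab: "nb b" "na a" using pos by (auto simp: nb_def na_def)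
  have GV: "\<Gamma> \<subseteq> V"
  proof
    fix v assume "v \<in> \<Gamma>"
    then obtain x where x: "x \<in> {a..b}" "v = (x, f x) \<or> v = (x, - g (x - c))" unfolding \<Gamma>_def cycle_def by auto
    then show "v \<in> V" using fx[OF x(1)] gx[OF x(1)] nab a b pq unfolding V_def by auto
  qed
  have uniq: "\<Delta> = \<Gamma>" if per_D: "periodic_orbit snd (upper_field z) (lower_field w c) \<Delta>" and sub: "\<Delta> \<subseteq> V" for \<Delta>
  proof -
    obtain \<gamma> T where T: "T > 0" and cg: "continuous_on UNIV \<gamma>" and pg: "\<And>t. \<gamma> (t + T) = \<gamma> t" and rg: "range \<gamma> = \<Delta>"
      and fin0: "finite {t \<in> {0..T}. snd (\<gamma> t) = 0}"
      and up: "\<And>t. snd (\<gamma> t) > 0 \<Longrightarrow> (\<gamma> has_vector_derivative upper_field z (\<gamma> t)) (at t)"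
      and lo: "\<And>t. snd (\<gamma> t) < 0 \<Longrightarrow> (\<gamma> has_vector_derivative lower_field w c (\<gamma> t)) (at t)"
      using per_D unfolding periodic_orbit_def by blast
    define X where "X t = fst (\<gamma> t)" for t
    define Y where "Y t = snd (\<gamma> t)" for t
    have gXY: "\<gamma> t = (X t, Y t)" for t by (simp add: X_def Y_def)
    have cX: "continuous_on UNIV X" and cY: "continuous_on UNIV Y" unfolding X_def Y_def by (intro continuous_intros cg)+
    have VX: "\<bar>X t\<bar> < 88/100" "\<bar>Y t\<bar> < 5/2" "Y t = 0 \<Longrightarrow> nb (X t) \<or> na (X t)" for t
    proof -
      have "\<gamma> t \<in> V" using rg sub by blast
      then show "\<bar>X t\<bar> < 88/100" "\<bar>Y t\<bar> < 5/2" "Y t = 0 \<Longrightarrow> nb (X t) \<or> na (X t)" unfolding V_def X_def Y_def by auto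
    qed
    have dX: "(X has_real_derivative fst D) (at t)" and dY: "(Y has_real_derivative snd D) (at t)"
      if "(\<gamma> has_vector_derivative D) (at t)" for D t
      using bounded_linear.has_vector_derivative[OF bounded_linear_fst that] bounded_linear.has_vector_derivative[OF bounded_linear_snd that]
      unfolding X_def[abs_def] Y_def[abs_def] has_real_derivative_iff_has_vector_derivative by auto
    have upX: "(X has_real_derivative fP z (X t) (Y t)) (at t)" and upY: "(Y has_real_derivative fQ z (X t) (Y t)) (at t)" if "0 < Y t" for t
      using dX[OF up[of t]] dY[OF up[of t]] that by (auto simp: Y_def X_def upper_field_def case_prod_unfold)
    have loX: "(X has_real_derivative - fP w (X t - c) (- Y t)) (at t)" and loY: "(Y has_real_derivative fQ w (X t - c) (- Y t)) (at t)" if "Y t < 0" for t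
      using dX[OF lo[of t]] dY[OF lo[of t]] that by (auto simp: Y_def X_def lower_field_def case_prod_unfold)
    have perk: "\<gamma> (t + of_int k * T) = \<gamma> t" for t and k :: int
    proof (induction k rule: int_induct[of _ 0])
      case (step1 i) then show ?case using pg[of "t + of_int i * T"] by (simp add: algebra_simps)
    next
      case (step2 i) then show ?case using pg[of "t + of_int (i - 1) * T"] by (simp add: algebra_simps)
    qed simp
    have floorT: "t - of_int \<lfloor>t / T\<rfloor> * T \<in> {0..<T}" for t
    proof -
      have "of_int \<lfloor>t / T\<rfloor> * T \<le> t"
        using of_int_floor_le[of "t / T"] unfolding pos_le_divide_eq[OF T] .
      moreover have "t / T < of_int \<lfloor>t / T\<rfloor> + 1" by linarith
      then have "t < (of_int \<lfloor>t / T\<rfloor> + 1) * T" unfolding pos_divide_less_eq[OF T] .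
      ultimately show ?thesis by (simp add: distrib_right)
    qed
    have fin: "finite {t \<in> {r..s}. Y t = 0}" for r s
    proof (rule finite_subset)
      show "{t \<in> {r..s}. Y t = 0} \<subseteq> (\<Union>k\<in>{\<lfloor>r/T\<rfloor>..\<lfloor>s/T\<rfloor>}. (\<lambda>x. x + of_int k * T) ` {t \<in> {0..T}. snd (\<gamma> t) = 0})"
      proof
        fix t assume t: "t \<in> {t \<in> {r..s}. Y t = 0}"
        let ?k = "\<lfloor>t / T\<rfloor>"
        have "\<gamma> (t - of_int ?k * T) = \<gamma> t" using perk[of "t - of_int ?k * T" ?k] by simp
        then have "t - of_int ?k * T \<in> {t \<in> {0..T}. snd (\<gamma> t) = 0}" using t floorT[of t] by (simp add: Y_def)
        moreover have "?k \<in> {\<lfloor>r/T\<rfloor>..\<lfloor>s/T\<rfloor>}" using t T by (auto intro!: floor_mono divide_right_mono)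
        ultimately show "t \<in> (\<Union>k\<in>{\<lfloor>r/T\<rfloor>..\<lfloor>s/T\<rfloor>}. (\<lambda>x. x + of_int k * T) ` {t \<in> {0..T}. snd (\<gamma> t) = 0})"
          by (intro UN_I[of ?k] image_eqI[of _ _ "t - of_int ?k * T"]) auto
      qed
    qed (use fin0 in auto)
    have ex0: "\<exists>t. Y t = 0"
    proof (rule ccontr)
      assume "\<nexists>t. Y t = 0"
      then have "(\<forall>t\<in>UNIV. 0 < Y t) \<or> (\<forall>t\<in>UNIV. Y t < 0)" by (intro constant_sign[OF cY]) auto
      moreover have X0: "X T = X 0" using pg[of 0] by (simp add: X_def)
      moreover have "X T < X 0" if "\<forall>t\<in>UNIV. 0 < Y t"
      proof (rule DERIV_neg_imp_decreasing_open[OF T])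
        show "\<exists>l. (X has_real_derivative l) (at t) \<and> l < 0" for t
          using upX[of t] that fP_neg[OF z, of "X t" "Y t"] VX[of t] by (intro exI[of _ "fP z (X t) (Y t)"]) auto
      qed (use cX continuous_on_subset in blast)
      moreover have "X 0 < X T" if "\<forall>t\<in>UNIV. Y t < 0"
      proof (rule DERIV_pos_imp_increasing_open[OF T])
        show "\<exists>l. (X has_real_derivative l) (at t) \<and> 0 < l" for t
          using loX[of t] that fP_neg[OF w, of "X t - c" "- Y t"] VX[of t] cs[of "X t"] by (intro exI[of _ "- fP w (X t - c) (- Y t)"]) auto
      qed (use cX continuous_on_subset in blast)
      ultimately show False by auto
    qed
    define consec where "consec s t \<longleftrightarrow> s < t \<and> Y s = 0 \<and> Y t = 0 \<and> (\<forall>r. s < r \<longrightarrow> r < t \<longrightarrow> Y r \<noteq> 0)" for s t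
    have consec_ex: "\<exists>s r. consec s r \<and> s \<le> t \<and> t < r" for t
    proof -
      obtain t0 where t0: "Y t0 = 0" using ex0 by blast
      define s where "s = t0 + of_int \<lfloor>(t - t0) / T\<rfloor> * T"
      have s: "s \<le> t" "t < s + T" using floorT[of "t - t0"] by (auto simp: s_def)
      have Ys: "Y s = 0" "Y (s + T) = 0" using perk[of t0 "\<lfloor>(t - t0) / T\<rfloor>"] pg[of s] t0 by (auto simp: Y_def s_def)
      let ?A = "{r \<in> {s..t}. Y r = 0}" and ?B = "{r \<in> {t..s+T}. Y r = 0} - {t}"
      have A: "finite ?A" "s \<in> ?A" and B: "finite ?B" "s + T \<in> ?B" using fin s Ys by auto
      have neA: "?A \<noteq> {}" using A(2) by blast
      have neB: "?B \<noteq> {}" using B(2) by blast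
      have mA: "Max ?A \<in> ?A" by (rule Max_in[OF A(1) neA])
      have mB: "Min ?B \<in> ?B" by (rule Min_in[OF B(1) neB])
      have "consec (Max ?A) (Min ?B)" unfolding consec_def
      proof (intro conjI allI impI)
        show "Max ?A < Min ?B" "Y (Max ?A) = 0" "Y (Min ?B) = 0" using mA mB by auto
        fix r assume r: "Max ?A < r" "r < Min ?B"
        show "Y r \<noteq> 0"
        proof
          assume "Y r = 0"
          then have "r \<in> ?A \<or> r \<in> ?B" using r mA mB by auto
          then show False using r Max_ge[OF A(1), of r] Min_le[OF B(1), of r] by auto
        qed
      qed
      then show ?thesis using mA mB by (intro exI[of _ "Max ?A"] exI[of _ "Min ?B"]) auto
    qed
    have consec_start: "s = t0" if "consec s t1" "s \<le> t0" "t0 < t1" "Y t0 = 0" for s t0 t1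
      using that unfolding consec_def by (metis order_le_less)
    have kz: "\<exists>k>0. fQ z (X t) (Y t) = k * X t" and kw: "\<exists>k>0. fQ w (X t - c) (- Y t) = k * (X t - c)" if "Y t = 0" for t
      using sgn_fQ_axis[OF z, of "X t"] sgn_fQ_axis[OF w, of "X t - c"] cs[of "X t"] VX[of t] that by auto
    have cQz: "isCont (\<lambda>t. fQ z (X t) (Y t)) t" and cQw: "isCont (\<lambda>t. fQ w (X t - c) (- Y t)) t" for t
    proof -
      have "continuous_on UNIV (\<lambda>t. fQ z (X t) (Y t))" "continuous_on UNIV (\<lambda>t. fQ w (X t - c) (- Y t))"
        unfolding fQ_def by (intro continuous_intros cX cY)+
      then show "isCont (\<lambda>t. fQ z (X t) (Y t)) t" "isCont (\<lambda>t. fQ w (X t - c) (- Y t)) t" by (auto simp: continuous_on_eq_continuous_at)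
    qed
    have sgn: "(\<forall>r\<in>{s<..<t}. 0 < Y r) \<or> (\<forall>r\<in>{s<..<t}. Y r < 0)" if "consec s t" for s t
      by (rule constant_sign[OF cY]) (use that in \<open>auto simp: consec_def\<close>)
    have cYm: "continuous_on UNIV (\<lambda>r. Y (- r))" by (intro continuous_on_compose2[OF cY] continuous_intros) auto
    have mir: "isCont (\<lambda>r. h (- r)) (- t)" if "isCont h t" for h :: "real \<Rightarrow> real" and t
      by (rule continuous_at_compose[of "- t" uminus h, unfolded o_def]) (use that in auto)
    have dm: "((\<lambda>r. Y (- r)) has_real_derivative - l) (at r)" if "(Y has_real_derivative l) (at (- r))" for l r
      using that DERIV_mirror[of Y l r] by simp
    have start_b: "0 < Y r" if st: "consec s t" and nb: "nb (X s)" and r: "s < r" "r < t" for s t r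
    proof (rule ccontr)
      assume "\<not> 0 < Y r"
      then have neg: "\<And>r. s < r \<Longrightarrow> r < t \<Longrightarrow> Y r < 0" using sgn[OF st] r by auto
      obtain k where "k > 0" "fQ w (X s - c) (- Y s) = k * (X s - c)" using kw[of s] st by (auto simp: consec_def)
      then show False using positive_slope_start[OF cY cQw, of s t] nbD[OF nb] loY neg st by (auto simp: consec_def)
    qed
    have start_a: "Y r < 0" if st: "consec s t" and na: "na (X s)" and r: "s < r" "r < t" for s t r
    proof (rule ccontr)
      assume "\<not> Y r < 0"
      then have ps: "\<And>r. s < r \<Longrightarrow> r < t \<Longrightarrow> 0 < Y r" using sgn[OF st] r by auto
      obtain k where "k > 0" "fQ z (X s) (Y s) = k * X s" using kz[of s] st by (auto simp: consec_def)
      then have "0 < - fQ z (X s) (Y s)" using naD[OF na] by (simp add: mult_pos_neg)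
      moreover have "isCont (\<lambda>t. - fQ z (X t) (Y t)) s" by (intro continuous_intros cQz)
      moreover have "continuous_on UNIV (\<lambda>r. - Y r)" using cY by (intro continuous_intros)
      ultimately show False
        using positive_slope_start[where Y = "\<lambda>r. - Y r" and \<phi> = "\<lambda>t. - fQ z (X t) (Y t)" and s = s and t = t] ps st DERIV_minus[OF upY] by (auto simp: consec_def)
    qed
    have end_b: "Y r < 0" if st: "consec s t" and nb: "nb (X t)" and r: "s < r" "r < t" for s t r
    proof (rule ccontr)
      assume "\<not> Y r < 0"
      then have ps: "\<And>r. s < r \<Longrightarrow> r < t \<Longrightarrow> 0 < Y r" using sgn[OF st] r by auto
      obtain k where "k > 0" "fQ z (X t) (Y t) = k * X t" using kz[of t] st by (auto simp: consec_def)
      then have q: "0 < fQ z (X (- (- t))) (Y (- (- t)))" using nbD[OF nb] by simp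
      have d: "((\<lambda>r. - Y (- r)) has_real_derivative fQ z (X (- r)) (Y (- r))) (at r) \<and> - Y (- r) < 0" if "- t < r" "r < - s" for r
      proof -
        have "0 < Y (- r)" using ps[of "- r"] that by simp
        then show ?thesis using DERIV_minus[OF dm[OF upY]] by simp
      qed
      have "continuous_on UNIV (\<lambda>r. - Y (- r))" by (intro continuous_intros cYm)
      then show False
        by (rule positive_slope_start[where s = "- t" and t = "- s" and \<phi> = "\<lambda>r. fQ z (X (- r)) (Y (- r))", OF _ mir[OF cQz] q _ _ d])
          (use st in \<open>simp_all add: consec_def\<close>)
    qed
    have end_a: "0 < Y r" if st: "consec s t" and na: "na (X t)" and r: "s < r" "r < t" for s t r
    proof (rule ccontr)
      assume "\<not> 0 < Y r"
      then have ng: "\<And>r. s < r \<Longrightarrow> r < t \<Longrightarrow> Y r < 0" using sgn[OF st] r by auto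
      obtain k where "k > 0" "fQ w (X t - c) (- Y t) = k * (X t - c)" using kw[of t] st by (auto simp: consec_def)
      then have q: "0 < - fQ w (X (- (- t)) - c) (- Y (- (- t)))" using naD[OF na] by (simp add: mult_pos_neg)
      have d: "((\<lambda>r. Y (- r)) has_real_derivative - fQ w (X (- r) - c) (- Y (- r))) (at r) \<and> Y (- r) < 0" if "- t < r" "r < - s" for r
      proof -
        have "Y (- r) < 0" using ng[of "- r"] that by simp
        then show ?thesis using dm[OF loY] by simp
      qed
      have ct: "isCont (\<lambda>r. - fQ w (X (- r) - c) (- Y (- r))) (- t)"
        by (rule mir[where h = "\<lambda>r. - fQ w (X r - c) (- Y r)"]) (intro continuous_intros cQw)
      show False
        by (rule positive_slope_start[where s = "- t" and t = "- s" and \<phi> = "\<lambda>r. - fQ w (X (- r) - c) (- Y (- r))", OF cYm ct q _ _ d])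
          (use st in \<open>simp_all add: consec_def\<close>)
    qed
    have mid: "\<exists>r. s < r \<and> r < t" if "consec s t" for s t using that dense unfolding consec_def by blast
    have next_a: "na (X t)" if st: "consec s t" and nbs: "nb (X s)" for s t
    proof -
      obtain r where r: "s < r" "r < t" using mid[OF st] by blast
      show ?thesis using VX(3)[of t] end_b[OF st _ r] start_b[OF st nbs r] st by (auto simp: consec_def)
    qed
    have next_b: "nb (X t)" if st: "consec s t" and nas: "na (X s)" for s t
    proof -
      obtain r where r: "s < r" "r < t" using mid[OF st] by blast
      show ?thesis using VX(3)[of t] end_a[OF st _ r] start_a[OF st nas r] st by (auto simp: consec_def)
    qed
    have arc_up: "\<exists>h. orbit_arc z (X t) (X s) h \<and> \<gamma> ` {s..t} = (\<lambda>x. (x, h x)) ` {X t..X s}" if st: "consec s t" and nb: "nb (X s)" for s t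
    proof -
      have "X t < X s \<and> (X t < 0 \<longrightarrow> 0 < X s \<longrightarrow> (\<exists>h. orbit_arc z (X t) (X s) h \<and> \<gamma> ` {s..t} = (\<lambda>x. (x, h x)) ` {X t..X s}))"
      proof (rule upper_pass[OF z])
        show "s < t" "snd (\<gamma> s) = 0" "snd (\<gamma> t) = 0" using st by (auto simp: consec_def Y_def)
        show "continuous_on {s..t} \<gamma>" using cg by (rule continuous_on_subset) simp
        show "(\<gamma> has_vector_derivative upper_field z (\<gamma> r)) (at r)" if "s < r" "r < t" for r
          using up[of r] start_b[OF st nb that] by (simp add: Y_def)
        show "0 < snd (\<gamma> r) \<and> snd (\<gamma> r) < 5/2" if "s < r" "r < t" for r
          using start_b[OF st nb that] VX(2)[of r] by (simp add: Y_def)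
        show "\<bar>fst (\<gamma> r)\<bar> < 9/10" for r using VX(1)[of r] by (simp add: X_def)
      qed (simp_all add: X_def)
      then show ?thesis using naD[OF next_a[OF st nb]] nbD[OF nb] by blast
    qed
    have arc_lo: "\<exists>h. orbit_arc w (X s - c) (X t - c) h \<and> \<gamma> ` {s..t} = (\<lambda>x. (x, - h (x - c))) ` {X s..X t}" if st: "consec s t" and na: "na (X s)" for s t
    proof -
      define \<beta> where "\<beta> r = (X (- r) - c, - Y (- r))" for r
      have cb: "continuous_on {- t..- s} \<beta>" unfolding \<beta>_def
        by (intro continuous_intros continuous_on_compose2[OF cX] continuous_on_compose2[OF cY]) auto
      have db: "(\<beta> has_vector_derivative upper_field w (\<beta> r)) (at r)" if "- t < r" "r < - s" for r
      proof -
        have ng: "Y (- r) < 0" using start_a[OF st na, of "- r"] that by simp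
        have "((\<lambda>r. X (- r)) has_real_derivative fP w (X (- r) - c) (- Y (- r))) (at r)"
          using loX[OF ng] DERIV_mirror[of X "- fP w (X (- r) - c) (- Y (- r))" r] by simp
        then have 1: "((\<lambda>r. X (- r) - c) has_vector_derivative fP w (X (- r) - c) (- Y (- r))) (at r)"
          unfolding has_real_derivative_iff_has_vector_derivative[symmetric] by (auto intro!: derivative_eq_intros)
        have 2: "((\<lambda>r. - Y (- r)) has_vector_derivative fQ w (X (- r) - c) (- Y (- r))) (at r)"
          unfolding has_real_derivative_iff_has_vector_derivative[symmetric] using DERIV_minus[OF dm[OF loY[OF ng]]] by simp
        show ?thesis using has_vector_derivative_Pair[OF 1 2] by (simp add: \<beta>_def[abs_def] upper_field_def)
      qed
      have "X s - c < X t - c \<and> (X s - c < 0 \<longrightarrow> 0 < X t - c \<longrightarrow> (\<exists>h. orbit_arc w (X s - c) (X t - c) h \<and> \<beta> ` {- t..- s} = (\<lambda>x. (x, h x)) ` {X s - c..X t - c}))"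
      proof (rule upper_pass[OF w _ cb db])
        show "- t < - s" "snd (\<beta> (- t)) = 0" "snd (\<beta> (- s)) = 0" using st by (auto simp: consec_def \<beta>_def)
        show "0 < snd (\<beta> r) \<and> snd (\<beta> r) < 5/2" if "- t < r" "r < - s" for r
          using start_a[OF st na, of "- r"] VX(2)[of "- r"] that by (simp add: \<beta>_def)
        show "\<bar>fst (\<beta> r)\<bar> < 9/10" for r using cs[OF VX(1)] by (simp add: \<beta>_def)
      qed (simp_all add: \<beta>_def)
      then obtain h where h: "orbit_arc w (X s - c) (X t - c) h" "\<beta> ` {- t..- s} = (\<lambda>x. (x, h x)) ` {X s - c..X t - c}"
        using naD[OF na] nbD[OF next_b[OF st na]] by blast
      have "\<gamma> ` {s..t} = (\<lambda>v. (fst v + c, - snd v)) ` (\<beta> ` (uminus ` {s..t}))"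
        unfolding image_image by (rule image_cong) (simp_all add: \<beta>_def gXY)
      also have "uminus ` {s..t} = {- t..- s}" by simp
      also have "(\<lambda>v. (fst v + c, - snd v)) ` (\<beta> ` {- t..- s}) = (\<lambda>x. (x, - h (x - c))) ` ((\<lambda>x. x + c) ` {X s - c..X t - c})"
        unfolding h(2) by (simp only: image_image fst_conv snd_conv add_diff_cancel_right')
      also have "(\<lambda>x. x + c) ` {X s - c..X t - c} = {X s..X t}" by simp
      finally show ?thesis using h(1) by blast
    qed
    have hit_up: "hit z (X t) = hit z (X s)" if st: "consec s t" and nb: "nb (X s)" for s t
    proof -
      obtain h where "orbit_arc z (X t) (X s) h" using arc_up[OF st nb] by blast
      moreover have "-9/10 < X t" "X s < 9/10" using VX(1)[of s] VX(1)[of t] by linarith+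
      ultimately show ?thesis using arc_hit[OF z, of "X t" "X s" h] by blast
    qed
    have hit_lo: "hit w (X s - c) = hit w (X t - c)" if st: "consec s t" and na: "na (X s)" for s t
    proof -
      obtain h where "orbit_arc w (X s - c) (X t - c) h" using arc_lo[OF st na] by blast
      moreover have "-9/10 < X s - c" "X t - c < 9/10" using cs[OF VX(1)[of s]] cs[OF VX(1)[of t]] by linarith+
      ultimately show ?thesis using arc_hit[OF w, of "X s - c" "X t - c" h] by blast
    qed
    define A where "A = {X t | t. Y t = 0 \<and> nb (X t)}"
    have finA: "finite A"
    proof (rule finite_subset)
      show "A \<subseteq> X ` {t \<in> {0..T}. Y t = 0}"
      proof
        fix x assume "x \<in> A"
        then obtain t where t: "x = X t" "Y t = 0" by (auto simp: A_def)
        let ?s = "t - of_int \<lfloor>t / T\<rfloor> * T"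
        have "\<gamma> ?s = \<gamma> t" using perk[of ?s "\<lfloor>t / T\<rfloor>"] by simp
        then show "x \<in> X ` {t \<in> {0..T}. Y t = 0}" using t floorT[of t]
          by (intro image_eqI[of _ _ ?s]) (auto simp: X_def Y_def)
      qed
    qed (use fin in auto)
    have step: "\<exists>x'\<in>A. hit w (partner x - c) = hit w (x' - c)" if xA: "x \<in> A" for x
    proof -
      obtain t0 where t0: "x = X t0" "Y t0 = 0" "nb (X t0)" using xA by (auto simp: A_def)
      obtain s t1 where c1: "consec s t1" "s \<le> t0" "t0 < t1" using consec_ex by blast
      have "s = t0" using consec_start[OF c1 t0(2)] .
      with c1 have c1: "consec t0 t1" by simp
      obtain s t2 where c2: "consec s t2" "s \<le> t1" "t1 < t2" using consec_ex by blast
      have "s = t1" using consec_start[OF c2] c1 by (simp add: consec_def)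
      with c2 have c2: "consec t1 t2" by simp
      have n1: "na (X t1)" by (rule next_a[OF c1 t0(3)])
      have n2: "nb (X t2)" by (rule next_b[OF c2 n1])
      have "partner x = X t1" unfolding t0(1) by (rule partner_eq) (use nbD[OF t0(3)] naD[OF n1] hit_up[OF c1 t0(3)] in auto)
      then show ?thesis using hit_lo[OF c2 n1] n2 c2 by (intro bexI[of _ "X t2"]) (auto simp: A_def consec_def)
    qed
    then obtain \<pi> where \<pi>: "\<And>x. x \<in> A \<Longrightarrow> \<pi> x \<in> A \<and> hit w (partner x - c) = hit w (\<pi> x - c)" by metis
    have Ab: "x = b" if "x \<in> A" for x
    proof -
      have AD: "x \<in> {p..q}" "0 < x - c" "x - c < 9/10" "\<bar>x - b\<bar> < e" if "x \<in> A" for x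
      proof -
        have "nb x" using that by (auto simp: A_def)
        note n = nbD[OF this]
        show "x \<in> {p..q}" "0 < x - c" "\<bar>x - b\<bar> < e" using n by auto
        have "x \<le> q" using n(1) by simp
        then show "x - c < 9/10" using pq c by linarith
      qed
      have "\<pi> x = x"
      proof (rule finite_strict_mono_id[OF finA _ _ that])
        show "\<pi> ` A \<subseteq> A" using \<pi> by blast
        fix x y assume xy: "x \<in> A" "y \<in> A" "x < y"
        note x = AD[OF xy(1)] and y = AD[OF xy(2)]
        have h: "hit z x < hit z y" by (rule hit_less[OF z]) (use x(1) y(1) xy pq in auto)
        have "partner y < partner x"
        proof (rule ccontr)
          assume "\<not> partner y < partner x"
          then have "hit z (partner y) \<le> hit z (partner x)"
            using hit_less_neg[OF z, of "partner x" "partner y"] partner[OF x(1)] partner[OF y(1)] by (cases "partner x = partner y") auto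
          then show False using h partner[OF x(1)] partner[OF y(1)] by simp
        qed
        moreover have "-9/10 < partner y - c" "partner x - c < 0"
          using partner[OF y(1)] pa[OF x(1)] a1 c by linarith+
        ultimately have lt: "hit w (\<pi> x - c) < hit w (\<pi> y - c)"
          using hit_less_neg[OF w, of "partner y - c" "partner x - c"] \<pi>[OF xy(1)] \<pi>[OF xy(2)] by simp
        show "\<pi> x < \<pi> y"
        proof (rule ccontr)
          assume "\<not> \<pi> x < \<pi> y"
          then have "hit w (\<pi> y - c) \<le> hit w (\<pi> x - c)"
            using hit_less[OF w, of "\<pi> y - c" "\<pi> x - c"] AD[of "\<pi> x"] AD[of "\<pi> y"] \<pi>[OF xy(1)] \<pi>[OF xy(2)] by (cases "\<pi> y = \<pi> x") auto
          then show False using lt by simp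
        qed
      qed
      then have "gap x = 0" using \<pi>[OF that] by (simp add: gap_def)
      then show ?thesis using e(2) AD[OF that] by blast
    qed
    have zb: "X t = b" if "Y t = 0" "nb (X t)" for t using Ab[of "X t"] that by (auto simp: A_def)
    have za: "X t = a" if Yt: "Y t = 0" and na: "na (X t)" for t
    proof -
      obtain s t2 where c2: "consec s t2" "s \<le> t" "t < t2" using consec_ex by blast
      have "s = t" using consec_start[OF c2 Yt] .
      with c2 have c2: "consec t t2" by simp
      have "X t2 = b" by (rule zb) (use next_b[OF c2 na] c2 in \<open>auto simp: consec_def\<close>)
      then have h: "hit w (X t - c) = hit w (a - c)" using hit_lo[OF c2 na] hw by simp
      have r: "-9/10 < X t - c" "X t - c < 0" using cs[OF VX(1)[of t]] naD[OF na] by linarith+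
      show ?thesis using hit_less_neg[OF w, of "X t - c" "a - c"] hit_less_neg[OF w, of "a - c" "X t - c"] h r w1
        by (cases "X t" a rule: linorder_cases) auto
    qed
    have img_up: "\<gamma> ` {s..t} = (\<lambda>x. (x, f x)) ` {a..b}" if st: "consec s t" and nb: "nb (X s)" for s t
    proof -
      have X: "X s = b" "X t = a" using zb[of s] za[of t] next_a[OF st nb] nb st by (auto simp: consec_def)
      obtain h where h: "orbit_arc z a b h" "\<gamma> ` {s..t} = (\<lambda>x. (x, h x)) ` {a..b}" using arc_up[OF st nb] X by auto
      have "h x = f x" if "x \<in> {a..b}" for x by (rule arc_unique[OF z _ _ h(1) f that]) (use a b pq in auto)
      then show ?thesis unfolding h(2) by (intro image_cong) auto
    qed
    have img_lo: "\<gamma> ` {s..t} = (\<lambda>x. (x, - g (x - c))) ` {a..b}" if st: "consec s t" and na: "na (X s)" for s t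
    proof -
      have X: "X s = a" "X t = b" using za[of s] zb[of t] next_b[OF st na] na st by (auto simp: consec_def)
      obtain h where h: "orbit_arc w (a - c) (b - c) h" "\<gamma> ` {s..t} = (\<lambda>x. (x, - h (x - c))) ` {a..b}" using arc_lo[OF st na] X by auto
      have "h (x - c) = g (x - c)" if "x \<in> {a..b}" for x by (rule arc_unique[OF w w1(1,4) h(1) g]) (use that in auto)
      then show ?thesis unfolding h(2) by (intro image_cong) auto
    qed
    show "\<Delta> = \<Gamma>"
    proof
      show "\<Delta> \<subseteq> \<Gamma>"
      proof
        fix v assume "v \<in> \<Delta>"
        then obtain t where t: "v = \<gamma> t" using rg by blast
        obtain s r where sr: "consec s r" "s \<le> t" "t < r" using consec_ex by blast
        then have "v \<in> \<gamma> ` {s..r}" using t by auto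
        moreover have "nb (X s) \<or> na (X s)" using VX(3)[of s] sr(1) by (simp add: consec_def)
        ultimately show "v \<in> \<Gamma>" using img_up[OF sr(1)] img_lo[OF sr(1)] unfolding \<Gamma>_def cycle_def by blast
      qed
      show "\<Gamma> \<subseteq> \<Delta>"
      proof -
        obtain s0 r0 where c0: "consec s0 r0" using consec_ex by blast
        obtain s r where c1: "consec s r" "s \<le> r0" "r0 < r" using consec_ex by blast
        have "s = r0" using consec_start[OF c1] c0 by (simp add: consec_def)
        with c1 have c1: "consec r0 r" by simp
        have "nb (X s0) \<or> na (X s0)" using VX(3)[of s0] c0 by (simp add: consec_def)
        then have "\<Gamma> = \<gamma> ` {s0..r0} \<union> \<gamma> ` {r0..r}"
        proof
          assume n: "nb (X s0)"
          show ?thesis using img_up[OF c0 n] img_lo[OF c1 next_a[OF c0 n]] by (simp add: \<Gamma>_def cycle_def)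
        next
          assume n: "na (X s0)"
          show ?thesis using img_lo[OF c0 n] img_up[OF c1 next_b[OF c0 n]] by (simp add: \<Gamma>_def cycle_def Un_commute)
        qed
        then show ?thesis using rg by blast
      qed
    qed
  qed
  have "crossing_limit_cycle snd (upper_field z) (lower_field w c) \<Gamma>"
    unfolding crossing_limit_cycle_def using per oV GV uniq by blast
  moreover have "(b, 0) \<in> \<Gamma>" unfolding \<Gamma>_def cycle_def using f a1 a b pq by (auto simp: orbit_arc_def intro!: image_eqI[of _ _ b])
  moreover have "x = b" if x: "(x, 0) \<in> \<Gamma>" "0 < x" for x
  proof -
    have "x \<in> {a..b}" "f x = 0 \<or> g (x - c) = 0" using x(1) unfolding \<Gamma>_def cycle_def by auto
    then show ?thesis using fx[of x] gx[of x] x(2) a a1 by auto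
  qed
  moreover have "norm v \<le> 4" if "v \<in> \<Gamma>" for v
  proof -
    have v: "\<bar>fst v\<bar> < 88/100" "\<bar>snd v\<bar> < 5/2" using that GV by (auto simp: V_def)
    have "norm v \<le> norm (fst v) + norm (snd v)" using norm_Pair_le[of "fst v" "snd v"] by simp
    then show ?thesis using v by simp
  qed
  ultimately show ?thesis using that by blast
qed

lemma gap_sign_change:
  assumes "p \<le> s" "s < t" "t \<le> q" "gap s * gap t < 0"
  obtains b where "s < b" "b < t" "gap b = 0"
proof -
  have c: "continuous_on {s..t} gap" by (rule continuous_on_subset[OF gap_continuous]) (use assms in auto)
  have "\<exists>b. s \<le> b \<and> b \<le> t \<and> gap b = 0"
  proof (cases "gap s < 0")
    case True
    then show ?thesis using IVT'[of gap s 0 t] assms c by (auto simp: mult_less_0_iff)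
  next
    case False
    then show ?thesis using IVT2'[of gap t 0 s] assms c by (auto simp: mult_less_0_iff)
  qed
  then obtain b where b: "s \<le> b" "b \<le> t" "gap b = 0" by blast
  moreover have "b \<noteq> s" "b \<noteq> t" using b(3) assms(4) by auto
  ultimately show ?thesis using that[of b] by auto
qed

lemma cycles_from_sign_changes:
  fixes tt :: "nat \<Rightarrow> real"
  assumes tt: "tt 0 = p" "tt n = q" "\<And>k. k < n \<Longrightarrow> tt k < tt (Suc k) \<and> gap (tt k) * gap (tt (Suc k)) < 0" and n: "0 < n"
    and a1: "a0 < a1" "a1 < - \<bar>c\<bar>" "hit z a1 < hit z p" and cp: "\<bar>c\<bar> < p"
  obtains C where "finite C" "card C = n" "\<And>\<Gamma>. \<Gamma> \<in> C \<Longrightarrow> crossing_limit_cycle snd (upper_field z) (lower_field w c) \<Gamma>"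
    "\<And>\<Gamma> v. \<Gamma> \<in> C \<Longrightarrow> v \<in> \<Gamma> \<Longrightarrow> norm v \<le> 4"
proof -
  have mono: "i \<le> j \<Longrightarrow> j \<le> n \<Longrightarrow> tt i \<le> tt j" for i j
  proof (induction j rule: dec_induct)
    case (step j) then show ?case using tt(3)[of j] by auto
  qed simp
  have np: "gap p \<noteq> 0" using tt(3)[OF n] tt(1) by auto
  have ex: "\<exists>\<Gamma>. k < n \<longrightarrow> (crossing_limit_cycle snd (upper_field z) (lower_field w c) \<Gamma> \<and> (\<exists>b. tt k < b \<and> b < tt (Suc k) \<and> (b, 0) \<in> \<Gamma> \<and>
      (\<forall>x. (x, 0) \<in> \<Gamma> \<longrightarrow> 0 < x \<longrightarrow> x = b)) \<and> (\<forall>v\<in>\<Gamma>. norm v \<le> 4))" for k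
  proof (cases "k < n")
    case True
    have r: "p \<le> tt k" "tt (Suc k) \<le> q" using mono[of 0 k] mono[of "Suc k" n] tt True by auto
    obtain b where b: "tt k < b" "b < tt (Suc k)" "gap b = 0"
      using gap_sign_change[OF r(1) _ r(2)] tt(3)[OF True] by blast
    have pb: "p < b" "b < q" using b r by linarith+
    obtain \<Gamma> where "crossing_limit_cycle snd (upper_field z) (lower_field w c) \<Gamma>" "(b, 0) \<in> \<Gamma>"
      "\<And>x. (x, 0) \<in> \<Gamma> \<Longrightarrow> 0 < x \<Longrightarrow> x = b" "\<And>v. v \<in> \<Gamma> \<Longrightarrow> norm v \<le> 4"
      by (rule cycle_isolated[OF pb b(3) np a1 cp]) blast
    then show ?thesis using b by blast
  qed blast
  then obtain G where G: "\<And>k. k < n \<Longrightarrow> crossing_limit_cycle snd (upper_field z) (lower_field w c) (G k) \<and> (\<exists>b. tt k < b \<and> b < tt (Suc k) \<and> (b, 0) \<in> G k \<and>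
      (\<forall>x. (x, 0) \<in> G k \<longrightarrow> 0 < x \<longrightarrow> x = b)) \<and> (\<forall>v\<in>G k. norm v \<le> 4)" by metis
  have ne: "G i \<noteq> G j" if ij: "i < j" "j < n" for i j
  proof
    assume e: "G i = G j"
    obtain b where b: "tt i < b" "b < tt (Suc i)" "(b, 0) \<in> G i" "\<forall>x. (x, 0) \<in> G i \<longrightarrow> 0 < x \<longrightarrow> x = b" using G[of i] ij by auto
    obtain b' where b': "tt j < b'" "(b', 0) \<in> G j" using G[of j] ij by auto
    have "0 < b'" using mono[of 0 j] b' ij tt pq by auto
    then have "b' = b" using b b' e by auto
    then show False using b b' mono[of "Suc i" j] ij by auto
  qed
  have inj: "inj_on G {..<n}" unfolding inj_on_def
  proof (intro ballI impI)
    fix i j assume "i \<in> {..<n}" "j \<in> {..<n}" "G i = G j"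
    then show "i = j" using ne[of i j] ne[of j i] by (cases i j rule: linorder_cases) auto
  qed
  show ?thesis
    by (rule that[of "G ` {..<n}"]) (use G card_image[OF inj] in auto)
qed

end

section \<open>Arithmetic on binary numerals\<close>

text \<open>
  Rewriting evaluates these functions much faster than the generic operations on integers. All
  computations below use them.
\<close>
fun inc :: "num \<Rightarrow> num" where
  "inc num.One = num.Bit0 num.One"
| "inc (num.Bit0 n) = num.Bit1 n"
| "inc (num.Bit1 n) = num.Bit0 (inc n)"

fun add0 :: "num \<Rightarrow> num \<Rightarrow> num" and add1 :: "num \<Rightarrow> num \<Rightarrow> num" where
  "add0 num.One n = inc n"
| "add0 (num.Bit0 m) num.One = num.Bit1 m"
| "add0 (num.Bit0 m) (num.Bit0 n) = num.Bit0 (add0 m n)"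
| "add0 (num.Bit0 m) (num.Bit1 n) = num.Bit1 (add0 m n)"
| "add0 (num.Bit1 m) num.One = num.Bit0 (inc m)"
| "add0 (num.Bit1 m) (num.Bit0 n) = num.Bit1 (add0 m n)"
| "add0 (num.Bit1 m) (num.Bit1 n) = num.Bit0 (add1 m n)"
| "add1 num.One num.One = num.Bit1 num.One"
| "add1 num.One (num.Bit0 n) = num.Bit0 (inc n)"
| "add1 num.One (num.Bit1 n) = num.Bit1 (inc n)"
| "add1 (num.Bit0 m) num.One = num.Bit0 (inc m)"
| "add1 (num.Bit0 m) (num.Bit0 n) = num.Bit1 (add0 m n)"
| "add1 (num.Bit0 m) (num.Bit1 n) = num.Bit0 (add1 m n)"
| "add1 (num.Bit1 m) num.One = num.Bit1 (inc m)"
| "add1 (num.Bit1 m) (num.Bit0 n) = num.Bit0 (add1 m n)"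
| "add1 (num.Bit1 m) (num.Bit1 n) = num.Bit1 (add1 m n)"

fun mulN :: "num \<Rightarrow> num \<Rightarrow> num" where
  "mulN num.One n = n"
| "mulN (num.Bit0 m) n = num.Bit0 (mulN m n)"
| "mulN (num.Bit1 m) n = add0 n (num.Bit0 (mulN m n))"

datatype sg = Ze | Po num | Ne num

fun dbl :: "sg \<Rightarrow> sg" where "dbl Ze = Ze" | "dbl (Po n) = Po (num.Bit0 n)" | "dbl (Ne n) = Ne (num.Bit0 n)"
fun dec :: "num \<Rightarrow> num" where
  "dec num.One = num.One" | "dec (num.Bit0 n) = num.Bit1 (dec n)" | "dec (num.Bit1 n) = num.Bit1 (num.Bit0 n)"
fun dblinc :: "sg \<Rightarrow> sg" where "dblinc Ze = Po num.One" | "dblinc (Po n) = Po (num.Bit1 n)" | "dblinc (Ne n) = Ne (dec n)"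
fun dbldec :: "sg \<Rightarrow> sg" where "dbldec Ze = Ne num.One" | "dbldec (Po n) = Po (dec n)" | "dbldec (Ne n) = Ne (num.Bit1 n)"
fun subN :: "num \<Rightarrow> num \<Rightarrow> sg" where
  "subN num.One num.One = Ze"
| "subN num.One (num.Bit0 n) = Ne (dec n)"
| "subN num.One (num.Bit1 n) = Ne (num.Bit0 n)"
| "subN (num.Bit0 m) num.One = Po (dec m)"
| "subN (num.Bit1 m) num.One = Po (num.Bit0 m)"
| "subN (num.Bit0 m) (num.Bit0 n) = dbl (subN m n)"
| "subN (num.Bit0 m) (num.Bit1 n) = dbldec (subN m n)"
| "subN (num.Bit1 m) (num.Bit0 n) = dblinc (subN m n)"
| "subN (num.Bit1 m) (num.Bit1 n) = dbl (subN m n)"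

fun sadd :: "sg \<Rightarrow> sg \<Rightarrow> sg" where
  "sadd Ze y = y"
| "sadd (Po m) Ze = Po m"
| "sadd (Po m) (Po n) = Po (add0 m n)"
| "sadd (Po m) (Ne n) = subN m n"
| "sadd (Ne m) Ze = Ne m"
| "sadd (Ne m) (Po n) = subN n m"
| "sadd (Ne m) (Ne n) = Ne (add0 m n)"
fun sneg :: "sg \<Rightarrow> sg" where "sneg Ze = Ze" | "sneg (Po m) = Ne m" | "sneg (Ne m) = Po m"
fun smul :: "sg \<Rightarrow> sg \<Rightarrow> sg" where
  "smul Ze y = Ze"
| "smul (Po m) Ze = Ze"
| "smul (Po m) (Po n) = Po (mulN n m)"
| "smul (Po m) (Ne n) = Ne (mulN n m)"
| "smul (Ne m) Ze = Ze"
| "smul (Ne m) (Po n) = Ne (mulN n m)"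
| "smul (Ne m) (Ne n) = Po (mulN n m)"

text \<open>
  The first argument is a template for \<open>2 ^ k\<close>, namely \<open>k\<close> zeros followed by the leading one; consuming it digit
  by digit avoids a counter.
\<close>
fun shN :: "num \<Rightarrow> num \<Rightarrow> num option" where
  "shN num.One n = Some n"
| "shN (num.Bit0 t) num.One = None"
| "shN (num.Bit0 t) (num.Bit0 n) = shN t n"
| "shN (num.Bit0 t) (num.Bit1 n) = shN t n"
| "shN (num.Bit1 t) n = None"
fun pos_opt :: "num option \<Rightarrow> sg" where "pos_opt None = Ze" | "pos_opt (Some n) = Po n"
fun shr :: "num \<Rightarrow> sg \<Rightarrow> sg" where
  "shr t Ze = Ze" | "shr t (Po n) = pos_opt (shN t n)" | "shr t (Ne n) = sneg (pos_opt (shN t n))"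

fun dstep2 :: "sg \<Rightarrow> sg \<Rightarrow> sg \<Rightarrow> sg \<times> sg" where
  "dstep2 q r Ze = (dblinc q, Ze)"
| "dstep2 q r (Po s) = (dblinc q, Po s)"
| "dstep2 q r (Ne s) = (dbl q, r)"
fun dvN :: "num \<Rightarrow> num \<Rightarrow> sg \<times> sg" and dstep :: "num \<Rightarrow> (sg \<times> sg) \<Rightarrow> bool \<Rightarrow> sg \<times> sg" where
  "dvN num.One d = dstep d (Ze, Ze) True"
| "dvN (num.Bit0 n) d = dstep d (dvN n d) False"
| "dvN (num.Bit1 n) d = dstep d (dvN n d) True"
| "dstep d (q, r) True = dstep2 q (dblinc r) (sadd (dblinc r) (Ne d))"
| "dstep d (q, r) False = dstep2 q (dbl r) (sadd (dbl r) (Ne d))"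
fun sdiv :: "num \<Rightarrow> sg \<Rightarrow> sg" where
  "sdiv d Ze = Ze" | "sdiv d (Po n) = fst (dvN n d)" | "sdiv d (Ne n) = sneg (fst (dvN n d))"

text \<open>
  Comparing the coefficients of \<open>x ^ i y ^ j\<close> in \<open>P F\<^sub>x + Q F\<^sub>y\<close> determines the coefficient of
  \<open>x ^ (i + 1) y ^ j\<close> in \<open>F\<close>, since \<open>P\<close> begins with \<open>- 1\<close>. The field coefficients are scaled by \<open>2 ^ K\<close>,
  hence the shift; division by \<open>i + 1\<close> comes from \<open>F\<^sub>x\<close>. The term \<open>y * tw\<close> stems from the part \<open>2 x\<close>
  of \<open>Q\<close>, which needs no shift.
\<close>
fun entry :: "num \<Rightarrow> num \<Rightarrow> sg \<Rightarrow> sg \<Rightarrow> sg \<Rightarrow> sg \<Rightarrow> sg \<Rightarrow> sg \<Rightarrow> sg \<Rightarrow> sg \<Rightarrow> sg \<Rightarrow> sg \<Rightarrow> sg \<Rightarrow> sg \<Rightarrow> sg \<Rightarrow> sg \<Rightarrow> sg" where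
  "entry t i a0 a1 a2 a3 a4 a5 tw x0 x1 x2 x3 x4 x5 y =
    sdiv i (sadd (shr t (sadd (smul a0 x0) (sadd (smul a1 x1) (sadd (smul a2 x2) (sadd (smul a3 x3) (sadd (smul a4 x4) (smul a5 x5))))))) (smul y tw))"

fun next_row :: "num \<Rightarrow> num \<Rightarrow> sg \<Rightarrow> sg \<Rightarrow> sg \<Rightarrow> sg \<Rightarrow> sg \<Rightarrow> sg \<Rightarrow> sg \<Rightarrow> sg \<Rightarrow> sg \<Rightarrow> sg \<Rightarrow> sg \<Rightarrow> sg \<Rightarrow> sg \<Rightarrow> sg list \<Rightarrow> sg list \<Rightarrow> sg list \<Rightarrow> sg list \<Rightarrow> sg list" where
  "next_row t i z5 z6 z7 a0 a1 a2 a3 a4 a5 tw p c1 c2 (x0 # r0) (x2 # r1) (y # rt) (x5 # r2) =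
     (let e = entry t i a0 a1 a2 a3 a4 a5 tw x0 c1 x2 p c2 x5 y in
      e # next_row t i z5 z6 z7 a0 a1 (sadd a2 z6) (sadd a3 z7) a4 (sadd a5 z5) (sadd tw (Po (num.Bit0 num.One))) x0 e c1 r0 r1 rt r2)"
| "next_row t i z5 z6 z7 a0 a1 a2 a3 a4 a5 tw p c1 c2 _ _ _ _ = []"

datatype prm = Prm (q0: sg) (q1: sg) (q2: sg) (q3: sg) (q4: sg) (q5: sg) (q6: sg) (q7: sg)

text \<open>
  Row \<open>i + 1\<close> needs rows \<open>i\<close>, \<open>i - 1\<close> and \<open>i - 2\<close>. The arguments \<open>a0\<close> to \<open>a4\<close> are the multiples
  \<open>i z\<^sub>0\<close>, \<open>(i + 1) z\<^sub>1\<close>, \<open>(i - 1) z\<^sub>2\<close>, \<open>i z\<^sub>3 - z\<^sub>7\<close>, \<open>(i + 1) z\<^sub>4\<close>, updated by additions. The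
  list of units bounds the number of rows. A row shortens by one entry every other step, so that exactly the
  monomials of weight \<open>i + 2 j \<le> N\<close> are computed; this weight is the natural one, because
  orbits are close to parabolas.
\<close>
fun rows :: "num \<Rightarrow> prm \<Rightarrow> unit list \<Rightarrow> num \<Rightarrow> sg \<Rightarrow> sg \<Rightarrow> sg \<Rightarrow> sg \<Rightarrow> sg \<Rightarrow> sg list \<Rightarrow> sg list \<Rightarrow> sg list \<Rightarrow> sg list list" where
  "rows t p [] i a0 a1 a2 a3 a4 r0 r1 r2 = []"
| "rows t p (u # us) i a0 a1 a2 a3 a4 r0 r1 r2 =
    (let r = next_row t i (q5 p) (q6 p) (q7 p) a0 a1 a2 a3 a4 (q5 p) (Po (num.Bit0 num.One)) Ze Ze Ze r0 r1 (tl r1) (tl r2) in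
     r # rows t p us (inc i) (sadd a0 (q0 p)) (sadd a1 (q1 p)) (sadd a2 (q2 p)) (sadd a3 (q3 p)) (sadd a4 (q4 p)) r r0 r1)"

fun horner :: "num \<Rightarrow> sg \<Rightarrow> sg list \<Rightarrow> sg" where
  "horner t u [] = Ze"
| "horner t u (a # as) = sadd a (shr t (smul u (horner t u as)))"

fun negligible :: "num \<Rightarrow> sg list \<Rightarrow> bool" where
  "negligible t [] = True"
| "negligible t [a] = (shr t a = Ze)"
| "negligible t [a, b] = (shr t a = Ze \<and> shr t b = Ze)"
| "negligible t (a # b # c # as) = negligible t (b # c # as)"

fun heads :: "sg list list \<Rightarrow> sg list" where
  "heads [] = []" | "heads (r # rs) = hd r # heads rs"

fun digest :: "num \<Rightarrow> sg list list \<Rightarrow> sg list \<times> bool" where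
  "digest t rs = (heads rs, list_all (negligible t) rs)"

section \<open>Values of the arithmetic operations\<close>

fun nv :: "num \<Rightarrow> int" where "nv num.One = 1" | "nv (num.Bit0 n) = 2 * nv n" | "nv (num.Bit1 n) = 2 * nv n + 1"
lemma nv_pos [simp]: "0 < nv n" by (induction n) simp_all
fun iv :: "sg \<Rightarrow> int" where "iv Ze = 0" | "iv (Po n) = nv n" | "iv (Ne n) = - nv n"

lemma inc_val [simp]: "nv (inc n) = nv n + 1"
  by (induction n) simp_all
lemma add_val [simp]: "nv (add0 m n) = nv m + nv n" "nv (add1 m n) = nv m + nv n + 1"
  by (induction m n and m n rule: add0_add1.induct) simp_all
lemma mul_val [simp]: "nv (mulN m n) = nv m * nv n"
  by (induction m) (simp_all add: algebra_simps)
lemma dbl_val [simp]: "iv (dbl x) = 2 * iv x" by (cases x) simp_all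
lemma dec_val [simp]: "nv (dec n) = 2 * nv n - 1" by (induction n) simp_all
lemma dblinc_val [simp]: "iv (dblinc x) = 2 * iv x + 1" by (cases x) simp_all
lemma dbldec_val [simp]: "iv (dbldec x) = 2 * iv x - 1" by (cases x) simp_all
lemma sub_val [simp]: "iv (subN m n) = nv m - nv n"
  by (induction m n rule: subN.induct) simp_all
lemma sadd_val [simp]: "iv (sadd x y) = iv x + iv y" by (cases x; cases y) simp_all
lemma sneg_val [simp]: "iv (sneg x) = - iv x" by (cases x) simp_all
lemma smul_val [simp]: "iv (smul x y) = iv x * iv y"
  by (cases x; cases y) (simp_all add: mult.commute)

definition tmpl :: "nat \<Rightarrow> num" where "tmpl k = (num.Bit0 ^^ k) num.One"

lemma shN_val: "iv (pos_opt (shN (tmpl k) n)) = nv n div 2 ^ k"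
proof (induction k arbitrary: n)
  case 0 then show ?case by (simp add: tmpl_def)
next
  case (Suc k)
  have t: "tmpl (Suc k) = num.Bit0 (tmpl k)" by (simp add: tmpl_def)
  have d: "a div 2 ^ Suc k = (a div 2) div 2 ^ k" for a :: int by (simp add: zdiv_zmult2_eq)
  show ?case
  proof (cases n)
    case One
    have "(1::int) div 2 ^ Suc k = 0" using d[of 1] by simp
    then show ?thesis using One by (simp add: t)
  next
    case (Bit0 m)
    have "nv (num.Bit0 m) div 2 = nv m" by simp
    then show ?thesis using Suc Bit0 d[of "nv (num.Bit0 m)"] by (simp add: t)
  next
    case (Bit1 m)
    have "nv (num.Bit1 m) div 2 = nv m" by simp
    then show ?thesis using Suc Bit1 d[of "nv (num.Bit1 m)"] by (simp add: t)
  qed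
qed

lemma shr_approx: "\<bar>real_of_int (iv (shr (tmpl k) x)) - real_of_int (iv x) / 2 ^ k\<bar> < 1"
proof -
  have *: "\<bar>real_of_int (a div 2^k) - real_of_int a / 2^k\<bar> < 1" for a :: int
  proof -
    have "\<lfloor>real_of_int a / real_of_int (2^k)\<rfloor> = a div 2^k" by (rule floor_divide_of_int_eq)
    then show ?thesis using floor_correct[of "real_of_int a / 2^k"] by simp
  qed
  show ?thesis
  proof (cases x)
    case (Ne n)
    then show ?thesis using *[of "nv n"] by (simp add: shN_val)
  qed (use * in \<open>simp_all add: shN_val\<close>)
qed

lemma shr_Ze: "shr (tmpl k) x = Ze \<Longrightarrow> \<bar>iv x\<bar> \<le> 2 ^ k"
proof -
  assume "shr (tmpl k) x = Ze"
  then have "\<bar>real_of_int (iv x) / 2 ^ k\<bar> < 1" using shr_approx[of k x] by simp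
  then have "\<bar>real_of_int (iv x)\<bar> < 2 ^ k" by (simp add: field_simps)
  then have "real_of_int \<bar>iv x\<bar> < real_of_int (2^k)" by simp
  then show ?thesis by linarith
qed

lemma dstep2_val: "fst (dstep2 q r x) = (if iv x < 0 then dbl q else dblinc q)"
   "snd (dstep2 q r x) = (if iv x < 0 then r else x)"
proof -
  have n: "\<not> nv n < 0" for n using nv_pos[of n] by linarith
  show "fst (dstep2 q r x) = (if iv x < 0 then dbl q else dblinc q)" by (cases x) (simp_all add: n)
  show "snd (dstep2 q r x) = (if iv x < 0 then r else x)" by (cases x) (simp_all add: n)
qed

lemma dstep_val: 
  assumes "0 \<le> iv r" "iv r < nv d"
  shows "iv (fst (dstep d (q, r) b)) * nv d + iv (snd (dstep d (q, r) b)) = 2 * (iv q * nv d + iv r) + of_bool b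
    \<and> 0 \<le> iv (snd (dstep d (q, r) b)) \<and> iv (snd (dstep d (q, r) b)) < nv d"
  using assms by (cases b) (auto simp: dstep2_val algebra_simps)

lemma dvN_val: "iv (fst (dvN n d)) * nv d + iv (snd (dvN n d)) = nv n \<and> 0 \<le> iv (snd (dvN n d)) \<and> iv (snd (dvN n d)) < nv d"
proof (induction n)
  case One
  then show ?case using dstep_val[of Ze d Ze True] by simp
next
  case (Bit0 n)
  then show ?case using dstep_val[of "snd (dvN n d)" d "fst (dvN n d)" False] by simp
next
  case (Bit1 n)
  then show ?case using dstep_val[of "snd (dvN n d)" d "fst (dvN n d)" True] by simp
qed

lemma sdiv_approx: "\<bar>nv d * iv (sdiv d x) - iv x\<bar> < nv d"
proof -
  have "\<bar>nv d * iv (fst (dvN n d)) - nv n\<bar> < nv d" for n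
  proof -
    have "nv d * iv (fst (dvN n d)) - nv n = - iv (snd (dvN n d))" using dvN_val[of n d] by (simp add: mult.commute)
    then show ?thesis using dvN_val[of n d] by simp
  qed
  then show ?thesis by (cases x) (simp_all add: abs_minus_commute)
qed

section \<open>The coefficient recursion\<close>

text \<open>
  Two roundings occur, the shift and the division, with total error at most \<open>i + 1\<close> after
  multiplication by \<open>i\<close>.
\<close>
definition step_ok :: "nat \<Rightarrow> int \<Rightarrow> int \<Rightarrow> int \<Rightarrow> int \<Rightarrow> bool" where
  "step_ok k i e s y \<longleftrightarrow> \<bar>real_of_int (i * e - y) - real_of_int s / 2 ^ k\<bar> \<le> real_of_int i + 1"

lemma entry_ok:
  "step_ok k (nv i) (iv (entry (tmpl k) i a0 a1 a2 a3 a4 a5 tw x0 x1 x2 x3 x4 x5 y))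
    (iv a0 * iv x0 + iv a1 * iv x1 + iv a2 * iv x2 + iv a3 * iv x3 + iv a4 * iv x4 + iv a5 * iv x5) (iv y * iv tw)"
proof -
  define S where "S = sadd (smul a0 x0) (sadd (smul a1 x1) (sadd (smul a2 x2) (sadd (smul a3 x3) (sadd (smul a4 x4) (smul a5 x5)))))"
  define e where "e = sdiv i (sadd (shr (tmpl k) S) (smul y tw))"
  have S: "iv S = iv a0 * iv x0 + iv a1 * iv x1 + iv a2 * iv x2 + iv a3 * iv x3 + iv a4 * iv x4 + iv a5 * iv x5"
    by (simp add: S_def)
  have "\<bar>nv i * iv e - (iv (shr (tmpl k) S) + iv y * iv tw)\<bar> < nv i"
    using sdiv_approx[of i "sadd (shr (tmpl k) S) (smul y tw)"] by (simp add: e_def)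
  then have "\<bar>real_of_int (nv i * iv e - (iv (shr (tmpl k) S) + iv y * iv tw))\<bar> < real_of_int (nv i)" by linarith
  then have "step_ok k (nv i) (iv e) (iv S) (iv y * iv tw)"
    using shr_approx[of k S] unfolding step_ok_def of_int_diff of_int_add by linarith
  then show ?thesis unfolding S by (simp add: e_def S_def)
qed

lemma next_row_length: "length (next_row t i z5 z6 z7 a0 a1 a2 a3 a4 a5 tw p c1 c2 r0 r1 rt r2)
   = min (length r0) (min (length r1) (min (length rt) (length r2)))"
  by (induction t i z5 z6 z7 a0 a1 a2 a3 a4 a5 tw p c1 c2 r0 r1 rt r2 rule: next_row.induct) (simp_all add: Let_def)

lemma next_row_ok:
  assumes "out = next_row (tmpl k) i z5 z6 z7 a0 a1 a2 a3 a4 a5 tw p c1 c2 r0 r1 rt r2" "j < length out"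
  shows "step_ok k (nv i) (iv (out ! j))
    (iv a0 * iv (r0 ! j) + iv a1 * iv ((c2 # c1 # out) ! (j + 1)) + (iv a2 + int j * iv z6) * iv (r1 ! j)
     + (iv a3 + int j * iv z7) * iv ((p # r0) ! j) + iv a4 * iv ((c2 # c1 # out) ! j) + (iv a5 + int j * iv z5) * iv (r2 ! j))
    (iv (rt ! j) * (iv tw + 2 * int j))"
  using assms
proof (induction r0 arbitrary: out j a2 a3 a5 tw p c1 c2 r1 rt r2)
  case (Cons x0 r0)
  from Cons.prems obtain x2 r1' y rt' x5 r2' where e: "r1 = x2 # r1'" "rt = y # rt'" "r2 = x5 # r2'"
    by (cases r1; cases rt; cases r2) (auto simp: Let_def)
  define e0 where "e0 = entry (tmpl k) i a0 a1 a2 a3 a4 a5 tw x0 c1 x2 p c2 x5 y"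
  define out' where "out' = next_row (tmpl k) i z5 z6 z7 a0 a1 (sadd a2 z6) (sadd a3 z7) a4 (sadd a5 z5) (sadd tw (Po (num.Bit0 num.One))) x0 e0 c1 r0 r1' rt' r2'"
  have out: "out = e0 # out'" using Cons.prems(1) by (simp add: e e0_def out'_def Let_def)
  show ?case
  proof (cases j)
    case 0
    then show ?thesis using entry_ok[of k i a0 a1 a2 a3 a4 a5 tw x0 c1 x2 p c2 x5 y] by (simp add: out e e0_def)
  next
    case (Suc l)
    then have "l < length out'" using Cons.prems(2) out by simp
    from Cons.IH[OF out'_def this] show ?thesis by (simp add: Suc out e algebra_simps)
  qed
qed simp

lemma rows_nth:
  assumes "m < length us" and "R = rows t p us i a0 a1 a2 a3 a4 r0 r1 r2"
  shows "length R = length us \<and> (\<exists>i' b0 b1 b2 b3 b4. nv i' = nv i + int m \<and> iv b0 = iv a0 + int m * iv (q0 p) \<and> iv b1 = iv a1 + int m * iv (q1 p)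
    \<and> iv b2 = iv a2 + int m * iv (q2 p) \<and> iv b3 = iv a3 + int m * iv (q3 p) \<and> iv b4 = iv a4 + int m * iv (q4 p)
    \<and> R ! m = next_row t i' (q5 p) (q6 p) (q7 p) b0 b1 b2 b3 b4 (q5 p) (Po (num.Bit0 num.One)) Ze Ze Ze
        ((r2 # r1 # r0 # R) ! (m + 2)) ((r2 # r1 # r0 # R) ! (m + 1)) (tl ((r2 # r1 # r0 # R) ! (m + 1))) (tl ((r2 # r1 # r0 # R) ! m)))"
  using assms
proof (induction us arbitrary: m R i a0 a1 a2 a3 a4 r0 r1 r2)
  case (Cons u us)
  define r where "r = next_row t i (q5 p) (q6 p) (q7 p) a0 a1 a2 a3 a4 (q5 p) (Po (num.Bit0 num.One)) Ze Ze Ze r0 r1 (tl r1) (tl r2)"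
  define R' where "R' = rows t p us (inc i) (sadd a0 (q0 p)) (sadd a1 (q1 p)) (sadd a2 (q2 p)) (sadd a3 (q3 p)) (sadd a4 (q4 p)) r r0 r1"
  have R: "R = r # R'" using Cons.prems(2) by (simp add: Let_def r_def R'_def)
  have len: "length R' = length us"
  proof (cases us)
    case Nil then show ?thesis by (simp add: R'_def)
  next
    case (Cons v vs) then show ?thesis using Cons.IH[of 0, OF _ R'_def] by simp
  qed
  show ?case
  proof (cases m)
    case 0
    show ?thesis unfolding 0
      by (intro conjI exI[of _ i] exI[of _ a0] exI[of _ a1] exI[of _ a2] exI[of _ a3] exI[of _ a4]) (auto simp: R r_def len)
  next
    case (Suc l)
    then have "l < length us" using Cons.prems by simp
    from Cons.IH[OF this R'_def] obtain i' b0 b1 b2 b3 b4 where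
      "nv i' = nv (inc i) + int l" "iv b0 = iv (sadd a0 (q0 p)) + int l * iv (q0 p)" "iv b1 = iv (sadd a1 (q1 p)) + int l * iv (q1 p)"
      "iv b2 = iv (sadd a2 (q2 p)) + int l * iv (q2 p)" "iv b3 = iv (sadd a3 (q3 p)) + int l * iv (q3 p)" "iv b4 = iv (sadd a4 (q4 p)) + int l * iv (q4 p)"
      "R' ! l = next_row t i' (q5 p) (q6 p) (q7 p) b0 b1 b2 b3 b4 (q5 p) (Po (num.Bit0 num.One)) Ze Ze Ze
        ((r1 # r0 # r # R') ! (l + 2)) ((r1 # r0 # r # R') ! (l + 1)) (tl ((r1 # r0 # r # R') ! (l + 1))) (tl ((r1 # r0 # r # R') ! l))" by blast
    then show ?thesis unfolding Suc
      by (intro conjI exI[of _ i'] exI[of _ b0] exI[of _ b1] exI[of _ b2] exI[of _ b3] exI[of _ b4]) (auto simp: R len algebra_simps)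
  qed
qed simp

section \<open>Residual of an approximate first integral\<close>

text \<open>
  Polynomials in two variables are coefficient functions, evaluated on a square; multiplication by a variable
  is a shift, which makes the residual \<open>P F\<^sub>x + Q F\<^sub>y\<close> linear in the coefficients.
\<close>
type_synonym coeffs = "nat \<Rightarrow> nat \<Rightarrow> real"

definition ev :: "nat \<Rightarrow> coeffs \<Rightarrow> real \<Rightarrow> real \<Rightarrow> real" where
  "ev M h x y = (\<Sum>a<M. \<Sum>b<M. h a b * x ^ a * y ^ b)"
definition DX :: "coeffs \<Rightarrow> coeffs" where "DX h a b = (real a + 1) * h (a + 1) b"
definition DY :: "coeffs \<Rightarrow> coeffs" where "DY h a b = (real b + 1) * h a (b + 1)"
definition SX :: "coeffs \<Rightarrow> coeffs" where "SX h a b = (if a = 0 then 0 else h (a - 1) b)"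
definition SY :: "coeffs \<Rightarrow> coeffs" where "SY h a b = (if b = 0 then 0 else h a (b - 1))"
definition weight_le :: "nat \<Rightarrow> coeffs \<Rightarrow> bool" where "weight_le n h \<longleftrightarrow> (\<forall>a b. n < a + 2 * b \<longrightarrow> h a b = 0)"

lemma ev_SX: assumes "weight_le n h" "n + 1 < M" shows "ev M (SX h) x y = x * ev M h x y"
proof (cases M)
  case (Suc m)
  have "h m b = 0" for b using assms Suc by (auto simp: weight_le_def)
  then have "ev M h x y = (\<Sum>a<m. \<Sum>b<M. h a b * x ^ a * y ^ b)" unfolding ev_def Suc sum.lessThan_Suc by simp
  moreover have "ev M (SX h) x y = (\<Sum>a<m. \<Sum>b<M. h a b * x ^ Suc a * y ^ b)"
    unfolding ev_def Suc sum.lessThan_Suc_shift[of _ m] by (simp add: SX_def del: sum.lessThan_Suc)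
  ultimately show ?thesis by (simp add: sum_distrib_left mult_ac)
qed (use assms in simp)

lemma ev_SY: assumes "weight_le n h" "n + 1 < M" shows "ev M (SY h) x y = y * ev M h x y"
proof (cases M)
  case (Suc m)
  have "h a m = 0" for a using assms Suc by (auto simp: weight_le_def)
  then have "ev M h x y = (\<Sum>a<M. \<Sum>b<m. h a b * x ^ a * y ^ b)" unfolding ev_def Suc sum.lessThan_Suc by simp
  moreover have "(\<Sum>b<M. SY h a b * x ^ a * y ^ b) = (\<Sum>b<m. h a b * x ^ a * y ^ Suc b)" for a
    unfolding Suc sum.lessThan_Suc_shift[of _ m] by (simp add: SY_def)
  ultimately show ?thesis by (simp add: ev_def sum_distrib_left mult_ac)
qed (use assms in simp)

lemma weight_le_SX: "weight_le n h \<Longrightarrow> n + 1 \<le> n' \<Longrightarrow> weight_le n' (SX h)" by (auto simp: weight_le_def SX_def)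
lemma weight_le_SY: "weight_le n h \<Longrightarrow> n + 2 \<le> n' \<Longrightarrow> weight_le n' (SY h)" by (auto simp: weight_le_def SY_def)
lemma weight_le_DX: "weight_le n h \<Longrightarrow> n \<le> n' + 1 \<Longrightarrow> weight_le n' (DX h)" by (auto simp: weight_le_def DX_def)
lemma weight_le_DY: "weight_le n h \<Longrightarrow> n \<le> n' + 2 \<Longrightarrow> weight_le n' (DY h)" by (auto simp: weight_le_def DY_def)

definition residual :: "(nat \<Rightarrow> real) \<Rightarrow> coeffs \<Rightarrow> coeffs" where
  "residual z g a b = - DX g a b + z 0 * SX (DX g) a b + z 1 * SY (DX g) a b + z 2 * SX (SX (DX g)) a b
     + z 3 * SX (SY (DX g)) a b + z 4 * SY (SY (DX g)) a b
     + 2 * SX (DY g) a b + z 5 * SX (SX (DY g)) a b + z 6 * SX (SY (DY g)) a b + z 7 * SY (SY (DY g)) a b"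

lemma ev_lin: "ev M (\<lambda>a b. h a b + k a b) x y = ev M h x y + ev M k x y"
  "ev M (\<lambda>a b. r * h a b) x y = r * ev M h x y" "ev M (\<lambda>a b. - h a b) x y = - ev M h x y"
  by (simp_all add: ev_def sum.distrib algebra_simps sum_distrib_left sum_negf)

lemma ev_residual:
  assumes g: "weight_le N g" and N: "2 \<le> N"
  shows "ev (N+4) (residual z g) x y = fP z x y * ev (N+4) (DX g) x y + fQ z x y * ev (N+4) (DY g) x y"
proof -
  have X: "weight_le (N-1) (DX g)" by (rule weight_le_DX[OF g]) simp
  have Y: "weight_le (N-2) (DY g)" by (rule weight_le_DY[OF g]) simp
  have XX: "weight_le N (SX (DX g))" by (rule weight_le_SX[OF X]) (use N in simp)
  have XY: "weight_le (N+1) (SY (DX g))" by (rule weight_le_SY[OF X]) (use N in simp)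
  have YX: "weight_le (N-1) (SX (DY g))" by (rule weight_le_SX[OF Y]) (use N in simp)
  have YY: "weight_le N (SY (DY g))" by (rule weight_le_SY[OF Y]) (use N in simp)
  have "residual z g = (\<lambda>a b. - DX g a b + z 0 * SX (DX g) a b + z 1 * SY (DX g) a b + z 2 * SX (SX (DX g)) a b
     + z 3 * SX (SY (DX g)) a b + z 4 * SY (SY (DX g)) a b
     + 2 * SX (DY g) a b + z 5 * SX (SX (DY g)) a b + z 6 * SX (SY (DY g)) a b + z 7 * SY (SY (DY g)) a b)"
    by (intro ext) (simp add: residual_def)
  then have "ev (N+4) (residual z g) x y = - ev (N+4) (DX g) x y + z 0 * ev (N+4) (SX (DX g)) x y + z 1 * ev (N+4) (SY (DX g)) x y
     + z 2 * ev (N+4) (SX (SX (DX g))) x y + z 3 * ev (N+4) (SX (SY (DX g))) x y + z 4 * ev (N+4) (SY (SY (DX g))) x y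
     + 2 * ev (N+4) (SX (DY g)) x y + z 5 * ev (N+4) (SX (SX (DY g))) x y + z 6 * ev (N+4) (SX (SY (DY g))) x y + z 7 * ev (N+4) (SY (SY (DY g))) x y"
    by (simp only: ev_lin)
  then show ?thesis using N
    by (simp add: ev_SX[OF X] ev_SY[OF X] ev_SX[OF XX] ev_SX[OF XY] ev_SY[OF XY]
       ev_SX[OF Y] ev_SX[OF YX] ev_SX[OF YY] ev_SY[OF YY] ev_SY[OF Y] fP_def fQ_def power2_eq_square algebra_simps)
qed

lemma geometric_bound: "0 \<le> r \<Longrightarrow> r < 1 \<Longrightarrow> (\<Sum>b<n. r ^ b) \<le> 1 / (1 - r)" for r :: real
  by (simp add: sum_gp_strict divide_right_mono)

lemma arith_geometric_bound: "(\<Sum>a<n. (real a + 2) * (17/20) ^ a) \<le> 512/10"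
proof -
  have "(\<Sum>a<n. (real a + 2) * (17/20) ^ a) = 460/9 - (17/20) ^ n * (20/3 * (real n + 2) + 340/9)"
  proof (induction n)
    case (Suc n)
    have "x - r * (20/3 * (m + 2) + 340/9) + (m + 2) * r = x - (17/20 * r) * (20/3 * (1 + m + 2) + 340/9)" for x r m :: real
      by (simp add: field_simps)
    then show ?case unfolding sum.lessThan_Suc Suc by (simp only: of_nat_Suc power_Suc)
  qed simp
  moreover have "0 \<le> (17/20::real) ^ n * (20/3 * (real n + 2) + 340/9)" by simp
  ultimately show ?thesis by linarith
qed

text \<open>
  A bound for the coefficients of the residual of weight \<open>N\<close> and more, which the recursion does not
  control. It is computed from a bound \<open>B\<close> for the coefficients of \<open>F\<close> of the four highest weights, and the
  weight itself contributes the factor \<open>(9/10) ^ N\<close>, because \<open>17/20 \<le> 9/10\<close> and \<open>4/5 \<le> (9/10)\<^sup>2\<close>.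
\<close>
definition shell :: "nat \<Rightarrow> real \<Rightarrow> real" where
  "shell N B = B / 4 * (real N + 7) * (9/10) ^ N"

lemma residual_top:
  assumes z: "small_coeffs z" and g: "weight_le N g" and B: "\<And>i j. N \<le> i + 2 * j + 3 \<Longrightarrow> \<bar>g i j\<bar> \<le> B"
    and ab: "N \<le> a + 2 * b"
  shows "\<bar>residual z g a b\<bar> \<le> B / 4 * (real N + 7)"
proof -
  have B0: "0 \<le> B" using order_trans[OF abs_ge_zero B[of N 0]] by simp
  show ?thesis
  proof (cases "a + 2 * b \<le> N + 3")
    case False
    then have "residual z g a b = 0" using g unfolding residual_def SX_def SY_def DX_def DY_def weight_le_def by auto
    then show ?thesis using B0 by simp
  next
    case True
    let ?A = "(real a + 2) * B" and ?B = "(real b + 2) * B"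
    have p: "0 \<le> ?A" "0 \<le> ?B" using B0 by auto
    have X: "\<bar>DX g i b'\<bar> \<le> ?A" if "N \<le> i + 2 * b' + 4" "i \<le> a + 1" for i b'
      unfolding DX_def abs_mult by (intro mult_mono B) (use that B0 in auto)
    have Y: "\<bar>DY g i b'\<bar> \<le> ?B" if "N \<le> i + 2 * b' + 5" "b' \<le> b + 1" for i b'
      unfolding DY_def abs_mult by (intro mult_mono B) (use that B0 in auto)
    have m: "\<bar>z k * h\<bar> \<le> Z * A" if "\<bar>z k\<bar> \<le> Z" "\<bar>h\<bar> \<le> A" for k h Z A
      unfolding abs_mult using that by (intro mult_mono) auto
    have 1: "DX g a b = 0" using g ab by (simp add: DX_def weight_le_def)
    have 2: "SX (DY g) a b = 0" using g ab by (cases "a = 0") (simp_all add: SX_def DY_def weight_le_def)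
    have s0: "\<bar>SX (DX g) a b\<bar> \<le> ?A" unfolding SX_def by (cases "a = 0") (use p X[of "a - 1" b] ab in simp_all)
    have s1: "\<bar>SY (DX g) a b\<bar> \<le> ?A" unfolding SY_def by (cases "b = 0") (use p X[of a "b - 1"] ab in simp_all)
    have s2: "\<bar>SX (SX (DX g)) a b\<bar> \<le> ?A" unfolding SX_def by (cases "a = 0"; cases "a = 1") (use p X[of "a - Suc (Suc 0)" b] ab in simp_all)
    have s3: "\<bar>SX (SY (DX g)) a b\<bar> \<le> ?A" unfolding SX_def SY_def by (cases "a = 0"; cases "b = 0") (use p X[of "a - 1" "b - 1"] ab in simp_all)
    have s4: "\<bar>SY (SY (DX g)) a b\<bar> \<le> ?A" unfolding SY_def by (cases "b = 0"; cases "b = 1") (use p X[of a "b - Suc (Suc 0)"] ab in simp_all)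
    have s5: "\<bar>SX (SX (DY g)) a b\<bar> \<le> ?B" unfolding SX_def by (cases "a = 0"; cases "a = 1") (use p Y[of "a - Suc (Suc 0)" b] ab in simp_all)
    have s6: "\<bar>SX (SY (DY g)) a b\<bar> \<le> ?B" unfolding SX_def SY_def by (cases "a = 0"; cases "b = 0") (use p Y[of "a - 1" "b - 1"] ab in simp_all)
    have s7: "\<bar>SY (SY (DY g)) a b\<bar> \<le> ?B" unfolding SY_def by (cases "b = 0"; cases "b = 1") (use p Y[of a "b - Suc (Suc 0)"] ab in simp_all)
    have zs: "\<bar>z 0\<bar> \<le> 16/100" "\<bar>z 1\<bar> \<le> 2/100" "\<bar>z 2\<bar> \<le> 4/100" "\<bar>z 3\<bar> \<le> 2/1000" "\<bar>z 4\<bar> \<le> 1/1000"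
      "\<bar>z 5\<bar> \<le> 2/10" "\<bar>z 6\<bar> \<le> 4/100" "\<bar>z 7\<bar> \<le> 2/1000" using z unfolding small_coeffs_def by blast+
    note t = m[OF zs(1) s0] m[OF zs(2) s1] m[OF zs(3) s2] m[OF zs(4) s3] m[OF zs(5) s4] m[OF zs(6) s5] m[OF zs(7) s6] m[OF zs(8) s7]
    have "\<bar>residual z g a b\<bar> \<le> 223/1000 * ((real a + 2) * B) + 242/1000 * ((real b + 2) * B)"
      using t[THEN abs_le_D1] t[THEN abs_le_D2] unfolding residual_def 1 2
      by (intro abs_leI) linarith+
    also have "\<dots> \<le> 1/4 * ((real a + 2) * B) + 1/4 * ((real b + 2) * B)" using p by linarith
    also have "\<dots> = B / 4 * (real a + real b + 4)" by (simp add: algebra_simps)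
    also have "\<dots> \<le> B / 4 * (real N + 7)" using True B0 by (intro mult_left_mono) auto
    finally show ?thesis .
  qed
qed

lemma residual_bound:
  assumes z: "small_coeffs z" and g: "weight_le N g" and B: "\<And>i j. N \<le> i + 2 * j + 3 \<Longrightarrow> \<bar>g i j\<bar> \<le> B"
    and low: "\<And>a b. a + 2 * b < N \<Longrightarrow> \<bar>residual z g a b\<bar> \<le> real a + 2"
    and x: "\<bar>x\<bar> \<le> 17/20" and y: "\<bar>y\<bar> \<le> 4/5"
  shows "\<bar>ev M (residual z g) x y\<bar> \<le> 256 + 1458 * shell N B"
proof -
  have B0: "0 \<le> B" using order_trans[OF abs_ge_zero B[of N 0]] by simp
  define S where "S = shell N B"
  have S0: "0 \<le> S" using B0 by (simp add: S_def shell_def)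
  have t: "\<bar>residual z g a b * x ^ a * y ^ b\<bar> \<le> (real a + 2) * (17/20) ^ a * (4/5) ^ b + S * (17/18) ^ a * (80/81) ^ b" for a b
  proof -
    have xa: "\<bar>x\<bar> ^ a \<le> (17/20) ^ a" using x by (intro power_mono) auto
    have yb: "\<bar>y\<bar> ^ b \<le> (4/5) ^ b" using y by (intro power_mono) auto
    have xy: "\<bar>x\<bar> ^ a * \<bar>y\<bar> ^ b \<le> (17/20) ^ a * (4/5) ^ b" by (intro mult_mono xa yb) auto
    have e: "\<bar>residual z g a b * x ^ a * y ^ b\<bar> = \<bar>residual z g a b\<bar> * (\<bar>x\<bar> ^ a * \<bar>y\<bar> ^ b)"
      by (simp add: abs_mult power_abs)
    show ?thesis
    proof (cases "a + 2 * b < N")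
      case True
      have "\<bar>residual z g a b\<bar> * (\<bar>x\<bar> ^ a * \<bar>y\<bar> ^ b) \<le> (real a + 2) * ((17/20) ^ a * (4/5) ^ b)"
        by (intro mult_mono low[OF True] xy) auto
      moreover have "0 \<le> S * (17/18) ^ a * (80/81) ^ b" using S0 by simp
      ultimately show ?thesis unfolding e by (simp add: mult.assoc)
    next
      case False
      have p: "(17/20::real) ^ a * (4/5) ^ b = (17/18) ^ a * (80/81) ^ b * (9/10) ^ (a + 2 * b)"
        by (simp add: power_add power_mult power_mult_distrib[symmetric] mult_ac) (simp add: power_mult_distrib[symmetric] power2_eq_square)
      have "(9/10::real) ^ (a + 2 * b) \<le> (9/10) ^ N" using False by (intro power_decreasing) auto
      then have q: "\<bar>x\<bar> ^ a * \<bar>y\<bar> ^ b \<le> (17/18) ^ a * (80/81) ^ b * (9/10) ^ N"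
        using xy unfolding p by (meson mult_left_mono order_trans mult_nonneg_nonneg zero_le_power divide_nonneg_nonneg zero_le_numeral)
      have "\<bar>residual z g a b\<bar> * (\<bar>x\<bar> ^ a * \<bar>y\<bar> ^ b) \<le> (B / 4 * (real N + 7)) * ((17/18) ^ a * (80/81) ^ b * (9/10) ^ N)"
        by (intro mult_mono residual_top[OF z g B] q) (use False B0 in auto)
      also have "\<dots> = S * (17/18) ^ a * (80/81) ^ b" by (simp add: S_def shell_def)
      also have "\<dots> \<le> (real a + 2) * (17/20) ^ a * (4/5) ^ b + S * (17/18) ^ a * (80/81) ^ b" by simp
      finally show ?thesis unfolding e .
    qed
  qed
  have "\<bar>ev M (residual z g) x y\<bar> \<le> (\<Sum>a<M. \<Sum>b<M. \<bar>residual z g a b * x ^ a * y ^ b\<bar>)"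
    unfolding ev_def by (rule order_trans[OF sum_abs sum_mono[OF sum_abs]])
  also have "\<dots> \<le> (\<Sum>a<M. \<Sum>b<M. (real a + 2) * (17/20) ^ a * (4/5) ^ b + S * (17/18) ^ a * (80/81) ^ b)"
    by (intro sum_mono t)
  also have "\<dots> = (\<Sum>a<M. (real a + 2) * (17/20) ^ a) * (\<Sum>b<M. (4/5) ^ b) + S * ((\<Sum>a<M. (17/18) ^ a) * (\<Sum>b<M. (80/81) ^ b))"
  proof -
    have p: "(\<Sum>a<M. \<Sum>b<M. f a * h b) = (\<Sum>a<M. f a) * (\<Sum>b<M. h b)" for f h :: "nat \<Rightarrow> real"
      by (simp add: sum_product)
    show ?thesis
      unfolding sum.distrib p[of "\<lambda>a. (real a + 2) * (17/20) ^ a" "\<lambda>b. (4/5) ^ b"] p[of "\<lambda>a. S * (17/18) ^ a" "\<lambda>b. (80/81) ^ b"]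
      by (simp add: sum_distrib_left[symmetric] mult.assoc)
  qed
  also have "\<dots> \<le> (512/10) * 5 + S * (18 * 81)"
    by (intro add_mono mult_mono mult_left_mono S0 arith_geometric_bound order_trans[OF geometric_bound])
      (auto intro!: sum_nonneg mult_nonneg_nonneg)
  finally show ?thesis by (simp add: S_def)
qed

lemma ev_at_0: "0 < M \<Longrightarrow> ev M h 0 y = (\<Sum>b<M. h 0 b * y ^ b)"
  unfolding ev_def by (subst sum.remove[of _ 0]) (auto intro!: sum.neutral simp: power_0_left)
lemma ev_y0: "0 < M \<Longrightarrow> ev M h x 0 = (\<Sum>a<M. h a 0 * x ^ a)"
  unfolding ev_def by (intro sum.cong refl, subst sum.remove[of _ 0]) (auto intro!: sum.neutral simp: power_0_left)

lemma ev_deriv: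
  assumes g: "weight_le N g" and M: "N < M" and Y: "(Y has_real_derivative D) (at t)" and s: "s = 1 \<or> s = (-1::real)"
  shows "((\<lambda>t. ev M g (s * t) (Y t)) has_real_derivative s * ev M (DX g) (s * t) (Y t) + ev M (DY g) (s * t) (Y t) * D) (at t)"
proof -
  obtain m where M': "M = Suc m" using M by (cases M) auto
  have z: "g (Suc m) b = 0" "g a (Suc m) = 0" for a b using g M M' by (auto simp: weight_le_def)
  have h1: "((\<lambda>t. (s * t) ^ a) has_real_derivative real a * (s * t) ^ (a - 1) * s) (at t)" for a
    using DERIV_power[OF DERIV_cmult[OF DERIV_ident, of s t], of a] by (simp add: mult_ac)
  have h2: "((\<lambda>t. Y t ^ b) has_real_derivative real b * Y t ^ (b - 1) * D) (at t)" for b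
    using DERIV_power[OF Y, of b] by (simp add: mult_ac)
  have "((\<lambda>t. g a b * (s * t) ^ a * Y t ^ b) has_real_derivative
     (g a b * (real a * (s * t) ^ (a - 1) * s) * Y t ^ b + g a b * (s * t) ^ a * (real b * Y t ^ (b - 1) * D))) (at t)" for a b
    using DERIV_mult[OF DERIV_cmult[OF h1, of "g a b"] h2] by (simp add: mult_ac)
  then have "((\<lambda>t. ev M g (s * t) (Y t)) has_real_derivative
     (\<Sum>a<M. \<Sum>b<M. g a b * (real a * (s * t) ^ (a - 1) * s) * Y t ^ b + g a b * (s * t) ^ a * (real b * Y t ^ (b - 1) * D))) (at t)"
    unfolding ev_def by (intro DERIV_sum)
  moreover have "(\<Sum>a<M. \<Sum>b<M. g a b * (real a * (s * t) ^ (a - 1) * s) * Y t ^ b) = s * ev M (DX g) (s * t) (Y t)"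
    unfolding M' ev_def sum.lessThan_Suc_shift[of "\<lambda>a. \<Sum>b<Suc m. g a b * (real a * (s * t) ^ (a - 1) * s) * Y t ^ b" m]
    by (simp add: DX_def z sum_distrib_left algebra_simps)
  moreover have "(\<Sum>b<M. g a b * (s * t) ^ a * (real b * Y t ^ (b - 1) * D)) = (\<Sum>b<M. DY g a b * (s * t) ^ a * Y t ^ b) * D" for a
    unfolding M' sum.lessThan_Suc_shift[of "\<lambda>b. g a b * (s * t) ^ a * (real b * Y t ^ (b - 1) * D)" m]
    by (simp add: DY_def z sum_distrib_right sum_distrib_left algebra_simps)
  ultimately show ?thesis by (simp add: sum.distrib ev_def sum_distrib_right)
qed

section \<open>Height of the orbits\<close>

definition low_arc :: "(nat \<Rightarrow> real) \<Rightarrow> real \<Rightarrow> bool" where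
  "low_arc z u \<longleftrightarrow> (\<exists>y. y u = 0 \<and> y 0 = hit z u \<and> (\<forall>x\<in>{0..u}. 0 \<le> y x \<and> y x \<le> 4/5 \<and>
     (y has_real_derivative fS z x (y x)) (at x within {0..u})))"

text \<open>
  On \<open>[0, u]\<close> the slope is at least \<open>- (m x + e)\<close> as long as \<open>0 \<le> y \<le> Y\<close>. A first application with the
  crude \<open>Y\<close> from the Picard iteration gives a better \<open>Y\<close> for a second one.
\<close>
lemma height_le:
  assumes z: "small_coeffs z" and p: "z 0 \<le> p0" "z 5 \<le> p5" "0 \<le> p0" "0 \<le> p5" and u: "0 < u" "u \<le> ub" "ub \<le> 9/10"
    and y: "y u = 0" "\<And>x. x \<in> {0..u} \<Longrightarrow> 0 \<le> y x \<and> y x \<le> Y \<and> (y has_real_derivative fS z x (y x)) (at x within {0..u})"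
    and Y: "0 \<le> Y" "Y \<le> 5/2"
    and m: "Pl = 1 - p0 * ub - 2/100 * Y - 4/100 * ub^2 - 2/1000 * (ub * Y) - 1/1000 * Y^2"
      "2 + p5 * ub + 4/100 * Y \<le> m * Pl" "2/1000 * Y^2 \<le> e * Pl" "0 \<le> m" "0 \<le> e" "0 \<le> Pl"
    and x: "x \<in> {0..u}"
  shows "y x \<le> m/2 * ub^2 + e * ub"
proof -
  have slope: "- fS z t (y t) \<le> m * t + e" if t: "t \<in> {0..u}" for t
  proof -
    have t': "0 \<le> t" "t \<le> ub" "t \<le> 9/10" using t u by auto
    have yt: "0 \<le> y t" "y t \<le> Y" using y(2)[OF t] by auto
    have b: "c * h \<le> C * H" if "c \<le> C" "0 \<le> C" "0 \<le> h" "h \<le> H" for c h C H :: real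
      using mult_right_mono[OF that(1,3)] mult_left_mono[OF that(4,2)] by linarith
    have zb: "z 1 \<le> 2/100" "z 2 \<le> 4/100" "z 3 \<le> 2/1000" "z 4 \<le> 1/1000" "z 6 \<le> 4/100" "z 7 \<le> 2/1000"
      using z unfolding small_coeffs_def by linarith+
    have tt: "t * t \<le> ub * t" "t * t \<le> ub * ub" "t * y t \<le> ub * Y" "y t * y t \<le> Y * Y" "t * y t \<le> Y * t"
    proof -
      show "t * t \<le> ub * t" using t' by (intro mult_right_mono)
      show "t * t \<le> ub * ub" "t * y t \<le> ub * Y" "y t * y t \<le> Y * Y" using t' yt Y by (auto intro!: mult_mono)
      show "t * y t \<le> Y * t" using mult_right_mono[OF yt(2) t'(1)] by (simp add: mult.commute)
    qed
    have Q: "fQ z t (y t) \<le> t * (2 + p5 * ub + 4/100 * Y) + 2/1000 * Y^2"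
    proof -
      have "z 5 * t^2 \<le> p5 * (ub * t)" unfolding power2_eq_square by (intro b p tt) (use t' in auto)
      moreover have "z 6 * (t * y t) \<le> 4/100 * (Y * t)" by (intro b tt zb) (use t' yt in auto)
      moreover have "z 7 * (y t)^2 \<le> 2/1000 * Y^2" unfolding power2_eq_square by (intro b tt zb) (use t' yt in auto)
      ultimately show ?thesis unfolding fQ_def by (simp add: algebra_simps)
    qed
    have P: "Pl \<le> - fP z t (y t)"
    proof -
      have "z 0 * t \<le> p0 * ub" by (intro b p t')
      moreover have "z 1 * y t \<le> 2/100 * Y" by (intro b yt zb) auto
      moreover have "z 2 * t^2 \<le> 4/100 * ub^2" unfolding power2_eq_square by (intro b tt zb) (use t' in auto)
      moreover have "z 3 * (t * y t) \<le> 2/1000 * (ub * Y)" by (intro b tt zb) (use t' yt in auto)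
      moreover have "z 4 * (y t)^2 \<le> 1/1000 * Y^2" unfolding power2_eq_square by (intro b tt zb) (use t' yt in auto)
      ultimately show ?thesis unfolding fP_def m(1) by simp
    qed
    have neg: "fP z t (y t) \<le> -3/4" by (rule fP_neg[OF z]) (use t' yt Y in auto)
    have "fQ z t (y t) \<le> t * (m * Pl) + e * Pl"
      using Q m(3) mult_left_mono[OF m(2) t'(1)] by linarith
    also have "\<dots> = (m * t + e) * Pl" by (simp add: algebra_simps)
    also have "\<dots> \<le> (m * t + e) * (- fP z t (y t))" by (intro mult_left_mono P) (use m t' in auto)
    finally have "fQ z t (y t) / (- fP z t (y t)) \<le> m * t + e" using neg by (subst pos_divide_le_eq) auto
    then show ?thesis by (simp add: fS_def)
  qed
  define k where "k t = y t + m/2 * t^2 + e * t" for t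
  have dk: "(k has_real_derivative fS z t (y t) + m * t + e) (at t within {0..u})" if "t \<in> {0..u}" for t
    unfolding k_def using y(2)[OF that] by (auto intro!: derivative_eq_intros)
  have "k x \<le> k u"
  proof (rule DERIV_nonneg_imp_increasing_open[of x u k])
    show "x \<le> u" using x by simp
    show "\<exists>l. (k has_real_derivative l) (at t) \<and> 0 \<le> l" if "x < t" "t < u" for t
    proof -
      have "at t within {0..u} = at t" using that x by (intro at_within_interior) (simp add: interior_atLeastAtMost_real)
      then show ?thesis using dk[of t] slope[of t] that x by (intro exI[of _ "fS z t (y t) + m * t + e"]) auto
    qed
    show "continuous_on {x..u} k" by (rule continuous_on_subset[OF DERIV_continuous_on[OF dk]]) (use x in auto)
  qed
  moreover have "m/2 * u^2 + e * u \<le> m/2 * ub^2 + e * ub" by (intro add_mono mult_left_mono power_mono) (use u m in auto)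
  moreover have "0 \<le> m/2 * x^2 + e * x" using x m by auto
  ultimately show ?thesis using y(1) by (simp add: k_def)
qed

lemma low_arcI:
  assumes z: "small_coeffs z" and u: "0 < u" "u \<le> ub"
    and c: "(z 0 \<le> 1/10 \<and> ub = 765/1000) \<or> (z 5 \<le> 6/100 \<and> ub = 765/1000) \<or> (z 0 \<le> 0 \<and> z 5 \<le> 0 \<and> ub = 845/1000)"
  shows "low_arc z u"
proof -
  have u': "u < 9/10" using u c by auto
  obtain y where y: "y u = 0" "y 0 = hit z u"
    "\<And>x. x \<in> {0..u} \<Longrightarrow> \<bar>y x\<bar> \<le> 249/100"
    "\<And>x. x \<in> {0..u} \<Longrightarrow> (y has_real_derivative fS z x (y x)) (at x within {0..u})"
    "\<And>x. x \<in> {0..<u} \<Longrightarrow> 0 < y x"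
    using backward_solution_pos[OF z u(1) u'] by metis
  have nn: "0 \<le> y x" if "x \<in> {0..u}" for x using y(1) y(5)[of x] that by (cases "x = u") auto
  note zz = z[unfolded small_coeffs_def]
  have "y x \<le> 4/5" if x: "x \<in> {0..u}" for x
  proof -
    have 1: "y x \<le> 249/100" if "x \<in> {0..u}" for x using y(3)[OF that] by simp
    have 2: "y x \<le> 84/100" if x: "x \<in> {0..u}" for x
      using c
    proof (elim disjE)
      assume c: "z 0 \<le> 1/10 \<and> ub = 765/1000"
      have "y x \<le> (2256/(1000*(839/1000)))/2 * (765/1000)^2 + (125/10000)/(839/1000) * (765/1000)"
        by (rule height_le[OF z, of "1/10" "2/10" u "765/1000" y "249/100" "1 - 1/10*(765/1000) - 2/100 * (249/100) - 4/100 * (765/1000)^2 - 2/1000 * ((765/1000) * (249/100)) - 1/1000 * (249/100)^2"])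
          (use c u y nn 1 x zz in \<open>auto simp: power2_eq_square\<close>)
      then show ?thesis by (simp add: power2_eq_square)
    next
      assume c: "z 5 \<le> 6/100 \<and> ub = 765/1000"
      have "y x \<le> (2147/(1000*(794/1000)))/2 * (765/1000)^2 + (125/10000)/(794/1000) * (765/1000)"
        by (rule height_le[OF z, of "16/100" "6/100" u "765/1000" y "249/100" "1 - 16/100*(765/1000) - 2/100 * (249/100) - 4/100 * (765/1000)^2 - 2/1000 * ((765/1000) * (249/100)) - 1/1000 * (249/100)^2"])
          (use c u y nn 1 x zz in \<open>auto simp: power2_eq_square\<close>)
      then show ?thesis by (simp add: power2_eq_square)
    next
      assume c: "z 0 \<le> 0 \<and> z 5 \<le> 0 \<and> ub = 845/1000"
      have "y x \<le> (2100/(1000*(911/1000)))/2 * (845/1000)^2 + (125/10000)/(911/1000) * (845/1000)"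
        by (rule height_le[OF z, of 0 0 u "845/1000" y "249/100" "1 - 0*(845/1000) - 2/100 * (249/100) - 4/100 * (845/1000)^2 - 2/1000 * ((845/1000) * (249/100)) - 1/1000 * (249/100)^2"])
          (use c u y nn 1 x zz in \<open>auto simp: power2_eq_square\<close>)
      then show ?thesis by (simp add: power2_eq_square)
    qed
    show ?thesis
      using c
    proof (elim disjE)
      assume c: "z 0 \<le> 1/10 \<and> ub = 765/1000"
      have "y x \<le> (219/(100*(87/100)))/2 * (765/1000)^2 + (15/10000)/(87/100) * (765/1000)"
        by (rule height_le[OF z, of "1/10" "2/10" u "765/1000" y "84/100" "1 - 1/10*(765/1000) - 2/100 * (84/100) - 4/100 * (765/1000)^2 - 2/1000 * ((765/1000) * (84/100)) - 1/1000 * (84/100)^2"])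
          (use c u y nn 2 x zz in \<open>auto simp: power2_eq_square\<close>)
      then show ?thesis by (simp add: power2_eq_square)
    next
      assume c: "z 5 \<le> 6/100 \<and> ub = 765/1000"
      have "y x \<le> (209/(100*(83/100)))/2 * (765/1000)^2 + (15/10000)/(83/100) * (765/1000)"
        by (rule height_le[OF z, of "16/100" "6/100" u "765/1000" y "84/100" "1 - 16/100*(765/1000) - 2/100 * (84/100) - 4/100 * (765/1000)^2 - 2/1000 * ((765/1000) * (84/100)) - 1/1000 * (84/100)^2"])
          (use c u y nn 2 x zz in \<open>auto simp: power2_eq_square\<close>)
      then show ?thesis by (simp add: power2_eq_square)
    next
      assume c: "z 0 \<le> 0 \<and> z 5 \<le> 0 \<and> ub = 845/1000"
      have "y x \<le> (204/(100*(95/100)))/2 * (845/1000)^2 + (15/10000)/(95/100) * (845/1000)"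
        by (rule height_le[OF z, of 0 0 u "845/1000" y "84/100" "1 - 0*(845/1000) - 2/100 * (84/100) - 4/100 * (845/1000)^2 - 2/1000 * ((845/1000) * (84/100)) - 1/1000 * (84/100)^2"])
          (use c u y nn 2 x zz in \<open>auto simp: power2_eq_square\<close>)
      then show ?thesis by (simp add: power2_eq_square)
    qed
  qed
  then show ?thesis unfolding low_arc_def using y nn by blast
qed

locale near_integral =
  fixes z :: "nat \<Rightarrow> real" and N K :: nat and g :: coeffs and B :: real
  assumes z: "small_coeffs z" and N: "2 \<le> N" and weight: "weight_le N g"
    and unit: "\<And>b. g 0 b = (if b = 1 then 2 ^ K else 0)"
    and top: "\<And>i j. N \<le> i + 2 * j + 3 \<Longrightarrow> \<bar>g i j\<bar> \<le> B"
    and low: "\<And>a b. a + 2 * b < N \<Longrightarrow> \<bar>residual z g a b\<bar> \<le> real a + 2"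
begin

definition err :: real where "err = (256 + 1458 * shell N B) / (3/4)"

lemma estimate:
  assumes s: "s = 1 \<or> s = (-1::real)" and u: "0 < u" "u \<le> 17/20"
    and orbit_arc: "low_arc (if s = 1 then z else refl_coeffs z) u"
  shows "\<bar>2 ^ K * hit z (s * u) - (\<Sum>a<N+4. g a 0 * (s * u) ^ a)\<bar> \<le> u * err"
proof -
  let ?z = "if s = 1 then z else refl_coeffs z"
  obtain y where y: "y u = 0" "y 0 = hit ?z u" and yy: "\<And>x. x \<in> {0..u} \<Longrightarrow> 0 \<le> y x \<and> y x \<le> 4/5 \<and>
     (y has_real_derivative fS ?z x (y x)) (at x within {0..u})" using orbit_arc unfolding low_arc_def by blast
  have h: "hit ?z u = hit z (s * u)" using s by (auto simp: hit_refl)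
  have S: "fS ?z x v = s * fS z (s * x) v" for x v using s by (auto simp: fS_refl)
  define k where "k t = ev (N+4) g (s * t) (y t)" for t
  define dk where "dk t = s * ev (N+4) (DX g) (s * t) (y t) + ev (N+4) (DY g) (s * t) (y t) * (s * fS z (s * t) (y t))" for t
  have k: "(k has_real_derivative dk t) (at t)" if t: "0 < t" "t < u" for t
  proof -
    have "at t within {0..u} = at t" using t by (intro at_within_interior) (simp add: interior_atLeastAtMost_real)
    then have "(y has_real_derivative s * fS z (s * t) (y t)) (at t)" using yy[of t] t by (simp add: S)
    from ev_deriv[OF weight _ this s, of "N+4"] show ?thesis unfolding k_def[abs_def] dk_def by simp
  qed
  have dkb: "\<bar>dk t\<bar> \<le> err" if t: "0 < t" "t < u" for t
  proof -
    have yt: "0 \<le> y t" "y t \<le> 4/5" using yy[of t] t by auto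
    have x: "\<bar>s * t\<bar> \<le> 17/20" using s t u by auto
    have P: "fP z (s * t) (y t) \<le> -3/4" by (rule fP_neg[OF z]) (use x yt in auto)
    have "dk t * fP z (s * t) (y t) = s * ev (N+4) (residual z g) (s * t) (y t)"
      unfolding ev_residual[OF weight N] dk_def fS_def using P by (simp add: field_simps)
    then have "\<bar>dk t\<bar> * \<bar>fP z (s * t) (y t)\<bar> = \<bar>ev (N+4) (residual z g) (s * t) (y t)\<bar>"
      using s by (metis abs_mult abs_minus_cancel abs_one mult_1)
    also have "\<dots> \<le> 256 + 1458 * shell N B"
      by (rule residual_bound[OF z weight top low x]) (use yt in auto)
    finally have *: "\<bar>dk t\<bar> * \<bar>fP z (s * t) (y t)\<bar> \<le> 256 + 1458 * shell N B" .
    have "\<bar>dk t\<bar> * (3/4) \<le> \<bar>dk t\<bar> * \<bar>fP z (s * t) (y t)\<bar>" by (intro mult_left_mono) (use P in auto)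
    then show ?thesis unfolding err_def using * by simp
  qed
  have c: "continuous_on {0..u} k"
  proof -
    have cy: "continuous_on {0..u} y" by (rule DERIV_continuous_on) (use yy in blast)
    show ?thesis unfolding k_def ev_def by (intro continuous_intros cy)
  qed
  obtain l t where t: "0 < t" "t < u" "(k has_real_derivative l) (at t)" "k u - k 0 = (u - 0) * l"
    using MVT[OF u(1) c] k by (metis real_differentiable_def)
  have l: "l = dk t" using DERIV_unique[OF t(3) k[OF t(1,2)]] .
  have "\<bar>k u - k 0\<bar> \<le> u * err"
    unfolding t(4) l abs_mult using dkb[OF t(1,2)] u by (intro mult_mono) auto
  moreover have "k u = (\<Sum>a<N+4. g a 0 * (s * u) ^ a)" unfolding k_def y(1) by (rule ev_y0) simp
  moreover have "k 0 = 2 ^ K * hit z (s * u)"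
  proof -
    have "k 0 = (\<Sum>b<N+4. g 0 b * y 0 ^ b)" unfolding k_def by (simp add: ev_at_0)
    also have "\<dots> = 2 ^ K * y 0" unfolding unit by (subst sum.remove[of _ 1]) auto
    finally show ?thesis using y(2) h by simp
  qed
  ultimately show ?thesis by simp
qed

end

section \<open>Tables as approximate first integrals\<close>

lemma negligible_nth: "negligible t l \<Longrightarrow> j < length l \<Longrightarrow> length l \<le> j + 2 \<Longrightarrow> shr t (l ! j) = Ze"
proof (induction t l arbitrary: j rule: negligible.induct)
  case (3 t a b) then show ?case by (cases j) auto
next
  case (4 t a b c as) then show ?case by (cases j) auto
qed auto

lemma heads_map: "heads rs = map hd rs" by (induction rs) auto

lemma horner_approx:
  assumes u: "u = real_of_int (iv U) / 2 ^ K"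
  shows "\<bar>real_of_int (iv (horner (tmpl K) U as)) - (\<Sum>i<length as. real_of_int (iv (as ! i)) * u ^ i)\<bar> \<le> (\<Sum>i<length as. \<bar>u\<bar> ^ i)"
proof (induction as)
  case (Cons a as)
  let ?h = "real_of_int (iv (horner (tmpl K) U as))" and ?s = "\<Sum>i<length as. real_of_int (iv (as ! i)) * u ^ i"
  have 1: "\<bar>real_of_int (iv (shr (tmpl K) (smul U (horner (tmpl K) U as)))) - u * ?h\<bar> < 1"
    using shr_approx[of K "smul U (horner (tmpl K) U as)"] by (simp add: u)
  have "\<bar>u * ?h - u * ?s\<bar> \<le> \<bar>u\<bar> * (\<Sum>i<length as. \<bar>u\<bar> ^ i)"
    using mult_left_mono[OF Cons.IH, of "\<bar>u\<bar>"] by (simp add: abs_mult[symmetric] right_diff_distrib)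
  moreover have "(\<Sum>i<length (a # as). real_of_int (iv ((a # as) ! i)) * u ^ i) = real_of_int (iv a) + u * ?s"
    by (simp add: sum.lessThan_Suc_shift sum_distrib_left mult_ac del: sum.lessThan_Suc)
  moreover have "(\<Sum>i<length (a # as). \<bar>u\<bar> ^ i) = 1 + \<bar>u\<bar> * (\<Sum>i<length as. \<bar>u\<bar> ^ i)"
    by (simp add: sum.lessThan_Suc_shift sum_distrib_left del: sum.lessThan_Suc)
  ultimately show ?case using 1 by (simp only: horner.simps sadd_val of_int_add) linarith
qed simp

definition start :: "nat \<Rightarrow> nat \<Rightarrow> sg list list" where
  "start K N = [replicate ((N+2) div 2 + 1) Ze, replicate ((N+1) div 2 + 1) Ze, Ze # Po (tmpl K) # replicate (N div 2 - 1) Ze]"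

definition table :: "nat \<Rightarrow> nat \<Rightarrow> prm \<Rightarrow> sg list list" where
  "table K N p = rows (tmpl K) p (replicate N ()) num.One Ze (q1 p) (sneg (q2 p)) (sneg (q7 p)) (q4 p)
     (start K N ! 2) (start K N ! 1) (start K N ! 0)"

definition field_coeffs :: "nat \<Rightarrow> prm \<Rightarrow> nat \<Rightarrow> real" where
  "field_coeffs K p k = real_of_int (iv ([q0 p, q1 p, q2 p, q3 p, q4 p, q5 p, q6 p, q7 p] ! k)) / 2 ^ K"

text \<open>
  The three starting rows have indices \<open>-2\<close>, \<open>-1\<close> and \<open>0\<close>, so row \<open>i\<close> is found at position \<open>i + 2\<close>.
\<close>
definition tab :: "nat \<Rightarrow> nat \<Rightarrow> prm \<Rightarrow> coeffs" where
  "tab K N p i j = (if i + 2 * j \<le> N then real_of_int (iv ((start K N @ table K N p) ! (i + 2) ! j)) else 0)"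

lemma table_row:
  assumes N: "2 \<le> N" and i: "i < N" and R: "R = start K N @ table K N p"
  shows "\<exists>i' b0 b1 b2 b3 b4. nv i' = 1 + int i \<and> iv b0 = int i * iv (q0 p) \<and> iv b1 = (int i + 1) * iv (q1 p)
    \<and> iv b2 = (int i - 1) * iv (q2 p) \<and> iv b3 = int i * iv (q3 p) - iv (q7 p) \<and> iv b4 = (int i + 1) * iv (q4 p)
    \<and> R ! (i + 3) = next_row (tmpl K) i' (q5 p) (q6 p) (q7 p) b0 b1 b2 b3 b4 (q5 p) (Po (num.Bit0 num.One)) Ze Ze Ze
        (R ! (i + 2)) (R ! (i + 1)) (tl (R ! (i + 1))) (tl (R ! i))"
proof -
  have R': "R = start K N ! 0 # start K N ! 1 # start K N ! 2 # table K N p" unfolding R start_def by simp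
  have "i < length (replicate N ())" using i by simp
  from rows_nth[OF this table_def[of K N p], folded R'] obtain i' b0 b1 b2 b3 b4 where
    "nv i' = nv num.One + int i" "iv b0 = iv Ze + int i * iv (q0 p)" "iv b1 = iv (q1 p) + int i * iv (q1 p)"
    "iv b2 = iv (sneg (q2 p)) + int i * iv (q2 p)" "iv b3 = iv (sneg (q7 p)) + int i * iv (q3 p)" "iv b4 = iv (q4 p) + int i * iv (q4 p)"
    "table K N p ! i = next_row (tmpl K) i' (q5 p) (q6 p) (q7 p) b0 b1 b2 b3 b4 (q5 p) (Po (num.Bit0 num.One)) Ze Ze Ze
        (R ! (i + 2)) (R ! (i + 1)) (tl (R ! (i + 1))) (tl (R ! i))" by blast
  moreover have "R ! (i + 3) = table K N p ! i" unfolding R' by (simp add: numeral_3_eq_3)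
  ultimately show ?thesis
    by (intro exI[of _ i'] exI[of _ b0] exI[of _ b1] exI[of _ b2] exI[of _ b3] exI[of _ b4]) (simp add: algebra_simps)
qed

lemma table_length:
  assumes N: "2 \<le> N" and R: "R = start K N @ table K N p"
  shows "k \<le> N + 2 \<Longrightarrow> length (R ! k) = (N + 2 - k) div 2 + 1"
proof (induction k rule: less_induct)
  case (less k)
  consider "k = 0" | "k = 1" | "k = 2" | i where "k = i + 3" "i < N"
  proof -
    assume h: "k = 0 \<Longrightarrow> thesis" "k = 1 \<Longrightarrow> thesis" "k = 2 \<Longrightarrow> thesis" "\<And>i. k = i + 3 \<Longrightarrow> i < N \<Longrightarrow> thesis"
    show thesis
    proof (cases "k < 3")
      case True
      then have "k = 0 \<or> k = 1 \<or> k = 2" by linarith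
      then show thesis using h by blast
    next
      case False
      then show thesis using less.prems h(4)[of "k - 3"] by simp
    qed
  qed
  then show ?case
  proof cases
    case (4 i)
    obtain i' b0 b1 b2 b3 b4 where "R ! (i + 3) = next_row (tmpl K) i' (q5 p) (q6 p) (q7 p) b0 b1 b2 b3 b4 (q5 p) (Po (num.Bit0 num.One)) Ze Ze Ze
        (R ! (i + 2)) (R ! (i + 1)) (tl (R ! (i + 1))) (tl (R ! i))" using table_row[OF N 4(2) R] by blast
    then have l: "length (R ! k) = min (length (R ! (i + 2))) (min (length (R ! (i + 1))) (min (length (R ! (i + 1)) - 1) (length (R ! i) - 1)))"
      by (simp only: 4(1) next_row_length length_tl)
    have L: "length (R ! (i + 2)) = (N - i) div 2 + 1" "length (R ! (i + 1)) = (N + 1 - i) div 2 + 1" "length (R ! i) = (N + 2 - i) div 2 + 1"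
      using less.IH[of "i+2"] less.IH[of "i+1"] less.IH[of i] 4 by simp_all
    obtain n where n: "N = Suc (i + n)" using less_imp_Suc_add[OF 4(2)] by blast
    have d: "(N - i) div 2 = Suc n div 2" "(N + 1 - i) div 2 = Suc (n div 2)" "(N + 2 - i) div 2 = Suc (Suc n div 2)" "(N + 2 - k) div 2 = n div 2"
      using n 4(1) by simp_all
    have "n div 2 \<le> Suc n div 2" by (rule div_le_mono) simp
    then show ?thesis unfolding l L d by simp
  qed (use N in \<open>auto simp: R start_def\<close>)
qed

lemma table_residual:
  assumes N: "2 \<le> N" and ij: "i + 2 * j < N"
  shows "\<bar>residual (field_coeffs K p) (tab K N p) i j\<bar> \<le> real i + 2"
proof -
  define R where "R = start K N @ table K N p"
  note len = table_length[OF N R_def]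
  define g where "g = tab K N p"
  have G: "real_of_int (iv (R ! (i' + 2) ! j')) = g i' j'" if "i' + 2 * j' \<le> N" for i' j'
    using that by (simp add: g_def tab_def R_def)
  have i: "i < N" using ij by simp
  obtain i' b0 b1 b2 b3 b4 where b: "nv i' = 1 + int i" "iv b0 = int i * iv (q0 p)" "iv b1 = (int i + 1) * iv (q1 p)"
    "iv b2 = (int i - 1) * iv (q2 p)" "iv b3 = int i * iv (q3 p) - iv (q7 p)" "iv b4 = (int i + 1) * iv (q4 p)"
    and next_row: "R ! (i + 3) = next_row (tmpl K) i' (q5 p) (q6 p) (q7 p) b0 b1 b2 b3 b4 (q5 p) (Po (num.Bit0 num.One)) Ze Ze Ze
        (R ! (i + 2)) (R ! (i + 1)) (tl (R ! (i + 1))) (tl (R ! i))" using table_row[OF N i R_def] by blast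
  have R1: "R ! 1 = replicate ((N+1) div 2 + 1) Ze" "R ! 0 = replicate ((N+2) div 2 + 1) Ze" by (simp_all add: R_def start_def)
  have lo: "length (R ! (i + 3)) = (N - (i + 1)) div 2 + 1" using len[of "i+3"] i by simp
  have j: "j < length (R ! (i + 3))" unfolding lo using ij by linarith
  let ?C = "Ze # Ze # R ! (i + 3)"
  have e: "real_of_int (iv (R ! (i + 3) ! j)) = g (i + 1) j" using G[of "i+1" j] ij by (simp add: numeral_3_eq_3)
  have h0: "real_of_int (iv (R ! (i + 2) ! j)) = g i j" using G[of i j] ij by simp
  have hp: "real_of_int (iv ((Ze # R ! (i + 2)) ! j)) = (if j = 0 then 0 else g i (j - 1))"
    using G[of i "j-1"] ij by (cases j) auto
  have c1: "real_of_int (iv (?C ! (j + 1))) = (if j = 0 then 0 else g (i + 1) (j - 1))"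
    using G[of "i+1" "j-1"] ij by (cases j) (auto simp: numeral_3_eq_3)
  have c2: "real_of_int (iv (?C ! j)) = (if j = 0 then 0 else if j = 1 then 0 else g (i + 1) (j - 1 - 1))"
  proof -
    consider "j = 0" | "j = 1" | l where "j = Suc (Suc l)" by (metis One_nat_def not0_implies_Suc)
    then show ?thesis using G[of "i+1" "j-2"] ij by cases (auto simp: numeral_3_eq_3)
  qed
  have Z1: "iv (R ! 1 ! j') = 0" if "j' < (N+1) div 2 + 1" for j' using that by (simp only: R1 nth_replicate iv.simps)
  have Z0: "iv (R ! 0 ! j') = 0" if "j' < (N+2) div 2 + 1" for j' using that by (simp only: R1 nth_replicate iv.simps)
  have h1: "real_of_int (iv (R ! (i + 1) ! j)) = (if i = 0 then 0 else g (i - 1) j)"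
    using G[of "i-1" j] Z1[of j] ij by (cases i) auto
  have ht: "real_of_int (iv (tl (R ! (i + 1)) ! j)) = (if i = 0 then 0 else g (i - 1) (j + 1))"
  proof -
    have "length (R ! (i+1)) = (N + 1 - i) div 2 + 1" using len[of "i+1"] i by simp
    then have "j < length (tl (R ! (i+1)))" using ij by simp
    then have "tl (R ! (i + 1)) ! j = R ! (i + 1) ! (j + 1)" by (simp add: nth_tl)
    then show ?thesis using G[of "i-1" "j+1"] Z1[of "j+1"] ij by (cases i) auto
  qed
  have h2: "real_of_int (iv (tl (R ! i) ! j)) = (if i = 0 then 0 else if i = 1 then 0 else g (i - 1 - 1) (j + 1))"
  proof -
    have "length (R ! i) = (N + 2 - i) div 2 + 1" using len[of i] i by simp
    then have "j < length (tl (R ! i))" using ij by simp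
    then have t: "tl (R ! i) ! j = R ! i ! (j + 1)" by (simp add: nth_tl)
    consider "i = 0" | "i = 1" | l where "i = Suc (Suc l)" by (metis One_nat_def not0_implies_Suc)
    then show ?thesis unfolding t using G[of "i-2" "j+1"] Z1[of "j+1"] Z0[of "j+1"] ij by cases auto
  qed
  have S: "SX (DX g) i j = real i * g i j" "SX (DY g) i j = (real j + 1) * (if i = 0 then 0 else g (i - 1) (j + 1))"
    "SY (DX g) i j = (real i + 1) * (if j = 0 then 0 else g (i + 1) (j - 1))"
    "SX (SX (DX g)) i j = (real i - 1) * (if i = 0 then 0 else g (i - 1) j)"
    "SX (SY (DX g)) i j = real i * (if j = 0 then 0 else g i (j - 1))"
    "SY (SY (DX g)) i j = (real i + 1) * (if j = 0 then 0 else if j = 1 then 0 else g (i + 1) (j - 1 - 1))"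
    "SX (SX (DY g)) i j = (real j + 1) * (if i = 0 then 0 else if i = 1 then 0 else g (i - 1 - 1) (j + 1))"
    "SX (SY (DY g)) i j = real j * (if i = 0 then 0 else g (i - 1) j)"
    "SY (SY (DY g)) i j = (real j - 1) * (if j = 0 then 0 else g i (j - 1))"
    "DX g i j = (real i + 1) * g (i + 1) j"
    by (auto simp: SX_def SY_def DX_def DY_def of_nat_diff Suc_diff_Suc)
  have "step_ok K (nv i') (iv (R ! (i + 3) ! j))
    (iv b0 * iv (R ! (i + 2) ! j) + iv b1 * iv (?C ! (j + 1)) + (iv b2 + int j * iv (q6 p)) * iv (R ! (i + 1) ! j)
     + (iv b3 + int j * iv (q7 p)) * iv ((Ze # R ! (i + 2)) ! j) + iv b4 * iv (?C ! j) + (iv (q5 p) + int j * iv (q5 p)) * iv (tl (R ! i) ! j))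
    (iv (tl (R ! (i + 1)) ! j) * (iv (Po (num.Bit0 num.One)) + 2 * int j))"
    by (rule next_row_ok[OF next_row j])
  then have st: "\<bar>(real i + 1) * g (i + 1) j - (if i = 0 then 0 else g (i - 1) (j + 1)) * (2 + 2 * real j)
     - (real i * real_of_int (iv (q0 p)) * g i j + (real i + 1) * real_of_int (iv (q1 p)) * (if j = 0 then 0 else g (i + 1) (j - 1))
      + ((real i - 1) * real_of_int (iv (q2 p)) + real j * real_of_int (iv (q6 p))) * (if i = 0 then 0 else g (i - 1) j)
      + (real i * real_of_int (iv (q3 p)) - real_of_int (iv (q7 p)) + real j * real_of_int (iv (q7 p))) * (if j = 0 then 0 else g i (j - 1))
      + (real i + 1) * real_of_int (iv (q4 p)) * (if j = 0 then 0 else if j = 1 then 0 else g (i + 1) (j - 1 - 1))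
      + (real_of_int (iv (q5 p)) + real j * real_of_int (iv (q5 p))) * (if i = 0 then 0 else if i = 1 then 0 else g (i - 1 - 1) (j + 1))) / 2 ^ K\<bar>
     \<le> real i + 2"
    unfolding step_ok_def by (simp only: of_int_diff of_int_mult of_int_add of_int_of_nat_eq e h0 hp c1 c2 h1 ht h2 b of_int_1 of_int_numeral iv.simps nv.simps mult_1_right mult_1 mult_2) (simp add: algebra_simps)
  have f: "field_coeffs K p 0 = real_of_int (iv (q0 p)) / 2 ^ K" "field_coeffs K p 1 = real_of_int (iv (q1 p)) / 2 ^ K"
    "field_coeffs K p 2 = real_of_int (iv (q2 p)) / 2 ^ K" "field_coeffs K p 3 = real_of_int (iv (q3 p)) / 2 ^ K"
    "field_coeffs K p 4 = real_of_int (iv (q4 p)) / 2 ^ K" "field_coeffs K p 5 = real_of_int (iv (q5 p)) / 2 ^ K"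
    "field_coeffs K p 6 = real_of_int (iv (q6 p)) / 2 ^ K" "field_coeffs K p 7 = real_of_int (iv (q7 p)) / 2 ^ K"
    by (simp_all add: field_coeffs_def numeral_eq_Suc)
  have alg: "- ((I + 1) * e) + q0 / k * (I * A) + q1 / k * ((I + 1) * B) + q2 / k * ((I - 1) * C) + q3 / k * (I * D) + q4 / k * ((I + 1) * E)
      + 2 * ((J + 1) * F) + q5 / k * ((J + 1) * H) + q6 / k * (J * C) + q7 / k * ((J - 1) * D)
    = - ((I + 1) * e - F * (2 + 2 * J) - (I * q0 * A + (I + 1) * q1 * B + ((I - 1) * q2 + J * q6) * C + (I * q3 - q7 + J * q7) * D
      + (I + 1) * q4 * E + (q5 + J * q5) * H) / k)" if "k \<noteq> 0" for I J e A B C D E F H k q0 q1 q2 q3 q4 q5 q6 q7 :: real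
    using that by (simp add: field_simps)
  show ?thesis unfolding g_def[symmetric]
  proof (rule order_trans[OF eq_refl st])
    show "\<bar>residual (field_coeffs K p) g i j\<bar> = \<bar>(real i + 1) * g (i + 1) j - (if i = 0 then 0 else g (i - 1) (j + 1)) * (2 + 2 * real j)
     - (real i * real_of_int (iv (q0 p)) * g i j + (real i + 1) * real_of_int (iv (q1 p)) * (if j = 0 then 0 else g (i + 1) (j - 1))
      + ((real i - 1) * real_of_int (iv (q2 p)) + real j * real_of_int (iv (q6 p))) * (if i = 0 then 0 else g (i - 1) j)
      + (real i * real_of_int (iv (q3 p)) - real_of_int (iv (q7 p)) + real j * real_of_int (iv (q7 p))) * (if j = 0 then 0 else g i (j - 1))
      + (real i + 1) * real_of_int (iv (q4 p)) * (if j = 0 then 0 else if j = 1 then 0 else g (i + 1) (j - 1 - 1))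
      + (real_of_int (iv (q5 p)) + real j * real_of_int (iv (q5 p))) * (if i = 0 then 0 else if i = 1 then 0 else g (i - 1 - 1) (j + 1))) / 2 ^ K\<bar>"
      (is "_ = \<bar>?r\<bar>")
    proof -
      have "residual (field_coeffs K p) g i j = - ?r"
        unfolding residual_def S f by (rule alg) simp
      then show ?thesis by (simp only: abs_minus_cancel)
    qed
  qed
qed

lemma table_near_integral:
  assumes z: "small_coeffs (field_coeffs K p)" and N: "6 \<le> N" and d: "list_all (negligible (tmpl k)) (table K N p)"
  shows "near_integral (field_coeffs K p) N K (tab K N p) (2 ^ k)"
proof
  have N2: "2 \<le> N" using N by simp
  have r0: "(start K N @ table K N p) ! 2 = Ze # Po (tmpl K) # replicate (N div 2 - 1) Ze" by (simp add: start_def)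
  have t: "nv (tmpl K) = 2 ^ K" unfolding tmpl_def by (induction K) auto
  show unit: "tab K N p 0 b = (if b = 1 then 2 ^ K else 0)" for b
  proof -
    consider "b = 0" | "b = 1" | l where "b = Suc (Suc l)" by (metis One_nat_def not0_implies_Suc)
    then show ?thesis
    proof cases
      case 3
      show ?thesis
      proof (cases "2 * b \<le> N")
        case True
        then have "l < N div 2 - 1" using 3 by linarith
        then have "(start K N @ table K N p) ! 2 ! b = Ze" unfolding r0 3 by simp
        then have "tab K N p 0 b = 0" by (simp only: tab_def add_0 iv.simps of_int_0 if_cancel)
        then show ?thesis using 3 by simp
      qed (use 3 in \<open>simp add: tab_def\<close>)
    qed (use N r0 in \<open>auto simp: tab_def start_def t\<close>)
  qed
  show "weight_le N (tab K N p)" by (auto simp: weight_le_def tab_def)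
  show "\<bar>tab K N p i j\<bar> \<le> 2 ^ k" if ij: "N \<le> i + 2 * j + 3" for i j
  proof (cases "i = 0 \<or> N < i + 2 * j")
    case True
    then show ?thesis
    proof
      assume "i = 0" then show ?thesis using ij N by (simp add: unit)
    qed (simp add: tab_def)
  next
    case False
    then obtain l where l: "i = Suc l" by (cases i) auto
    let ?R = "start K N @ table K N p"
    have len: "length (?R ! (i + 2)) = (N - i) div 2 + 1" using table_length[OF N2 refl, of "i+2"] False by simp
    have m: "?R ! (i + 2) = table K N p ! l" by (simp add: l start_def)
    have "length (table K N p) = N"
      using rows_nth[of 0 "replicate N ()", OF _ table_def[of K N p]] N by simp
    then have "negligible (tmpl k) (?R ! (i + 2))" unfolding m using d False l by (simp add: list_all_length)
    then have "shr (tmpl k) (?R ! (i + 2) ! j) = Ze" by (rule negligible_nth) (use len False ij in linarith)+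
    then have "\<bar>iv (?R ! (i + 2) ! j)\<bar> \<le> 2 ^ k" by (rule shr_Ze)
    then have "real_of_int \<bar>iv (?R ! (i + 2) ! j)\<bar> \<le> real_of_int (2 ^ k)" by (simp only: of_int_le_iff)
    then show ?thesis by (simp add: tab_def)
  qed
qed (use assms table_residual in auto)

text \<open>
  Along an orbit the derivative of \<open>F\<close> is the residual divided by \<open>P\<close>, and \<open>F(0, y) = 2 ^ K y\<close>. So \<open>F(s u, 0)\<close>
  is \<open>2 ^ K\<close> times the height up to \<open>u\<close> times the largest residual. The number 7 bounds the rounding of the Horner
  scheme: \<open>0.845 / 0.155 < 6\<close>, and one unit for the last multiplication.
\<close>
theorem certified_hit:
  assumes z: "small_coeffs (field_coeffs K p)" and N: "6 \<le> N" and d: "digest (tmpl k) (table K N p) = (hs, True)"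
    and s: "s = 1 \<or> s = (-1::real)" and u: "0 < u" "u \<le> 845/1000" and U: "s * u = real_of_int (iv U) / 2 ^ K"
    and orbit_arc: "low_arc (if s = 1 then field_coeffs K p else refl_coeffs (field_coeffs K p)) u"
  shows "\<bar>2 ^ K * hit (field_coeffs K p) (s * u) - real_of_int (iv (shr (tmpl K) (smul U (horner (tmpl K) U hs))))\<bar>
    \<le> u * ((256 + 1458 * shell N (2 ^ k)) / (3/4)) + 7"
proof -
  have d': "list_all (negligible (tmpl k)) (table K N p)" and hs: "hs = map hd (table K N p)" using d by (auto simp: heads_map)
  interpret near_integral "field_coeffs K p" N K "tab K N p" "2 ^ k" by (rule table_near_integral[OF z N d'])
  have e: "\<bar>2 ^ K * hit (field_coeffs K p) (s * u) - (\<Sum>a<N+4. tab K N p a 0 * (s * u) ^ a)\<bar> \<le> u * err"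
    by (rule estimate[OF s u(1) _ orbit_arc]) (use u in simp)
  have lenT: "length (table K N p) = N"
    using rows_nth[of 0 "replicate N ()", OF _ table_def[of K N p]] N by simp
  have hd: "real_of_int (iv (hs ! a)) = tab K N p (Suc a) 0" if "a < N" for a
  proof -
    have m: "(start K N @ table K N p) ! (Suc a + 2) = table K N p ! a" by (simp add: start_def)
    have "length (table K N p ! a) > 0" using table_length[OF _ refl, of N "Suc a + 2" K p] that N m by simp
    then have "hs ! a = table K N p ! a ! 0" using that lenT by (simp add: hs hd_conv_nth)
    then show ?thesis using that by (simp add: tab_def m[simplified])
  qed
  have "(\<Sum>a<N+4. tab K N p a 0 * (s * u) ^ a) = (\<Sum>a<Suc N. tab K N p a 0 * (s * u) ^ a)"
    by (rule sum.mono_neutral_right) (auto simp: tab_def)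
  also have "\<dots> = (\<Sum>a<N. tab K N p (Suc a) 0 * (s * u) ^ Suc a)"
    unfolding sum.lessThan_Suc_shift unit by simp
  also have "\<dots> = s * u * (\<Sum>a<length hs. real_of_int (iv (hs ! a)) * (s * u) ^ a)"
    using hd lenT by (simp add: hs sum_distrib_left mult_ac)
  finally have F: "(\<Sum>a<N+4. tab K N p a 0 * (s * u) ^ a) = s * u * (\<Sum>a<length hs. real_of_int (iv (hs ! a)) * (s * u) ^ a)" .
  let ?h = "real_of_int (iv (horner (tmpl K) U hs))" and ?S = "\<Sum>a<length hs. real_of_int (iv (hs ! a)) * (s * u) ^ a"
  have us: "\<bar>s * u\<bar> = u" using s u by auto
  have "\<bar>?h - ?S\<bar> \<le> (\<Sum>i<length hs. u ^ i)" using horner_approx[OF U, of hs] us by simp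
  also have "\<dots> \<le> 1 / (1 - u)" by (rule geometric_bound) (use u in auto)
  also have "\<dots> \<le> 1 / (155/1000)" by (rule divide_left_mono) (use u in auto)
  finally have h: "\<bar>?h - ?S\<bar> \<le> 1 / (155/1000)" .
  have "\<bar>s * u * ?h - s * u * ?S\<bar> = u * \<bar>?h - ?S\<bar>" unfolding right_diff_distrib[symmetric] abs_mult[of "s * u"] us ..
  also have "\<dots> \<le> 845/1000 * (1 / (155/1000))" by (intro mult_mono h) (use u in auto)
  finally have h': "\<bar>s * u * ?h - s * u * ?S\<bar> \<le> 6" by simp
  have "\<bar>real_of_int (iv (shr (tmpl K) (smul U (horner (tmpl K) U hs)))) - s * u * ?h\<bar> < 1"
    using shr_approx[of K "smul U (horner (tmpl K) U hs)"] by (simp add: U)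
  then show ?thesis using e h' unfolding F err_def by linarith
qed

section \<open>Transfer to the line of discontinuity\<close>

lemma periodic_orbit_image:
  assumes L: "bounded_linear L" "inj L" and h: "\<And>p. h' (L p) = m * h p" "m > (0::real)"
    and Z: "\<And>p. Zp' (L p) = L (Zp p)" "\<And>p. Zm' (L p) = L (Zm p)"
    and lie: "\<And>p. lie_derivative Zp' h' (L p) = m * lie_derivative Zp h p" "\<And>p. lie_derivative Zm' h' (L p) = m * lie_derivative Zm h p"
    and o: "periodic_orbit h Zp Zm \<Gamma>"
  shows "periodic_orbit h' Zp' Zm' (L ` \<Gamma>)"
proof -
  obtain \<gamma> T where g: "T > 0" "continuous_on UNIV \<gamma>" "\<And>t. \<gamma> (t + T) = \<gamma> t" "range \<gamma> = \<Gamma>" "\<And>p. \<Gamma> \<noteq> {p}"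
    "finite {t \<in> {0..T}. h (\<gamma> t) = 0}"
    "\<And>t. h (\<gamma> t) > 0 \<Longrightarrow> (\<gamma> has_vector_derivative Zp (\<gamma> t)) (at t)"
    "\<And>t. h (\<gamma> t) < 0 \<Longrightarrow> (\<gamma> has_vector_derivative Zm (\<gamma> t)) (at t)"
    "\<And>t. h (\<gamma> t) = 0 \<Longrightarrow> crossing_point h Zp Zm (\<gamma> t)"
    using o unfolding periodic_orbit_def by blast
  have hs: "h' (L p) = 0 \<longleftrightarrow> h p = 0" "0 < h' (L p) \<longleftrightarrow> 0 < h p" "h' (L p) < 0 \<longleftrightarrow> h p < 0" for p
    using h by (auto simp: zero_less_mult_iff mult_less_0_iff)
  have ne: "L ` \<Gamma> \<noteq> {p}" for p
  proof
    assume a: "L ` \<Gamma> = {p}"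
    have "\<Gamma> \<noteq> {}" using g(4) by auto
    then obtain v where v: "v \<in> \<Gamma>" by blast
    have "w = v" if "w \<in> \<Gamma>" for w
    proof -
      have "L w = L v" using a that v by (metis image_eqI singletonD)
      then show ?thesis using L(2) by (simp add: inj_eq)
    qed
    then have "\<Gamma> = {v}" using v by blast
    then show False using g(5) by blast
  qed
  have m2: "0 < m * x * (m * y) \<longleftrightarrow> 0 < x * y" for x y :: real
  proof -
    have e: "m * x * (m * y) = (m * m) * (x * y)" by (simp only: mult_ac)
    have "0 < m * m" using h(2) by (rule mult_pos_pos[OF _ h(2)])
    from mult_less_cancel_left_pos[OF this, of 0 "x * y"] show ?thesis unfolding e by simp
  qed
  have cr: "crossing_point h Zp Zm p \<Longrightarrow> crossing_point h' Zp' Zm' (L p)" for p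
    unfolding crossing_point_def lie m2 by (simp add: hs)
  show ?thesis unfolding periodic_orbit_def
  proof (intro exI[of _ "\<lambda>t. L (\<gamma> t)"] exI[of _ T] conjI allI impI)
    show "continuous_on UNIV (\<lambda>t. L (\<gamma> t))"
      by (rule bounded_linear.continuous_on[OF L(1) g(2)])
    show "range (\<lambda>t. L (\<gamma> t)) = L ` \<Gamma>" using g(4) by auto
    show "finite {t \<in> {0..T}. h' (L (\<gamma> t)) = 0}" using g(6) by (simp add: hs)
    fix t
    show "((\<lambda>t. L (\<gamma> t)) has_vector_derivative Zp' (L (\<gamma> t))) (at t)" if "0 < h' (L (\<gamma> t))"
      unfolding Z by (rule bounded_linear.has_vector_derivative[OF L(1) g(7)]) (use that hs in simp)
    show "((\<lambda>t. L (\<gamma> t)) has_vector_derivative Zm' (L (\<gamma> t))) (at t)" if "h' (L (\<gamma> t)) < 0"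
      unfolding Z by (rule bounded_linear.has_vector_derivative[OF L(1) g(8)]) (use that hs in simp)
    show "crossing_point h' Zp' Zm' (L (\<gamma> t))" if "h' (L (\<gamma> t)) = 0"
      by (rule cr[OF g(9)]) (use that hs in simp)
  qed (use g ne in auto)
qed

definition chart :: "real \<Rightarrow> plane \<Rightarrow> plane" where
  "chart \<mu> = (\<lambda>(x, y). (\<mu> * x, \<mu> * (y - sqrt 3 * x)))"
definition chart_inv :: "real \<Rightarrow> plane \<Rightarrow> plane" where
  "chart_inv \<mu> = (\<lambda>(x, y). (1 / \<mu> * x, 1 / \<mu> * (y + sqrt 3 * x)))"

lemma chart_bij: assumes "\<mu> > 0" shows "chart_inv \<mu> (chart \<mu> p) = p" "chart \<mu> (chart_inv \<mu> p) = p"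
proof -
  have 1: "chart_inv \<mu> (chart \<mu> (x, y)) = (x, y)" for x y
    using assms by (simp add: chart_def chart_inv_def field_simps)
  have 2: "chart \<mu> (chart_inv \<mu> (x, y)) = (x, y)" for x y
    using assms by (simp add: chart_def chart_inv_def field_simps)
  show "chart_inv \<mu> (chart \<mu> p) = p" "chart \<mu> (chart_inv \<mu> p) = p"
    using 1[of "fst p" "snd p"] 2[of "fst p" "snd p"] by simp_all
qed

lemma chart_linear: "bounded_linear (chart \<mu>)" "bounded_linear (chart_inv \<mu>)"
proof -
  have "linear (chart \<mu>)" by (rule linearI) (auto simp: chart_def case_prod_unfold algebra_simps)
  then show "bounded_linear (chart \<mu>)" by (rule linear_conv_bounded_linear[THEN iffD1])
  have "linear (chart_inv \<mu>)" by (rule linearI) (auto simp: chart_inv_def case_prod_unfold algebra_simps add_divide_distrib)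
  then show "bounded_linear (chart_inv \<mu>)" by (rule linear_conv_bounded_linear[THEN iffD1])
qed

lemma lie_h_line: "lie_derivative Z h_line p = sqrt 3 * fst (Z p) + snd (Z p)"
  by (simp add: lie_derivative_def gradient_h_line inner_prod_def)

lemma limit_cycle_chart:
  assumes \<mu>: "\<mu> > 0" and Z: "\<And>p. Zp' (chart \<mu> p) = chart \<mu> (Zp p)" "\<And>p. Zm' (chart \<mu> p) = chart \<mu> (Zm p)"
    and c: "crossing_limit_cycle snd Zp Zm \<Gamma>"
  shows "crossing_limit_cycle h_line Zp' Zm' (chart \<mu> ` \<Gamma>)"
proof -
  have h: "h_line (chart \<mu> p) = \<mu> * snd p" for p by (simp add: h_line_def chart_def case_prod_unfold algebra_simps)
  have lie: "lie_derivative Z' h_line (chart \<mu> p) = \<mu> * lie_derivative Z snd p" if "Z' (chart \<mu> p) = chart \<mu> (Z p)" for Z Z' p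
    unfolding lie_h_line lie_snd that by (simp add: chart_def case_prod_unfold algebra_simps)
  have inj: "inj (chart \<mu>)" "inj (chart_inv \<mu>)" by (metis injI chart_bij[OF \<mu>])+
  have fw: "periodic_orbit h_line Zp' Zm' (chart \<mu> ` \<Delta>)" if "periodic_orbit snd Zp Zm \<Delta>" for \<Delta>
    by (rule periodic_orbit_image[where L = "chart \<mu>", OF chart_linear(1) inj(1) h \<mu> Z lie[where Z = Zp and Z' = Zp', OF Z(1)] lie[where Z = Zm and Z' = Zm', OF Z(2)] that])
  have Zi: "Zp (chart_inv \<mu> p) = chart_inv \<mu> (Zp' p)" "Zm (chart_inv \<mu> p) = chart_inv \<mu> (Zm' p)" for p
    using Z[of "chart_inv \<mu> p"] chart_bij[OF \<mu>] by metis+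
  have bw: "periodic_orbit snd Zp Zm (chart_inv \<mu> ` \<Delta>)" if "periodic_orbit h_line Zp' Zm' \<Delta>" for \<Delta>
  proof (rule periodic_orbit_image[where L = "chart_inv \<mu>" and m = "1 / \<mu>", OF chart_linear(2) inj(2) _ _ Zi _ _ that])
    show "snd (chart_inv \<mu> p) = 1 / \<mu> * h_line p" for p by (simp add: h_line_def chart_inv_def case_prod_unfold)
    show "lie_derivative Zp snd (chart_inv \<mu> p) = 1 / \<mu> * lie_derivative Zp' h_line p" for p
      using lie[where Z = Zp and Z' = Zp' and p = "chart_inv \<mu> p", OF Z(1)] chart_bij(2)[OF \<mu>, of p] \<mu> by simp
    show "lie_derivative Zm snd (chart_inv \<mu> p) = 1 / \<mu> * lie_derivative Zm' h_line p" for p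
      using lie[where Z = Zm and Z' = Zm' and p = "chart_inv \<mu> p", OF Z(2)] chart_bij(2)[OF \<mu>, of p] \<mu> by simp
  qed (use \<mu> in simp)
  obtain V where V: "open V" "\<Gamma> \<subseteq> V" "\<And>\<Delta>. periodic_orbit snd Zp Zm \<Delta> \<Longrightarrow> \<Delta> \<subseteq> V \<Longrightarrow> \<Delta> = \<Gamma>"
    using c unfolding crossing_limit_cycle_def by blast
  have cp: "periodic_orbit snd Zp Zm \<Gamma>" "\<exists>p\<in>\<Gamma>. snd p = 0"
    using c unfolding crossing_limit_cycle_def crossing_periodic_orbit_def by auto
  show ?thesis unfolding crossing_limit_cycle_def crossing_periodic_orbit_def
  proof (intro conjI exI[of _ "chart_inv \<mu> -` V"] allI impI)
    show "periodic_orbit h_line Zp' Zm' (chart \<mu> ` \<Gamma>)" by (rule fw[OF cp(1)])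
    show "\<exists>p\<in>chart \<mu> ` \<Gamma>. h_line p = 0" using cp(2) h by auto
    show "open (chart_inv \<mu> -` V)" by (rule open_vimage[OF V(1) linear_continuous_on[OF chart_linear(2)]])
    show "chart \<mu> ` \<Gamma> \<subseteq> chart_inv \<mu> -` V" using V(2) chart_bij[OF \<mu>] by auto
    fix \<Delta> assume d: "periodic_orbit h_line Zp' Zm' \<Delta> \<and> \<Delta> \<subseteq> chart_inv \<mu> -` V"
    then have "chart_inv \<mu> ` \<Delta> = \<Gamma>" by (intro V(3) bw) auto
    then have "chart \<mu> ` \<Gamma> = chart \<mu> ` (chart_inv \<mu> ` \<Delta>)" by simp
    then show "\<Delta> = chart \<mu> ` \<Gamma>" by (simp add: image_image chart_bij[OF \<mu>])
  qed
qed

definition quadratic :: "(real \<Rightarrow> real \<Rightarrow> real) \<Rightarrow> bool" where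
  "quadratic F \<longleftrightarrow> (\<exists>c. \<forall>x y. F x y = c 0 0 + c 1 0 * x + c 0 1 * y + c 2 0 * x^2 + c (1::nat) (1::nat) * (x * y) + c 0 2 * y^2)"

lemma quadratic_subst:
  "quadratic (\<lambda>x y. e0 + e1 * (\<alpha> * x + \<delta>) + e2 * (r * x + s * y) + e3 * (\<alpha> * x + \<delta>)^2 + e4 * ((\<alpha> * x + \<delta>) * (r * x + s * y)) + e5 * (r * x + s * y)^2)"
  unfolding quadratic_def
proof (rule exI[of _ "\<lambda>i j. if i = 0 \<and> j = 0 then e0 + e1 * \<delta> + e3 * \<delta>^2
    else if i = 1 \<and> j = 0 then e1 * \<alpha> + e2 * r + 2 * e3 * \<alpha> * \<delta> + e4 * \<delta> * r
    else if i = 0 \<and> j = 1 then e2 * s + e4 * \<delta> * s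
    else if i = 2 then e3 * \<alpha>^2 + e4 * \<alpha> * r + e5 * r^2
    else if i = 1 then e4 * \<alpha> * s + 2 * e5 * r * s else e5 * s^2"])
qed (simp add: power2_eq_square algebra_simps)

lemma bipoly_2: "bipoly 2 c x y = c 0 0 + c 1 0 * x + c 0 1 * y + c 2 0 * x^2 + c (Suc 0) (Suc 0) * (x * y) + c 0 2 * y^2"
proof -
  have s: "{(i, j). i + j \<le> (2::nat)} = {(0,0),(1,0),(0,1),(2,0),(1,1),(0,2)}"
    by auto
  show ?thesis unfolding bipoly_def s by simp
qed

text \<open>
  The first order term absorbs the difference to the unperturbed centre; the second order term is zero.
\<close>
lemma quad_field_reaches:
  assumes e: "\<epsilon> \<noteq> 0" and F: "quadratic F" and G: "quadratic G"
  obtains p q where "quad_field \<epsilon> p q = (\<lambda>(x, y). (F x y, G x y))"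
proof -
  obtain c where c: "\<And>x y. F x y = c 0 0 + c 1 0 * x + c 0 1 * y + c 2 0 * x^2 + c (1::nat) (1::nat) * (x * y) + c 0 2 * y^2"
    using F unfolding quadratic_def by blast
  obtain d where d: "\<And>x y. G x y = d 0 0 + d 1 0 * x + d 0 1 * y + d 2 0 * x^2 + d (1::nat) (1::nat) * (x * y) + d 0 2 * y^2"
    using G unfolding quadratic_def by blast
  define p where "p k i j = (if k = (1::nat) then (c i j - (if i = 0 \<and> j = 1 then -1 else if i = 2 \<and> j = 0 then 1 else 0)) / \<epsilon> else 0)" for k i j
  define q where "q k i j = (if k = (1::nat) then (d i j - (if i = 1 \<and> j = 0 then 1 else if i = 1 \<and> j = 1 then 1 else 0)) / \<epsilon> else 0)" for k i j
  have s: "{1..2} = {1, 2::nat}" by auto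
  have "quad_field \<epsilon> p q = (\<lambda>(x, y). (F x y, G x y))"
    unfolding quad_field_def c d s using e
    by (intro ext) (simp add: bipoly_2 p_def q_def case_prod_unfold field_simps)
  then show ?thesis using that by blast
qed

lemma quadratic_compose:
  assumes "\<And>X Y. F X Y = e0 + e1 * X + e2 * Y + e3 * X^2 + e4 * (X * Y) + e5 * Y^2"
  shows "quadratic (\<lambda>x y. F (\<alpha> * x + \<delta>) (r * x + s * y))"
  unfolding assms by (rule quadratic_subst)

lemma upper_field_quadratic: "\<exists>F G. quadratic F \<and> quadratic G \<and> (\<forall>p. chart \<mu> (upper_field z (chart_inv \<mu> p)) = (F (fst p) (snd p), G (fst p) (snd p)))"
proof -
  have i: "chart_inv \<mu> p = (1/\<mu> * fst p + 0, sqrt 3/\<mu> * fst p + 1/\<mu> * snd p)" for p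
    by (simp add: chart_inv_def case_prod_unfold field_simps add_divide_distrib)
  have 1: "\<mu> * fP z X Y = - \<mu> + \<mu> * z 0 * X + \<mu> * z 1 * Y + \<mu> * z 2 * X^2 + \<mu> * z 3 * (X * Y) + \<mu> * z 4 * Y^2" for X Y :: real
    by (simp add: fP_def algebra_simps)
  have 2: "\<mu> * (fQ z X Y - sqrt 3 * fP z X Y) = \<mu> * sqrt 3 + \<mu> * (2 - sqrt 3 * z 0) * X + (- \<mu> * sqrt 3 * z 1) * Y + \<mu> * (z 5 - sqrt 3 * z 2) * X^2
      + \<mu> * (z 6 - sqrt 3 * z 3) * (X * Y) + \<mu> * (z 7 - sqrt 3 * z 4) * Y^2" for X Y :: real
    by (simp add: fP_def fQ_def algebra_simps)
  show ?thesis
  proof (intro exI conjI allI)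
    show "quadratic (\<lambda>x y. \<mu> * fP z (1/\<mu> * x + 0) (sqrt 3/\<mu> * x + 1/\<mu> * y))"
      by (rule quadratic_compose[where F = "\<lambda>X Y. \<mu> * fP z X Y", OF 1])
    show "quadratic (\<lambda>x y. \<mu> * (fQ z (1/\<mu> * x + 0) (sqrt 3/\<mu> * x + 1/\<mu> * y) - sqrt 3 * fP z (1/\<mu> * x + 0) (sqrt 3/\<mu> * x + 1/\<mu> * y)))"
      by (rule quadratic_compose[where F = "\<lambda>X Y. \<mu> * (fQ z X Y - sqrt 3 * fP z X Y)", OF 2])
  qed (simp only: i upper_field_def chart_def split_conv)
qed

lemma lower_field_quadratic: "\<exists>F G. quadratic F \<and> quadratic G \<and> (\<forall>p. chart \<mu> (lower_field z c (chart_inv \<mu> p)) = (F (fst p) (snd p), G (fst p) (snd p)))"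
proof -
  have i: "chart_inv \<mu> p = ((1/\<mu> * fst p + - c) + c, - ((- sqrt 3/\<mu>) * fst p + (- 1/\<mu>) * snd p))" for p
    by (simp add: chart_inv_def case_prod_unfold field_simps add_divide_distrib)
  have 1: "\<mu> * - fP z X Y = \<mu> + (- \<mu> * z 0) * X + (- \<mu> * z 1) * Y + (- \<mu> * z 2) * X^2 + (- \<mu> * z 3) * (X * Y) + (- \<mu> * z 4) * Y^2" for X Y :: real
    by (simp add: fP_def algebra_simps)
  have 2: "\<mu> * (fQ z X Y - sqrt 3 * - fP z X Y) = - \<mu> * sqrt 3 + \<mu> * (2 + sqrt 3 * z 0) * X + (\<mu> * sqrt 3 * z 1) * Y + \<mu> * (z 5 + sqrt 3 * z 2) * X^2
      + \<mu> * (z 6 + sqrt 3 * z 3) * (X * Y) + \<mu> * (z 7 + sqrt 3 * z 4) * Y^2" for X Y :: real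
    by (simp add: fP_def fQ_def algebra_simps)
  show ?thesis
  proof (intro exI conjI allI)
    show "quadratic (\<lambda>x y. \<mu> * - fP z (1/\<mu> * x + - c) ((- sqrt 3/\<mu>) * x + (- 1/\<mu>) * y))"
      by (rule quadratic_compose[where F = "\<lambda>X Y. \<mu> * - fP z X Y", OF 1])
    show "quadratic (\<lambda>x y. \<mu> * (fQ z (1/\<mu> * x + - c) ((- sqrt 3/\<mu>) * x + (- 1/\<mu>) * y) - sqrt 3 * - fP z (1/\<mu> * x + - c) ((- sqrt 3/\<mu>) * x + (- 1/\<mu>) * y)))"
      by (rule quadratic_compose[where F = "\<lambda>X Y. \<mu> * (fQ z X Y - sqrt 3 * - fP z X Y)", OF 2])
  qed (simp only: i lower_field_def chart_def split_conv add_diff_cancel_right' minus_minus)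
qed

lemma realize:
  assumes U: "(0, 0) \<in> interior U" and C: "finite C" "\<And>\<Gamma>. \<Gamma> \<in> C \<Longrightarrow> crossing_limit_cycle snd (upper_field z) (lower_field w c) \<Gamma>"
    and B: "\<And>\<Gamma> p. \<Gamma> \<in> C \<Longrightarrow> p \<in> \<Gamma> \<Longrightarrow> norm p \<le> R" and e: "\<epsilon> \<noteq> 0"
  shows "\<exists>pp qp pm qm. \<exists>D. finite D \<and> card D = card C \<and>
     (\<forall>\<Gamma>\<in>D. \<Gamma> \<subseteq> U \<and> crossing_limit_cycle h_line (quad_field \<epsilon> pp qp) (quad_field \<epsilon> pm qm) \<Gamma>)"
proof -
  obtain r where r: "r > 0" "ball (0, 0) r \<subseteq> U" using U mem_interior by blast
  define \<mu> where "\<mu> = r / (8 * (1 + \<bar>R\<bar>))"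
  have \<mu>: "\<mu> > 0" using r by (simp add: \<mu>_def)
  have small: "norm (chart \<mu> p) < r" if "norm p \<le> R" for p
  proof -
    obtain x y where p: "p = (x, y)" by (cases p)
    have xy: "\<bar>x\<bar> \<le> R" "\<bar>y\<bar> \<le> R" using that norm_fst_le[of x y] norm_snd_le[of y x] p by auto
    have s3: "sqrt 3 \<le> 2" by (rule real_le_lsqrt) simp_all
    have "norm (chart \<mu> p) \<le> norm (\<mu> * x) + norm (\<mu> * (y - sqrt 3 * x))"
      unfolding p chart_def split_conv by (rule norm_Pair_le)
    also have "\<dots> = \<mu> * (\<bar>x\<bar> + \<bar>y - sqrt 3 * x\<bar>)" using \<mu> by (simp only: real_norm_def abs_mult abs_of_pos distrib_left)
    also have "\<bar>y - sqrt 3 * x\<bar> \<le> \<bar>y\<bar> + 2 * \<bar>x\<bar>"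
      using abs_triangle_ineq4[of y "sqrt 3 * x"] mult_right_mono[OF s3, of "\<bar>x\<bar>"] by (simp add: abs_mult)
    finally have "norm (chart \<mu> p) \<le> \<mu> * (\<bar>x\<bar> + (\<bar>y\<bar> + 2 * \<bar>x\<bar>))" using \<mu> by simp
    also have "\<dots> \<le> \<mu> * (4 * (1 + \<bar>R\<bar>))" using xy \<mu> by (intro mult_left_mono) auto
    also have "\<dots> = r / 2" using abs_ge_zero[of R] by (simp add: \<mu>_def field_simps)
    finally show ?thesis using r by simp
  qed
  obtain F G where FG: "quadratic F" "quadratic G" "\<And>p. chart \<mu> (upper_field z (chart_inv \<mu> p)) = (F (fst p) (snd p), G (fst p) (snd p))"
    using upper_field_quadratic by blast
  obtain F' G' where FG': "quadratic F'" "quadratic G'" "\<And>p. chart \<mu> (lower_field w c (chart_inv \<mu> p)) = (F' (fst p) (snd p), G' (fst p) (snd p))"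
    using lower_field_quadratic by blast
  obtain pp qp where P: "quad_field \<epsilon> pp qp = (\<lambda>(x, y). (F x y, G x y))" using quad_field_reaches[OF e FG(1,2)] by blast
  obtain pm qm where M: "quad_field \<epsilon> pm qm = (\<lambda>(x, y). (F' x y, G' x y))" using quad_field_reaches[OF e FG'(1,2)] by blast
  have Zp: "quad_field \<epsilon> pp qp (chart \<mu> p) = chart \<mu> (upper_field z p)" for p
    using FG(3)[of "chart \<mu> p"] by (simp add: P case_prod_unfold chart_bij[OF \<mu>])
  have Zm: "quad_field \<epsilon> pm qm (chart \<mu> p) = chart \<mu> (lower_field w c p)" for p
    using FG'(3)[of "chart \<mu> p"] by (simp add: M case_prod_unfold chart_bij[OF \<mu>])
  have "inj (chart \<mu>)" by (metis injI chart_bij[OF \<mu>])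
  then have card: "card ((`) (chart \<mu>) ` C) = card C" by (intro card_image inj_on_subset[OF inj_on_image_Pow, of "chart \<mu>" UNIV]) auto
  have D: "\<Delta> \<subseteq> U \<and> crossing_limit_cycle h_line (quad_field \<epsilon> pp qp) (quad_field \<epsilon> pm qm) \<Delta>"
    if D: "\<Delta> \<in> (`) (chart \<mu>) ` C" for \<Delta>
  proof -
    obtain \<Gamma> where \<Gamma>: "\<Gamma> \<in> C" "\<Delta> = chart \<mu> ` \<Gamma>" using D by blast
    have "chart \<mu> p \<in> U" if "p \<in> \<Gamma>" for p
      using small[OF B[OF \<Gamma>(1) that]] r(2) by (auto simp: dist_norm zero_prod_def[symmetric])
    then have "\<Delta> \<subseteq> U" unfolding \<Gamma>(2) by blast
    moreover have "crossing_limit_cycle h_line (quad_field \<epsilon> pp qp) (quad_field \<epsilon> pm qm) \<Delta>"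
      unfolding \<Gamma>(2) by (rule limit_cycle_chart[OF \<mu> Zp Zm C(2)[OF \<Gamma>(1)]])
    ultimately show ?thesis ..
  qed
  show ?thesis
    by (rule exI[of _ pp], rule exI[of _ qp], rule exI[of _ pm], rule exI[of _ qm], rule exI[of _ "(`) (chart \<mu>) ` C"])
      (intro conjI ballI D card finite_imageI C(1))
qed

section \<open>Certified comparisons of heights\<close>

definition sg_of :: "int \<Rightarrow> sg" where
  "sg_of i = (if i = 0 then Ze else if 0 < i then Po (num_of_nat (nat i)) else Ne (num_of_nat (nat (- i))))"

lemma nv_numeral: "nv n = numeral n"
proof (induction n)
  case (Bit0 n) show ?case unfolding nv.simps numeral_Bit0[of n] Bit0 by (rule mult_2)
next
  case (Bit1 n) show ?case unfolding nv.simps numeral_Bit1[of n] Bit1 by (simp only: mult_2)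
qed simp

lemma sg_of_simps:
  "sg_of 0 = Ze" "sg_of 1 = Po num.One" "sg_of (numeral n) = Po n" "sg_of (- 1) = Ne num.One" "sg_of (- numeral n) = Ne n"
proof -
  have n: "num_of_nat (numeral n) = n" for n by (metis nat_of_num_inverse nat_of_num_numeral)
  show "sg_of 0 = Ze" "sg_of 1 = Po num.One" "sg_of (numeral n) = Po n" "sg_of (- 1) = Ne num.One" "sg_of (- numeral n) = Ne n"
    using n[of num.One] by (simp_all add: sg_of_def n)
qed

lemma iv_sg_of: "iv (sg_of i) = i"
proof -
  have n: "nv (num_of_nat m) = int m" if "0 < m" for m
    using that by (simp add: nv_numeral) (metis num_of_nat_inverse nat_of_num_numeral of_nat_numeral)
  show ?thesis by (simp add: sg_of_def n)
qed

fun evals :: "num \<Rightarrow> sg list \<Rightarrow> sg list \<Rightarrow> sg list" where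
  "evals t hs [] = []"
| "evals t hs (U # Us) = shr t (smul U (horner t U hs)) # evals t hs Us"

lemma evals_map: "evals t hs Us = map (\<lambda>U. shr t (smul U (horner t U hs))) Us"
  by (induction Us) auto

lemma certified_value:
  assumes z: "small_coeffs (field_coeffs K p)" "0 \<le> field_coeffs K p 0" "0 \<le> field_coeffs K p 5"
      "field_coeffs K p 0 \<le> 1/10 \<or> field_coeffs K p 5 \<le> 6/100"
    and N: "6 \<le> N" and d: "digest (tmpl k) (table K N p) = (hs, True)"
    and err: "(256 + 1458 * shell N (2 ^ k)) / (3/4) \<le> 700"
    and x: "x = real_of_int i / 2 ^ K" "x \<noteq> 0" "- 845/1000 \<le> x" "x \<le> 765/1000"
    and v: "shr (tmpl K) (smul (sg_of i) (horner (tmpl K) (sg_of i) hs)) = sg_of j"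
  shows "\<bar>2 ^ K * hit (field_coeffs K p) x - real_of_int j\<bar> \<le> \<bar>x\<bar> * 700 + 7"
proof -
  define s :: real where "s = (if 0 < x then 1 else -1)"
  have s: "s = 1 \<or> s = -1" "s * \<bar>x\<bar> = x" "0 < \<bar>x\<bar>" "\<bar>x\<bar> \<le> 845/1000" using x(2-4) by (auto simp: s_def)
  have orbit_arc: "low_arc (if s = 1 then field_coeffs K p else refl_coeffs (field_coeffs K p)) \<bar>x\<bar>"
  proof (cases "0 < x")
    case True
    have "low_arc (field_coeffs K p) \<bar>x\<bar>"
      by (rule low_arcI[OF z(1), of "\<bar>x\<bar>" "765/1000"]) (use x(2-4) True z(4) in auto)
    then show ?thesis using True by (simp add: s_def)
  next
    case False
    have "low_arc (refl_coeffs (field_coeffs K p)) \<bar>x\<bar>"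
      by (rule low_arcI[of _ _ "845/1000"]) (use z x(2-4) False in \<open>auto simp: small_refl refl_coeffs_def\<close>)
    then show ?thesis using False by (simp add: s_def)
  qed
  have "\<bar>2 ^ K * hit (field_coeffs K p) (s * \<bar>x\<bar>) - real_of_int (iv (shr (tmpl K) (smul (sg_of i) (horner (tmpl K) (sg_of i) hs))))\<bar>
    \<le> \<bar>x\<bar> * ((256 + 1458 * shell N (2 ^ k)) / (3/4)) + 7"
    by (rule certified_hit[OF z(1) N d s(1,3,4) _ orbit_arc]) (unfold s(2) iv_sg_of, rule x(1))
  also have "\<dots> \<le> \<bar>x\<bar> * 700 + 7" by (intro add_right_mono mult_left_mono err) simp
  finally show ?thesis unfolding v iv_sg_of s(2) .
qed

lemma hit_compare:
  assumes "\<bar>2 ^ K * h1 - real_of_int j1\<bar> \<le> \<bar>x1\<bar> * 700 + 7" "\<bar>2 ^ K * h2 - real_of_int j2\<bar> \<le> \<bar>x2\<bar> * 700 + 7"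
    "x1 = real_of_int i1 / 2 ^ K" "x2 = real_of_int i2 / 2 ^ K" "700 * (\<bar>i1\<bar> + \<bar>i2\<bar>) + 14 * 2 ^ K < (j2 - j1) * 2 ^ K"
  shows "h1 < (h2::real)"
proof -
  have "real_of_int (700 * (\<bar>i1\<bar> + \<bar>i2\<bar>) + 14 * 2 ^ K) < real_of_int ((j2 - j1) * 2 ^ K)" using assms(5) by (simp only: of_int_less_iff)
  then have "700 * (\<bar>real_of_int i1\<bar> + \<bar>real_of_int i2\<bar>) + 14 * 2 ^ K < (real_of_int j2 - real_of_int j1) * 2 ^ K" by simp
  then have "(700 * (\<bar>real_of_int i1\<bar> + \<bar>real_of_int i2\<bar>) + 14 * 2 ^ K) / 2 ^ K < real_of_int j2 - real_of_int j1"
    by (simp add: pos_divide_less_eq)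
  then have "\<bar>x1\<bar> * 700 + \<bar>x2\<bar> * 700 + 14 < real_of_int j2 - real_of_int j1"
    by (simp add: assms(3,4) abs_divide add_divide_distrib mult.commute)
  then have "2 ^ K * h1 < 2 ^ K * h2" using assms(1,2) by linarith
  then show ?thesis by simp
qed

context matched_pair
begin

text \<open>
  It is enough to compare heights at a rational point \<open>a\<close> close to the partner, on the side on which
  replacing \<open>a\<close> by the partner can only increase the gap.
\<close>
lemma gap_positive: "b \<in> {p..q} \<Longrightarrow> -88/100 < a \<Longrightarrow> a < - \<bar>c\<bar> \<Longrightarrow> partner b < - \<bar>c\<bar> \<Longrightarrow> hit z b < hit z a \<Longrightarrow> hit w (a - c) < hit w (b - c) \<Longrightarrow> 0 < gap b"
proof -
  assume a: "b \<in> {p..q}" "-88/100 < a" "a < - \<bar>c\<bar>" "partner b < - \<bar>c\<bar>" "hit z b < hit z a" "hit w (a - c) < hit w (b - c)"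
  have "a < 0" using a(3) by linarith
  then have "a < partner b"
    using hit_less_neg[OF z, of "partner b" a] partner[OF a(1)] a by (cases "partner b" a rule: linorder_cases) auto
  moreover have "-9/10 < a - c" "partner b - c < 0" using a c by linarith+
  ultimately have "hit w (partner b - c) < hit w (a - c)" using hit_less_neg[OF w, of "a - c" "partner b - c"] by simp
  then show ?thesis using a(6) by (simp add: gap_def)
qed

lemma gap_negative: "b \<in> {p..q} \<Longrightarrow> -88/100 < a \<Longrightarrow> a < - \<bar>c\<bar> \<Longrightarrow> hit z a < hit z b \<Longrightarrow> hit w (b - c) < hit w (a - c) \<Longrightarrow> gap b < 0"
proof -
  assume a: "b \<in> {p..q}" "-88/100 < a" "a < - \<bar>c\<bar>" "hit z a < hit z b" "hit w (b - c) < hit w (a - c)"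
  have "partner b < a"
    using hit_less_neg[OF z, of a "partner b"] partner[OF a(1)] a by (cases "partner b" a rule: linorder_cases) auto
  moreover have "-9/10 < partner b - c" "a - c < 0" using a partner[OF a(1)] c by linarith+
  ultimately have "hit w (a - c) < hit w (partner b - c)" using hit_less_neg[OF w, of "partner b - c" "a - c"] by simp
  then show ?thesis using a(5) by (simp add: gap_def)
qed

end

section \<open>The explicit fields\<close>

text \<open>
  The numerators over \<open>2 ^ 158\<close> of the coefficients of the two fields and of the translation. They were found by
  numerical continuation to a pair of fields whose gap function oscillates like a Chebyshev polynomial.
\<close>
definition z_prm :: prm where
  "z_prm = Prm (sg_of (33394135404414031557157941970039716382662264389)) (sg_of (6114363862186606312013943634771278102579618392)) (sg_of (-
   7492705761011597381857762942855647643699446701)) (sg_of (- 605059961387290084763241639504890979369705480)) (sg_of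
   (99794428241919784208663640427104736330260875)) (sg_of (68535623116855620416093511506115612144004027852)) (sg_of
   (13478267765897342630564820290016927037608726989)) (sg_of (511299889656027011856018285879699507403313511))"
definition w_prm :: prm where
  "w_prm = Prm (sg_of (56913668458067465927125167298914962048876299766)) (sg_of (- 1970329551393143454191335183764721525013747319)) (sg_of
   (11610404074965610823519870314273416315121563584)) (sg_of (72011946124785569546121150495463026904846973)) (sg_of
   (102553670354932586092170920944997558134866980)) (sg_of (21496557009548751676159060848365120811597201825)) (sg_of (-
   6733832773040735960832281168068366132847636649)) (sg_of (339711053329322696314565616968698635431780249))"
definition shift_num :: int where "shift_num = 4426"

definition z_coeffs :: "int list" where
  "z_coeffs = [0, 365375409332725729550921208179070754913983135744, 45107964641894561176803131815398348303109518876, 5772437986253377716272043650049384726083278630,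
   1075811852374369379202923842334085463131702962, 239153635182208440319386174203861772571111566, 54876586403392482319113271809460165357075929,
   12721286388910081902084876984953891434392481, 3016728290564112004627522789881579686485466, 732370315791656168050518753153884826708193,
   181013797952078656637495148865867760238667, 45326946119971541565168594849900869855542, 11471089293966606895714282948638295474868,
   2929716329267072020733465890579318569435, 754223424947673042782526014230343204840, 195506400298742827410670114593853956509,
   50982715493677198164617272881561693091, 13365197482709876399814551828772145191, 3520171535210562418703082240369670901,
   931052200440657845837839401064087582, 247185683073756290169953145243322444, 65849882560116943451216702326752398, 17596812175708991774112361707260944,
   4715665021669888390729510543157520, 1267007638717922132579657503740191, 341234223939556825099935079330036, 92104990765260160855262225833983,
   24911509354412015593131254976541, 6750561549150414500485659140810, 1832508471994373136734437938154, 498272874815803848450256932877,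
   135693032771235033759589157621, 37006253245039788875389564821, 10106062171762222505439520110, 2763398196549658675129464609,
   756533167886756731857131894, 207351155393620287263822583, 56892139720749843606641287, 15625748944712326223262684, 4295854038853938822668776,
   1182108461284090778917863, 325570344024371950350485, 89741641923001974861899, 24756432411030264254384, 6834572330163053600631, 1888205534454200481256,
   522021247883562301362, 144415999870682647339, 39977780753339942667, 11073554501769603484, 3069091512561233484, 851093169779668305, 236145390876543118,
   65555343545031870, 18207680504645205, 5059541399597186, 1406598697516849, 391223300201051, 108859902474975, 30303550884669, 8439085651828,
   2351082140780, 655247334009, 182684858896, 50951233250, 14215330269, 3967388991, 1107627832, 309328577, 86413058, 24147271, 6749669, 1887205, 527806,
   147654, 41317, 11564, 3237, 906, 253, 71, 19, 5, 1, 0, 0, 0, 0, 0, 0, 0, 0, 0, 0, 0, 0, 0, 0, 0, 0, 0, 0]"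

definition w_coeffs :: "int list" where
  "w_coeffs = [0, 365375409332725729550921208179070754913983135744, 45107964641894561176803131815398348303116600452, 8406350265913540776626331098376730195199688028,
   1726158969044002310430781697551611652869214329, 410665705992661062685790615158539343029123136, 98492394952560052854216854146130954382449319,
   24024505707358555981340636927169168599827531, 5952859668113637393812501827120991411830810, 1503093259714854121621198034137383341690401,
   384647887510054979576487219521363628547215, 99413563450927579827400088357370900028273, 25898789545807641953180100214565043470086,
   6794760530056810804305979583647565985801, 1793706191634258157928494975475008950849, 476045806541684742036575978381509882203,
   126928573252691915329152492542129681546, 33981700386723285500894813470719557235, 9130902428093704130797940667997722403,
   2461512469930518959596657303677947301, 665532236534211677507072447894193311, 180423673607209883273395057256818180,
   49031010769656232556669437220361046, 13353969942703234391255972032415328, 3644456165110578197591733732066117, 996478272849547258660007601269987,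
   272931525955288887928946333702234, 74874719180633013835652343743135, 20571364314965789842746878178506, 5659697118831197119635788356116,
   1559142121762245418245242995024, 430035869889282951395285555054, 118745598700969736853801288360, 32824231739146790272188879627,
   9082570527684406047112793531, 2515564201729699813625846493, 697351533135534960664423704, 193480402276783565014605040, 53724434067147031941556516,
   14929271386401205594806118, 4151651077397643741009501, 1155322736935449175145900, 321715427403025719486110, 89642380692950995669759,
   24992835547553725482839, 6972152504629744954825, 1946062152128417340546, 543469257134907937778, 151849125203334788270, 42448251490704201499,
   11871598659181243030, 3321640840321526824, 929785624845257970, 260371061523818433, 72941678913375723, 20442110607058265, 5731083841490570,
   1607323374649910, 450941222109608, 126555716876570, 35529081312951, 9977506635052, 2802796634377, 787568877758, 221365009587, 62237068330,
   17502715217, 4923505814, 1385329061, 389886115, 109755409, 30903991, 8703640, 2451784, 690806, 194679, 54874, 15470, 4362, 1230, 346, 97, 27, 7, 2, 0,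
   0, 0]"

text \<open>
  Numerators over \<open>2 ^ 158\<close> of the test points: seventeen points to the right of the origin, then rational
  approximations of their partners. For \<open>z\<close> two more points follow, a point to the left of all partners and one to
  the right of them. The arguments of \<open>w\<close> are translated. A partner is approximated so
  that both comparisons of heights in \<open>gap_positive\<close> or \<open>gap_negative\<close> have half of the gap as margin.
\<close>
definition z_args :: "int list" where
  "z_args = [7136238463529799405291429847247475681913733120, 28188141930942707650901147896627528943559245824, 56376283861885415301802295793255057887118491648,
   83493990023298653041909729212795465478390677504, 109541260415182420871223448155248751717375803392, 134518095037536718789743452620614916604073869312,
   157710870044008566856940599624169212570293501952, 179476397357774455043079460658274013400130387968, 199457865055657893377895464230566945309488840704,
   217298461214482391891124038848685634514273173504, 232998185834247950582765184512630081014483386368, 246557038914954569452818901222400284810119479296,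
   257618208533425758531020617485633872117085765632, 266538506612838007787634904794693216719477932032, 272961121230014827252397191657215944833200291840,
   276529240461779726955042906580839682674157158400, 277956488154485686836101192550289177810539905024, - 7153487427625358303316805881765655475585582706,
   - 28459213205894745654049308686035616337328035238, - 57471250015692421855612754773096944580566662924, -
   85918887793361451969382002875356651443096051826, - 113754588631257758167744913102703264510465341949, -
   140930532650616548543535731496486192629764026258, - 166602024950857237253402720580224851522100806413, -
   191086895226140694782822260717720915278052242463, - 213908856021110690430817621690710322412518542634, -
   234570838972283422871876271013560006883781243788, - 252981051525552134282985297846617536602484014344, -
   269055808531174669922091952672203937006392487199, - 282291710928937832656759710991258067506170485435, -
   293047061554221820829310032323243718209987960839, - 300836360892321042418111991852966583773931145478, -
   305180331451689779089507336512386868907907874413, - 306921253369035812154006681195414548739468561746, -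
   308642313547663824278854340893453323242768957440, - 3568119231764899702645714923623737840956866560]"

definition z_vals :: "int list" where
  "z_vals = [139716581088203038543844826559097464732316410, 2195591186309819548159243964347080880854577566, 8867754469425810628632833146409426148880993958,
   19634399223420127345879307178940223711043419925, 34105948532658016377658703608542609720417434804, 51889719172990574952610208942526627627795053056,
   71920238658891145303451391313012344005650072574, 93877743278547691855588954436319315633164825595, 116793949462573846264767136729677597314954181317,
   139536287943298276223893930758623771456655370327, 161366222126988406379841167948655436560850027932, 181612818842825280136705276008435000564242958800,
   199101324705074845606445471799408632711421098682, 213849200675346044854863206858758387372930638084, 224827552874913851617069333872241781303738789364,
   231057802038290571766708168765417405588854204350, 233576253547785624723068095947263523535651105145, 139716581088203038543844826559097464732316287,
   2195591186309819548159243964347080880854578252, 8867754469425810628632833146409426148880992575, 19634399223420127345879307178940223711043421989,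
   34105948532658016377658703608542609720417432073, 51889719172990574952610208942526627627795056443, 71920238658891145303451391313012344005650068566,
   93877743278547691855588954436319315633164830205, 116793949462573846264767136729677597314954176139, 139536287943298276223893930758623771456655376024,
   161366222126988406379841167948655436560850021771, 181612818842825280136705276008435000564242965378, 199101324705074845606445471799408632711421091785,
   213849200675346044854863206858758387372930645279, 224827552874913851617069333872241781303738781951, 231057802038290571766708168765417405588854211413,
   233576253547785624723068095947263523535651101541, 236078075382984377342136206394296012952900891839, 34802956711611475393045650489476233813546274]"

definition w_args :: "int list" where
  "w_args = [7136238463529799405291429847247475681913728694, 28188141930942707650901147896627528943559241398, 56376283861885415301802295793255057887118487222,
   83493990023298653041909729212795465478390673078, 109541260415182420871223448155248751717375798966, 134518095037536718789743452620614916604073864886,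
   157710870044008566856940599624169212570293497526, 179476397357774455043079460658274013400130383542, 199457865055657893377895464230566945309488836278,
   217298461214482391891124038848685634514273169078, 232998185834247950582765184512630081014483381942, 246557038914954569452818901222400284810119474870,
   257618208533425758531020617485633872117085761206, 266538506612838007787634904794693216719477927606, 272961121230014827252397191657215944833200287414,
   276529240461779726955042906580839682674157153974, 277956488154485686836101192550289177810539900598, - 7153487427625358303316805881765655475585587132,
   - 28459213205894745654049308686035616337328039664, - 57471250015692421855612754773096944580566667350, -
   85918887793361451969382002875356651443096056252, - 113754588631257758167744913102703264510465346375, -
   140930532650616548543535731496486192629764030684, - 166602024950857237253402720580224851522100810839, -
   191086895226140694782822260717720915278052246889, - 213908856021110690430817621690710322412518547060, -
   234570838972283422871876271013560006883781248214, - 252981051525552134282985297846617536602484018770, -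
   269055808531174669922091952672203937006392491625, - 282291710928937832656759710991258067506170489861, -
   293047061554221820829310032323243718209987965265, - 300836360892321042418111991852966583773931149904, -
   305180331451689779089507336512386868907907878839, - 306921253369035812154006681195414548739468566172]"

definition w_vals :: "int list" where
  "w_vals = [139716966230851203554872690397775925186868979, 2195686306637497553648646318765294585270314451, 8869306651596358289155834151214527704703290217,
   19642012728734831000809175013521454559375432566, 34128937763302567442699032732639831274851692660, 51942980730459266063764699087990660120389892520,
   72022659832615821901631323752806872544965810311, 94052442699728192999635714773995625523378143579, 117064661092781633943140137908785791581954806682,
   139923133199340755523237739259585833826793043364, 161884145421357126671397832671600773020118517323, 182269532720339344560277905175657756208505858872,
   199891301734331802624787472415788497610571631095, 214761221175028446633836342105046863659953039376, 225836176430934447423920793999639220370104825109,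
   232123435782846480969720381393390360314172639834, 234665382526194981375781750121786918919354291062, 139716966230851203554872690397775925186869101,
   2195686306637497553648646318765294585270313764, 8869306651596358289155834151214527704703291599, 19642012728734831000809175013521454559375430503,
   34128937763302567442699032732639831274851695385, 51942980730459266063764699087990660120389889139, 72022659832615821901631323752806872544965814307,
   94052442699728192999635714773995625523378138985, 117064661092781633943140137908785791581954811835, 139923133199340755523237739259585833826793037697,
   161884145421357126671397832671600773020118523445, 182269532720339344560277905175657756208505852342, 199891301734331802624787472415788497610571637936,
   214761221175028446633836342105046863659953032243, 225836176430934447423920793999639220370104832456, 232123435782846480969720381393390360314172632835,
   234665382526194981375781750121786918919354294631]"

text \<open>
  The coefficients of the four highest weights are below \<open>2 ^ 7\<close>, and the list contains the coefficients of the
  powers of \<open>x\<close>. Weight 102 is needed for the first field and weight 88 for the second, whose coefficients decay faster.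
\<close>
lemma z_digest: "digest (tmpl 7) (table 158 102 z_prm) = (map sg_of z_coeffs, True)"
  unfolding z_prm_def z_coeffs_def by (simp only: sg_of_simps list.map) code_simp

lemma w_digest: "digest (tmpl 5) (table 158 88 w_prm) = (map sg_of w_coeffs, True)"
  unfolding w_prm_def w_coeffs_def by (simp only: sg_of_simps list.map) code_simp

lemma z_evals: "evals (tmpl 158) (map sg_of z_coeffs) (map sg_of z_args) = map sg_of z_vals"
  unfolding z_coeffs_def z_args_def z_vals_def by (simp only: sg_of_simps list.map) code_simp

lemma w_evals: "evals (tmpl 158) (map sg_of w_coeffs) (map sg_of w_args) = map sg_of w_vals"
  unfolding w_coeffs_def w_args_def w_vals_def by (simp only: sg_of_simps list.map) code_simp

definition in_range :: "int \<Rightarrow> bool" where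
  "in_range i \<longleftrightarrow> i \<noteq> 0 \<and> - (845 * 2 ^ 158) \<le> 1000 * i \<and> 1000 * i \<le> 765 * 2 ^ 158"

text \<open>
  The heights over the points \<open>i1\<close> and \<open>i2\<close> have approximations \<open>j1\<close> and \<open>j2\<close> with errors \<open>700 \<bar>i\<bar> / 2 ^ 158 + 7\<close>.
\<close>
definition separated :: "int \<Rightarrow> int \<Rightarrow> int \<Rightarrow> int \<Rightarrow> bool" where
  "separated i1 j1 i2 j2 \<longleftrightarrow> 700 * (\<bar>i1\<bar> + \<bar>i2\<bar>) + 14 * 2 ^ 158 < (j2 - j1) * 2 ^ 158"

definition alternates :: "nat \<Rightarrow> bool" where
  "alternates k \<longleftrightarrow> 0 < z_args ! k \<and> z_args ! (17 + k) < - \<bar>shift_num\<bar>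
     \<and> w_args ! k = z_args ! k - shift_num \<and> w_args ! (17 + k) = z_args ! (17 + k) - shift_num
     \<and> (if even k
        then separated (z_args ! (17 + k)) (z_vals ! (17 + k)) (z_args ! k) (z_vals ! k)
           \<and> separated (w_args ! k) (w_vals ! k) (w_args ! (17 + k)) (w_vals ! (17 + k))
        else separated (z_args ! k) (z_vals ! k) (z_args ! (17 + k)) (z_vals ! (17 + k))
           \<and> separated (w_args ! (17 + k)) (w_vals ! (17 + k)) (w_args ! k) (w_vals ! k))"

lemma data_checks:
  "length z_args = 36" "length w_args = 34" "length z_vals = 36" "length w_vals = 34"
  "list_all in_range z_args" "list_all in_range w_args"
  "list_all alternates [0..<17]" "list_all (\<lambda>k. z_args ! k < z_args ! Suc k) [0..<16]"
  "separated (z_args ! 16) (z_vals ! 16) (z_args ! 34) (z_vals ! 34)" "separated (z_args ! 35) (z_vals ! 35) (z_args ! 0) (z_vals ! 0)"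
  "z_args ! 34 < z_args ! 35" "z_args ! 35 < - \<bar>shift_num\<bar>" "\<bar>shift_num\<bar> < z_args ! 0" "\<bar>shift_num\<bar> * 100 \<le> 2 ^ 158"
  by code_simp+

section \<open>Sixteen cycles\<close>

definition Z_coeffs :: "nat \<Rightarrow> real" where "Z_coeffs = field_coeffs 158 z_prm"
definition W_coeffs :: "nat \<Rightarrow> real" where "W_coeffs = field_coeffs 158 w_prm"
definition shift :: real where "shift = real_of_int shift_num / 2 ^ 158"

definition z_pt :: "nat \<Rightarrow> real" where "z_pt k = real_of_int (z_args ! k) / 2 ^ 158"
definition w_pt :: "nat \<Rightarrow> real" where "w_pt k = real_of_int (w_args ! k) / 2 ^ 158"

lemma Z_small: "small_coeffs Z_coeffs" "0 \<le> Z_coeffs 0" "0 \<le> Z_coeffs 5" "Z_coeffs 0 \<le> 1/10 \<or> Z_coeffs 5 \<le> 6/100"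
  by (simp_all add: small_coeffs_def Z_coeffs_def field_coeffs_def z_prm_def iv_sg_of)

lemma W_small: "small_coeffs W_coeffs" "0 \<le> W_coeffs 0" "0 \<le> W_coeffs 5" "W_coeffs 0 \<le> 1/10 \<or> W_coeffs 5 \<le> 6/100"
  by (simp_all add: small_coeffs_def W_coeffs_def field_coeffs_def w_prm_def iv_sg_of)

lemma in_rangeD:
  assumes "in_range i" "x = real_of_int i / 2 ^ 158"
  shows "x \<noteq> 0" "- 845/1000 \<le> x" "x \<le> 765/1000"
proof -
  have "real_of_int (- (845 * 2 ^ 158)) \<le> real_of_int (1000 * i)" "real_of_int (1000 * i) \<le> real_of_int (765 * 2 ^ 158)"
    using assms(1) unfolding in_range_def of_int_le_iff by blast+
  then show "- 845/1000 \<le> x" "x \<le> 765/1000" unfolding assms(2) by simp_all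
  show "x \<noteq> 0" using assms by (simp add: in_range_def)
qed

lemma z_hit: "i < 36 \<Longrightarrow> \<bar>2 ^ 158 * hit Z_coeffs (z_pt i) - real_of_int (z_vals ! i)\<bar> \<le> \<bar>z_pt i\<bar> * 700 + 7"
  unfolding Z_coeffs_def
proof (rule certified_value[OF Z_small[unfolded Z_coeffs_def] _ z_digest])
  assume i: "i < 36"
  show "z_pt i = real_of_int (z_args ! i) / 2 ^ 158" by (simp add: z_pt_def)
  have r: "in_range (z_args ! i)" using data_checks(1,5) i by (simp add: list_all_length)
  show "z_pt i \<noteq> 0" "- 845/1000 \<le> z_pt i" "z_pt i \<le> 765/1000" by (rule in_rangeD[OF r z_pt_def])+
  have "map (\<lambda>U. shr (tmpl 158) (smul U (horner (tmpl 158) U (map sg_of z_coeffs)))) (map sg_of z_args) ! i = map sg_of z_vals ! i"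
    unfolding evals_map[symmetric] z_evals ..
  then show "shr (tmpl 158) (smul (sg_of (z_args ! i)) (horner (tmpl 158) (sg_of (z_args ! i)) (map sg_of z_coeffs))) = sg_of (z_vals ! i)"
    using i data_checks(1,3) by simp
qed (simp_all add: shell_def power_divide)

lemma w_hit: "i < 34 \<Longrightarrow> \<bar>2 ^ 158 * hit W_coeffs (w_pt i) - real_of_int (w_vals ! i)\<bar> \<le> \<bar>w_pt i\<bar> * 700 + 7"
  unfolding W_coeffs_def
proof (rule certified_value[OF W_small[unfolded W_coeffs_def] _ w_digest])
  assume i: "i < 34"
  show "w_pt i = real_of_int (w_args ! i) / 2 ^ 158" by (simp add: w_pt_def)
  have r: "in_range (w_args ! i)" using data_checks(2,6) i by (simp add: list_all_length)
  show "w_pt i \<noteq> 0" "- 845/1000 \<le> w_pt i" "w_pt i \<le> 765/1000" by (rule in_rangeD[OF r w_pt_def])+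
  have "map (\<lambda>U. shr (tmpl 158) (smul U (horner (tmpl 158) U (map sg_of w_coeffs)))) (map sg_of w_args) ! i = map sg_of w_vals ! i"
    unfolding evals_map[symmetric] w_evals ..
  then show "shr (tmpl 158) (smul (sg_of (w_args ! i)) (horner (tmpl 158) (sg_of (w_args ! i)) (map sg_of w_coeffs))) = sg_of (w_vals ! i)"
    using i data_checks(2,4) by simp
qed (simp_all add: shell_def power_divide)

lemma z_less: "separated (z_args ! i) (z_vals ! i) (z_args ! j) (z_vals ! j) \<Longrightarrow> i < 36 \<Longrightarrow> j < 36 \<Longrightarrow> hit Z_coeffs (z_pt i) < hit Z_coeffs (z_pt j)"
  by (rule hit_compare[OF z_hit z_hit z_pt_def z_pt_def]) (simp_all only: separated_def)

lemma w_less: "separated (w_args ! i) (w_vals ! i) (w_args ! j) (w_vals ! j) \<Longrightarrow> i < 34 \<Longrightarrow> j < 34 \<Longrightarrow> hit W_coeffs (w_pt i) < hit W_coeffs (w_pt j)"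
  by (rule hit_compare[OF w_hit w_hit w_pt_def w_pt_def]) (simp_all only: separated_def)

lemma z_pt_order:
  "\<bar>shift\<bar> < z_pt 0" "z_pt 35 < - \<bar>shift\<bar>" "z_pt 34 < z_pt 35" "\<bar>shift\<bar> \<le> 1/100"
  "k < 16 \<Longrightarrow> z_pt k < z_pt (Suc k)" "k < 17 \<Longrightarrow> z_pt (17 + k) < - \<bar>shift\<bar>" "i < 36 \<Longrightarrow> - 845/1000 \<le> z_pt i \<and> z_pt i \<le> 765/1000"
proof -
  have s: "\<bar>shift\<bar> = real_of_int \<bar>shift_num\<bar> / 2 ^ 158" by (simp add: shift_def)
  have lt: "real_of_int a / 2 ^ 158 < real_of_int b / 2 ^ 158" if "a < b" for a b :: int
    using that by (intro divide_strict_right_mono) auto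
  have neg: "- (real_of_int a / 2 ^ 158) = real_of_int (- a) / 2 ^ 158" for a by simp
  show "\<bar>shift\<bar> < z_pt 0" unfolding s z_pt_def by (rule lt[OF data_checks(13)])
  show "z_pt 35 < - \<bar>shift\<bar>" unfolding s z_pt_def neg by (rule lt[OF data_checks(12)])
  show "z_pt 34 < z_pt 35" unfolding z_pt_def by (rule lt[OF data_checks(11)])
  have "real_of_int (\<bar>shift_num\<bar> * 100) \<le> real_of_int (2 ^ 158)" using data_checks(14) unfolding of_int_le_iff .
  then show "\<bar>shift\<bar> \<le> 1/100" unfolding s by simp
  show "z_pt k < z_pt (Suc k)" if "k < 16" unfolding z_pt_def by (rule lt) (use data_checks(8) that in \<open>simp add: list_all_iff\<close>)
  show "z_pt (17 + k) < - \<bar>shift\<bar>" if "k < 17" unfolding s z_pt_def neg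
    by (rule lt) (use data_checks(7) that in \<open>simp add: list_all_iff alternates_def\<close>)
  show "- 845/1000 \<le> z_pt i \<and> z_pt i \<le> 765/1000" if "i < 36"
    using in_rangeD[OF _ z_pt_def, of i] data_checks(1,5) that by (simp add: list_all_length)
qed

lemma sixteen_model_cycles:
  obtains C where "finite C" "card C = 16" "\<And>\<Gamma>. \<Gamma> \<in> C \<Longrightarrow> crossing_limit_cycle snd (upper_field Z_coeffs) (lower_field W_coeffs shift) \<Gamma>"
    "\<And>\<Gamma> v. \<Gamma> \<in> C \<Longrightarrow> v \<in> \<Gamma> \<Longrightarrow> norm v \<le> 4"
proof -
  have mono: "i \<le> j \<Longrightarrow> j \<le> 16 \<Longrightarrow> z_pt i \<le> z_pt j" for i j
  proof (induction j rule: dec_induct)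
    case (step j) then show ?case using z_pt_order(5)[of j] by auto
  qed simp
  have lt: "z_pt 0 < z_pt 16" using z_pt_order(5)[of 0] mono[of 1 16] by simp
  interpret matched_pair Z_coeffs W_coeffs shift "z_pt 0" "z_pt 16" "z_pt 34"
  proof
    show "0 < z_pt 0" using z_pt_order(1) by linarith
    show "z_pt 16 < 88/100" "-88/100 < z_pt 34" using z_pt_order(7)[of 16] z_pt_order(7)[of 34] by auto
    show "z_pt 34 < 0" using z_pt_order(2,3) by linarith
    show "hit Z_coeffs (z_pt 16) < hit Z_coeffs (z_pt 34)" by (rule z_less[OF data_checks(9)]) simp_all
  qed (use Z_small W_small z_pt_order(4) lt in auto)
  have h1: "hit Z_coeffs (z_pt 35) < hit Z_coeffs (z_pt 0)" by (rule z_less[OF data_checks(10)]) simp_all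
  have pn: "partner x < - \<bar>shift\<bar>" if x: "x \<in> {z_pt 0..z_pt 16}" for x
  proof (rule ccontr)
    assume "\<not> partner x < - \<bar>shift\<bar>"
    then have "z_pt 35 < partner x" using z_pt_order(2) by linarith
    then have "hit Z_coeffs (partner x) < hit Z_coeffs (z_pt 35)"
      using hit_less_neg[OF Z_small(1), of "z_pt 35" "partner x"] partner[OF x] z_pt_order(7)[of 35] by auto
    moreover have "hit Z_coeffs (z_pt 0) \<le> hit Z_coeffs x"
      using hit_less[OF Z_small(1), of "z_pt 0" x] x pq by (cases "x = z_pt 0") auto
    ultimately show False using partner[OF x] h1 by simp
  qed
  have sign: "if even k then gap (z_pt k) < 0 else 0 < gap (z_pt k)" if k: "k < 17" for k
  proof -
    have al: "alternates k" using data_checks(7) k by (simp add: list_all_iff)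
    have I: "z_pt k \<in> {z_pt 0..z_pt 16}" using mono[of 0 k] mono[of k 16] k by simp
    have w: "w_pt k = z_pt k - shift" "w_pt (17 + k) = z_pt (17 + k) - shift"
      using al unfolding alternates_def w_pt_def z_pt_def shift_def by (simp_all add: diff_divide_distrib)
    have lo: "-88/100 < z_pt (17 + k)" using z_pt_order(7)[of "17 + k"] k by auto
    note A = I lo z_pt_order(6)[OF k]
    have i: "k < 36" "17 + k < 36" "k < 34" "17 + k < 34" using k by auto
    show ?thesis
    proof (cases "even k")
      case True
      then have "hit Z_coeffs (z_pt (17 + k)) < hit Z_coeffs (z_pt k)" "hit W_coeffs (w_pt k) < hit W_coeffs (w_pt (17 + k))"
        using al z_less[OF _ i(2,1)] w_less[OF _ i(3,4)] unfolding alternates_def by auto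
      then show ?thesis using gap_negative[OF A] True unfolding w by simp
    next
      case False
      then have "hit Z_coeffs (z_pt k) < hit Z_coeffs (z_pt (17 + k))" "hit W_coeffs (w_pt (17 + k)) < hit W_coeffs (w_pt k)"
        using al z_less[OF _ i(1,2)] w_less[OF _ i(4,3)] unfolding alternates_def by auto
      then show ?thesis using gap_positive[OF A pn[OF I]] False unfolding w by simp
    qed
  qed
  have "z_pt k < z_pt (Suc k) \<and> gap (z_pt k) * gap (z_pt (Suc k)) < 0" if "k < 16" for k
    using z_pt_order(5)[OF that] sign[of k] sign[of "Suc k"] that by (cases "even k") (auto intro: mult_neg_pos mult_pos_neg)
  from cycles_from_sign_changes[of z_pt 16, OF refl refl this _ z_pt_order(3,2) h1 z_pt_order(1)] that show ?thesis by auto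
qed

theorem proposition4p7:
  fixes U :: "(real \<times> real) set"
  assumes "(0, 0) \<in> interior U"
  shows "\<exists>\<epsilon>\<^sub>0>0. \<forall>\<epsilon>. 0 < \<bar>\<epsilon>\<bar> \<and> \<bar>\<epsilon>\<bar> < \<epsilon>\<^sub>0 \<longrightarrow>
           (\<exists>pp qp pm qm. \<exists>C. finite C \<and> card C \<ge> 16 \<and>
              (\<forall>\<Gamma>\<in>C. \<Gamma> \<subseteq> U \<and>
                 crossing_limit_cycle h_line (quad_field \<epsilon> pp qp) (quad_field \<epsilon> pm qm) \<Gamma>))"
proof (intro exI[of _ 1] conjI allI impI)
  fix \<epsilon> :: real assume "0 < \<bar>\<epsilon>\<bar> \<and> \<bar>\<epsilon>\<bar> < 1"
  then have e: "\<epsilon> \<noteq> 0" by auto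
  obtain C where C: "finite C" "card C = 16" "\<And>\<Gamma>. \<Gamma> \<in> C \<Longrightarrow> crossing_limit_cycle snd (upper_field Z_coeffs) (lower_field W_coeffs shift) \<Gamma>"
    "\<And>\<Gamma> v. \<Gamma> \<in> C \<Longrightarrow> v \<in> \<Gamma> \<Longrightarrow> norm v \<le> 4" using sixteen_model_cycles by blast
  obtain pp qp pm qm D where "finite D" "card D = card C"
    "\<forall>\<Gamma>\<in>D. \<Gamma> \<subseteq> U \<and> crossing_limit_cycle h_line (quad_field \<epsilon> pp qp) (quad_field \<epsilon> pm qm) \<Gamma>"
    using realize[where z = Z_coeffs and w = W_coeffs and c = shift and R = 4 and C = C, OF assms C(1) C(3) _ e] C(4) by blast
  then show "\<exists>pp qp pm qm. \<exists>C. finite C \<and> card C \<ge> 16 \<and>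
              (\<forall>\<Gamma>\<in>C. \<Gamma> \<subseteq> U \<and> crossing_limit_cycle h_line (quad_field \<epsilon> pp qp) (quad_field \<epsilon> pm qm) \<Gamma>)"
    using C(2) by (intro exI[of _ pp] exI[of _ qp] exI[of _ pm] exI[of _ qm] exI[of _ D]) simp
qed simp

end
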